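(* Let $\sigma>0$, let $f=(f_1,\dots,f_d):\mathbb{R}^d\to\mathbb{R}^d$ be of class $C^\infty$, let $x_0\in\mathbb{R}^d$ and $y_0=f(x_0)$, and let $H$ be the RKHS on $\mathbb{R}^d$ of the kernel $k(x,y)=e^{(x-x_0)^\top(y-x_0)/\sigma^2}$. Assume that $f^\alpha:=f_1^{\alpha_1}\cdots f_d^{\alpha_d}\in H$ for all $\alpha\in\mathbb{Z}_{\ge0}^d$. Let $x_1,x_2,\dots$ be i.i.d. random variables whose distribution has a compactly supported density $\rho$ such that $\operatorname{ess\,inf}_{x\in U}\rho(x)>0$ for some nonempty open $U\subset\mathbb{R}^d$, and let $y_i=f(x_i)$. Let $\widehat f_{m,n,N}:\mathbb{R}^d\to\mathbb{R}^d$ be the output of the reconstruction algorithm described in the context, for $1\le m\le n$ and $N\ge\binom{n+d}{d}$. Then for every compact set $K\subset\mathbb{R}^d$, almost surely, $$\lim_{m\to\infty}\lim_{n\to\infty}\lim_{N\to\infty}\ \sup_{y\in K}\big\|f(y)-\widehat f_{m,n,N}(y)\big\|=0 .$$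
   Context: Reconstruction algorithm. Fix an enumeration $\{\alpha^{(i)}\}_{i\ge1}$ of $\mathbb{Z}_{\ge0}^d$ with $|\alpha^{(i)}|\le|\alpha^{(j)}|$ for $i\le j$, and with $\alpha^{(1)}=0$ and $\alpha^{(i+1)}=e_i$ (the $i$-th standard unit vector) for $i=1,\dots,d$. Let $r_n:=\binom{n+d}{d}$, $v_i(x):=(x-x_0)^{\alpha^{(i)}}/\sigma^{|\alpha^{(i)}|}$, and $\mathbf{v}_n(x):=(v_i(x))_{i=1}^{r_n}$. Given data $X=(x_1,\dots,x_N)$, $Y=(y_1,\dots,y_N)$, set $\widetilde y_i:=y_i-y_0+x_0$ and form $$\mathbf{V}_n^X:=(\mathbf{v}_n(x_1),\dots,\mathbf{v}_n(x_N))\in\mathbb{R}^{r_n\times N},\qquad \mathbf{V}_m^{\widetilde Y}:=(\mathbf{v}_m(\widetilde y_1),\dots,\mathbf{v}_m(\widetilde y_N))\in\mathbb{R}^{r_m\times N}.$$ Let $\widehat{\mathbf{C}}\in\mathbb{R}^{r_m\times r_m}$ be the matrix formed by the first $r_m$ columns of $\mathbf{V}_m^{\widetilde Y}(\mathbf{V}_n^X)^\dagger$ ($\dagger$ = Moore–Penrose pseudo-inverse). The output is $\widehat f_{m,n,N}=(\widehat f_1,\dots,\widehat f_d)$, where $\widehat f_i(x)$ is the $(i+1)$-th component of $\sigma\,\widehat{\mathbf{C}}\,\mathbf{v}_m(x)$ plus the $i$-th component of $y_0$. *)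

theory Defs
  imports "Jordan_Normal_Form.Matrix" "HOL-Probability.Probability"
begin

no_notation Matrix.vec_index (infixl \<open>$\<close> 100)
no_notation Matrix.scalar_prod (infix \<open>\<bullet>\<close> 70)

primrec Ck :: "nat \<Rightarrow> ('a::euclidean_space \<Rightarrow> 'b::euclidean_space) \<Rightarrow> bool" where
  "Ck 0 f \<longleftrightarrow> continuous_on UNIV f"
| "Ck (Suc k) f \<longleftrightarrow>
     (\<forall>x. f differentiable (at x)) \<and> (\<forall>v. Ck k (\<lambda>x. frechet_derivative f (at x) v))"

definition Cinfinity :: "('a::euclidean_space \<Rightarrow> 'b::euclidean_space) \<Rightarrow> bool" where
  "Cinfinity f \<longleftrightarrow> (\<forall>k. Ck k f)"

text \<open>The predicate \<open>is_rkhs k H ip\<close>: the set \<open>H\<close> of real-valued functions with inner product \<open>ip\<close> is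
  the RKHS of the kernel \<open>k\<close>. By Moore--Aronszajn, for a positive semidefinite \<open>k\<close>
  there is exactly one such \<open>H\<close>, and \<open>ip\<close> is unique on \<open>H\<close>;
  its values outside \<open>H\<close> are irrelevant.\<close>

definition real_inner_on ::
  "('a \<Rightarrow> real) set \<Rightarrow> (('a \<Rightarrow> real) \<Rightarrow> ('a \<Rightarrow> real) \<Rightarrow> real) \<Rightarrow> bool" where
  "real_inner_on H ip \<longleftrightarrow>
     (\<lambda>_. 0) \<in> H \<and>
     (\<forall>g\<in>H. \<forall>h\<in>H. (\<lambda>x. g x + h x) \<in> H) \<and>
     (\<forall>c. \<forall>g\<in>H. (\<lambda>x. c * g x) \<in> H) \<and>
     (\<forall>g\<in>H. \<forall>h\<in>H. ip g h = ip h g) \<and>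
     (\<forall>g\<in>H. \<forall>h\<in>H. \<forall>u\<in>H. ip (\<lambda>x. g x + h x) u = ip g u + ip h u) \<and>
     (\<forall>c. \<forall>g\<in>H. \<forall>u\<in>H. ip (\<lambda>x. c * g x) u = c * ip g u) \<and>
     (\<forall>g\<in>H. 0 \<le> ip g g \<and> (ip g g = 0 \<longrightarrow> g = (\<lambda>_. 0)))"

definition ip_dist ::
  "(('a \<Rightarrow> real) \<Rightarrow> ('a \<Rightarrow> real) \<Rightarrow> real) \<Rightarrow> ('a \<Rightarrow> real) \<Rightarrow> ('a \<Rightarrow> real) \<Rightarrow> real" where
  "ip_dist ip g h = sqrt (ip (\<lambda>x. g x - h x) (\<lambda>x. g x - h x))"

definition ip_complete ::
  "('a \<Rightarrow> real) set \<Rightarrow> (('a \<Rightarrow> real) \<Rightarrow> ('a \<Rightarrow> real) \<Rightarrow> real) \<Rightarrow> bool" where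
  "ip_complete H ip \<longleftrightarrow>
     (\<forall>s :: nat \<Rightarrow> 'a \<Rightarrow> real.
        (\<forall>i. s i \<in> H) \<and> (\<forall>e>0. \<exists>N. \<forall>i\<ge>N. \<forall>j\<ge>N. ip_dist ip (s i) (s j) < e) \<longrightarrow>
        (\<exists>h\<in>H. (\<lambda>i. ip_dist ip (s i) h) \<longlonglongrightarrow> 0))"

definition is_rkhs ::
  "('a \<Rightarrow> 'a \<Rightarrow> real) \<Rightarrow> ('a \<Rightarrow> real) set \<Rightarrow> (('a \<Rightarrow> real) \<Rightarrow> ('a \<Rightarrow> real) \<Rightarrow> real) \<Rightarrow> bool" where
  "is_rkhs k H ip \<longleftrightarrow>
     real_inner_on H ip \<and> ip_complete H ip \<and>
     (\<forall>x. k x \<in> H) \<and> (\<forall>x. \<forall>g\<in>H. ip g (k x) = g x)"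

definition exp_kernel :: "real \<Rightarrow> 'a::real_inner \<Rightarrow> 'a \<Rightarrow> 'a \<Rightarrow> real" where
  "exp_kernel \<sigma> x0 x y = exp (inner (x - x0) (y - x0) / \<sigma>\<^sup>2)"

definition essinf :: "'a measure \<Rightarrow> ('a \<Rightarrow> real) \<Rightarrow> ereal" where
  "essinf M g = - esssup M (\<lambda>x. - ereal (g x))"

text \<open>The case distinction fixes the supremum of norms over the empty set to be 0, since
  \<open>Sup\<close> on the reals is unspecified there.\<close>

definition sup_norm_on :: "'a set \<Rightarrow> ('a \<Rightarrow> 'b::real_normed_vector) \<Rightarrow> real" where
  "sup_norm_on K g = (if K = {} then 0 else (SUP y\<in>K. norm (g y)))"

definition is_pinv :: "real mat \<Rightarrow> real mat \<Rightarrow> bool" where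
  "is_pinv A B \<longleftrightarrow>
     B \<in> carrier_mat (dim_col A) (dim_row A) \<and>
     A * B * A = A \<and> B * A * B = B \<and>
     transpose_mat (A * B) = A * B \<and> transpose_mat (B * A) = B * A"

definition pinv :: "real mat \<Rightarrow> real mat" where
  "pinv A = (THE B. is_pinv A B)"

definition mdeg :: "nat ^ 'd::finite \<Rightarrow> nat" where
  "mdeg \<alpha> = (\<Sum>j\<in>UNIV. \<alpha> $ j)"

definition mpow :: "real ^ 'd::finite \<Rightarrow> nat ^ 'd \<Rightarrow> real" where
  "mpow x \<alpha> = (\<Prod>j\<in>UNIV. (x $ j) ^ (\<alpha> $ j))"

text \<open>Indices are 0-based: \<open>\<alpha> i\<close> is the multi-index written \<open>\<alpha>\<close> with superscript \<open>(i+1)\<close>, and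
  \<open>c i\<close> (for \<open>i < d\<close>) is the \<open>(i+1)\<close>-th coordinate. As the index type carries no
  order, the numbering \<open>c\<close> of the coordinates is part of the data.\<close>

definition graded_enum :: "(nat \<Rightarrow> 'd::finite) \<Rightarrow> (nat \<Rightarrow> nat ^ 'd) \<Rightarrow> bool" where
  "graded_enum c \<alpha> \<longleftrightarrow>
     bij_betw c {..<CARD('d)} UNIV \<and> bij \<alpha> \<and>
     (\<forall>i j. i \<le> j \<longrightarrow> mdeg (\<alpha> i) \<le> mdeg (\<alpha> j)) \<and>
     \<alpha> 0 = 0 \<and> (\<forall>i<CARD('d). \<alpha> (Suc i) = axis (c i) 1)"

definition rdim :: "'d::finite itself \<Rightarrow> nat \<Rightarrow> nat" where
  "rdim _ n = (n + CARD('d)) choose CARD('d)"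

definition vbasis ::
  "(nat \<Rightarrow> nat ^ 'd::finite) \<Rightarrow> real \<Rightarrow> real ^ 'd \<Rightarrow> nat \<Rightarrow> real ^ 'd \<Rightarrow> real Matrix.vec" where
  "vbasis \<alpha> \<sigma> x0 n x =
     Matrix.vec (rdim TYPE('d) n) (\<lambda>i. mpow (x - x0) (\<alpha> i) / \<sigma> ^ mdeg (\<alpha> i))"

definition Vmat ::
  "(nat \<Rightarrow> nat ^ 'd::finite) \<Rightarrow> real \<Rightarrow> real ^ 'd \<Rightarrow> nat \<Rightarrow> nat \<Rightarrow> (nat \<Rightarrow> real ^ 'd) \<Rightarrow> real mat" where
  "Vmat \<alpha> \<sigma> x0 n N z =
     mat_of_cols (rdim TYPE('d) n) (map (\<lambda>i. vbasis \<alpha> \<sigma> x0 n (z i)) [0..<N])"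

definition first_cols :: "nat \<Rightarrow> real mat \<Rightarrow> real mat" where
  "first_cols r A = Matrix.mat (dim_row A) r (\<lambda>(i, j). A $$ (i, j))"

text \<open>The data points are \<open>z 0, \<dots>, z (N - 1)\<close> with images \<open>w 0, \<dots>, w (N - 1)\<close>.\<close>

definition Chat ::
  "(nat \<Rightarrow> nat ^ 'd::finite) \<Rightarrow> real \<Rightarrow> real ^ 'd \<Rightarrow> real ^ 'd \<Rightarrow>
   (nat \<Rightarrow> real ^ 'd) \<Rightarrow> (nat \<Rightarrow> real ^ 'd) \<Rightarrow> nat \<Rightarrow> nat \<Rightarrow> nat \<Rightarrow> real mat" where
  "Chat \<alpha> \<sigma> x0 y0 z w m n N =
     first_cols (rdim TYPE('d) m)
       (Vmat \<alpha> \<sigma> x0 m N (\<lambda>i. w i - y0 + x0) * pinv (Vmat \<alpha> \<sigma> x0 n N z))"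

text \<open>With 0-based indices, coordinate \<open>c i\<close> of the output is entry \<open>Suc i\<close> of the vector.\<close>

definition fhat ::
  "(nat \<Rightarrow> 'd::finite) \<Rightarrow> (nat \<Rightarrow> nat ^ 'd) \<Rightarrow> real \<Rightarrow> real ^ 'd \<Rightarrow> real ^ 'd \<Rightarrow>
   (nat \<Rightarrow> real ^ 'd) \<Rightarrow> (nat \<Rightarrow> real ^ 'd) \<Rightarrow> nat \<Rightarrow> nat \<Rightarrow> nat \<Rightarrow> real ^ 'd \<Rightarrow> real ^ 'd" where
  "fhat c \<alpha> \<sigma> x0 y0 z w m n N x =
     (\<chi> j. vec_index (\<sigma> \<cdot>\<^sub>m Chat \<alpha> \<sigma> x0 y0 z w m n N *\<^sub>v vbasis \<alpha> \<sigma> x0 m x)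
             (Suc (inv_into {..<CARD('d)} c j)) + y0 $ j)"

end

theory Submission
  imports Defs "Jordan_Normal_Form.Determinant" "HOL-Computational_Algebra.Polynomial"
begin

no_notation Matrix.vec_index (infixl \<open>$\<close> 100)
no_notation Matrix.scalar_prod (infix \<open>\<bullet>\<close> 70)

text \<open>Write \<open>z = (x - x0) / \<sigma>\<close>. The monomials \<open>z\<^sup>\<beta>\<close> form an orthogonal system in \<open>H\<close> with squared norms
  \<open>\<beta>!\<close>, so that the Taylor polynomials of a function in \<open>H\<close> converge faster than any geometric
  sequence on compact sets. As the number of samples grows, the rows of the estimated matrix
  converge to the coefficients of the \<open>L\<^sup>2(\<rho>)\<close> projections of \<open>(f\<^sub>j - f\<^sub>j(x0)) / \<sigma>\<close> onto the
  polynomials of degree at most \<open>n\<close>, by the strong law of large numbers. Such a projection differs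
  from the Taylor polynomial of degree \<open>n\<close> by a polynomial with superexponentially small \<open>L\<^sup>2(\<rho>)\<close>
  norm, and the coefficients of a polynomial of degree \<open>n\<close> are at most \<open>C\<^sup>n\<close> times its \<open>L\<^sup>2(\<rho>)\<close> norm.
  Hence the coefficients converge to Taylor coefficients as \<open>n \<rightarrow> \<infinity>\<close>, and \<open>m \<rightarrow> \<infinity>\<close> is the convergence
  of the Taylor series.\<close>

section \<open>Replacing exponentials by powers in a reproducing kernel space\<close>

text \<open>The reproducing property describes kernel functions only, so neither membership of the
  monomials in \<open>H\<close> nor their inner products can be read off. The monomials arise from
  kernel functions by differentiation in the centre, carried out inside \<open>H\<close>: divided
  differences of kernel functions have explicit power series as Gram functions, and completeness
  turns convergence of Gram entries into convergence in \<open>H\<close>. A loss geometric in the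
  degree is affordable because the Taylor error beats every geometric rate. A coefficient bound with
  such a loss comes from equidistant grids: the spacing shrinks like 1/n, and the resulting power
  n^n is cancelled by the factorials in the Lagrange denominators. The same bound shows that a
  polynomial of zero norm has zero coefficients. The limiting Gram matrix is therefore nonsingular,
  and for large N the pseudo-inverse is the right inverse given by the normal equations, which
  passes to the limit. Only countably many empirical moments enter, and none depends on m or n, so
  one null set serves all limits.\<close>

definition shifted_series :: "(nat \<Rightarrow> real) \<Rightarrow> nat \<Rightarrow> real \<Rightarrow> real" where
  "shifted_series a n t = (\<Sum>j. a (j + n) * t ^ j)"

lemma shifted_series_summable:
  fixes a :: "nat \<Rightarrow> real"
  assumes "\<And>t. summable (\<lambda>j. a j * t ^ j)"
  shows "summable (\<lambda>j. a (j + n) * t ^ j)"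
proof (cases "t = 0")
  case False
  have "summable (\<lambda>j. a (j + n) * t ^ (j + n))"
    using assms[of t] by (subst summable_iff_shift)
  then have "summable (\<lambda>j. (a (j + n) * t ^ (j + n)) / t ^ n)"
    by (rule summable_divide)
  then show ?thesis using False by (simp add: power_add)
qed (auto intro!: summable_finite[of "{0}"])

lemma shifted_series_zero: "shifted_series a n 0 = a n"
  by (simp add: shifted_series_def)

text \<open>Solved for the last term, this is a divided difference: passing from \<open>n\<close> to
  \<open>Suc n\<close> subtracts the value at 0 and divides by \<open>t\<close>. The series also
  makes sense at \<open>t = 0\<close>, where the quotient does not.\<close>

lemma shifted_series_Suc:
  assumes "\<And>t. summable (\<lambda>j. a j * t ^ j)"
  shows "shifted_series a n t = a n + t * shifted_series a (Suc n) t"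
proof -
  have "shifted_series a n t = a n + (\<Sum>j. a (Suc j + n) * t ^ Suc j)"
    unfolding shifted_series_def using suminf_split_head[OF shifted_series_summable[OF assms], of n t]
    by simp
  also have "(\<Sum>j. a (Suc j + n) * t ^ Suc j) = (\<Sum>j. t * (a (j + Suc n) * t ^ j))"
    by (simp add: algebra_simps)
  also have "\<dots> = t * shifted_series a (Suc n) t"
    unfolding shifted_series_def by (rule suminf_mult[OF shifted_series_summable[OF assms]])
  finally show ?thesis .
qed

lemma shifted_series_isCont:
  assumes "\<And>t. summable (\<lambda>j. a j * t ^ j)"
  shows "isCont (shifted_series a n) t"
  unfolding shifted_series_def
  by (rule isCont_powser_converges_everywhere) (rule shifted_series_summable[OF assms])

abbreviation "exp_coeff \<equiv> (\<lambda>j. 1 / fact j :: real)"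

lemma exp_coeff_summable: "summable (\<lambda>j. exp_coeff j * t ^ j)"
  using summable_exp[of t] by (simp add: field_simps)

lemma shifted_series_exp: "shifted_series exp_coeff 0 t = exp t"
  by (simp add: shifted_series_def exp_def field_simps scaleR_conv_of_real)

locale fun_inner =
  fixes H :: "('a \<Rightarrow> real) set" and ip :: "('a \<Rightarrow> real) \<Rightarrow> ('a \<Rightarrow> real) \<Rightarrow> real"
  assumes inner_on: "real_inner_on H ip"
begin

lemma zero_mem: "(\<lambda>_. 0) \<in> H"
  and add_mem: "g \<in> H \<Longrightarrow> h \<in> H \<Longrightarrow> (\<lambda>x. g x + h x) \<in> H"
  and scale_mem: "g \<in> H \<Longrightarrow> (\<lambda>x. r * g x) \<in> H"
  and ip_sym: "g \<in> H \<Longrightarrow> h \<in> H \<Longrightarrow> ip g h = ip h g"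
  and ip_add: "g \<in> H \<Longrightarrow> h \<in> H \<Longrightarrow> u \<in> H \<Longrightarrow> ip (\<lambda>x. g x + h x) u = ip g u + ip h u"
  and ip_scale: "g \<in> H \<Longrightarrow> u \<in> H \<Longrightarrow> ip (\<lambda>x. r * g x) u = r * ip g u"
  and ip_nonneg: "g \<in> H \<Longrightarrow> 0 \<le> ip g g"
  using inner_on unfolding real_inner_on_def by blast+

lemma diff_mem:
  assumes "g \<in> H" "h \<in> H"
  shows "(\<lambda>x. g x - h x) \<in> H"
  using add_mem[OF assms(1) scale_mem[OF assms(2), of "-1"]] by simp

lemma ip_diff:
  assumes "g \<in> H" "h \<in> H" "u \<in> H"
  shows "ip (\<lambda>x. g x - h x) u = ip g u - ip h u"
  using ip_add[OF assms(1) scale_mem[OF assms(2), of "-1"] assms(3)] ip_scale[OF assms(2,3), of "-1"]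
  by simp

lemma sum_mem:
  assumes "finite I" "\<And>i. i \<in> I \<Longrightarrow> g i \<in> H"
  shows "(\<lambda>x. \<Sum>i\<in>I. r i * g i x) \<in> H"
  using assms by (induction I rule: finite_induct) (auto intro!: zero_mem add_mem scale_mem)

lemma ip_zero: "u \<in> H \<Longrightarrow> ip (\<lambda>_. 0) u = 0"
  using ip_scale[OF zero_mem, of u 0] by simp

lemma ip_sum:
  assumes "finite I" "\<And>i. i \<in> I \<Longrightarrow> g i \<in> H" "u \<in> H"
  shows "ip (\<lambda>x. \<Sum>i\<in>I. r i * g i x) u = (\<Sum>i\<in>I. r i * ip (g i) u)"
  using assms
proof (induction I rule: finite_induct)
  case (insert i I)
  then have "(\<lambda>x. \<Sum>i\<in>I. r i * g i x) \<in> H" by (intro sum_mem) auto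
  then show ?case using insert by (simp add: ip_add[OF scale_mem] ip_scale)
qed (simp add: ip_zero)

lemma ip_diff_diff:
  assumes "g \<in> H" "h \<in> H"
  shows "ip (\<lambda>x. g x - h x) (\<lambda>x. g x - h x) = ip g g - 2 * ip g h + ip h h"
  using assms by (simp add: ip_diff diff_mem ip_sym[of _ "\<lambda>x. g x - h x"] ip_sym[of h g])

lemma cauchy_schwarz:
  assumes "g \<in> H" "h \<in> H"
  shows "(ip g h)\<^sup>2 \<le> ip g g * ip h h"
proof -
  have *: "0 \<le> ip g g - 2 * r * ip g h + r\<^sup>2 * ip h h" for r
  proof -
    have rh: "(\<lambda>x. r * h x) \<in> H" using assms scale_mem by blast
    have "ip g (\<lambda>x. r * h x) = r * ip g h"
      using assms rh by (metis ip_scale ip_sym)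
    moreover have "ip (\<lambda>x. r * h x) (\<lambda>x. r * h x) = r\<^sup>2 * ip h h"
      using assms rh by (metis ip_scale ip_sym power2_eq_square mult.assoc)
    ultimately show ?thesis
      using ip_nonneg[OF diff_mem[OF assms(1) rh]] ip_diff_diff[OF assms(1) rh] by simp
  qed
  show ?thesis
  proof (cases "ip h h = 0")
    case True
    have "ip g h = 0"
    proof (rule ccontr)
      assume "ip g h \<noteq> 0"
      \<comment> \<open>As \<open>ip h h\<close> vanishes, the bound is affine in \<open>r\<close>;
        this choice of \<open>r\<close> makes its right-hand side equal to -1.\<close>
      then show False using *[of "(ip g g + 1) / (2 * ip g h)"] True by simp
    qed
    then show ?thesis using True by simp
  next
    case False
    then have pos: "ip h h > 0" using ip_nonneg[OF assms(2)] by simp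
    have "0 \<le> ip g g - (ip g h)\<^sup>2 / ip h h"
      using *[of "ip g h / ip h h"] pos by (simp add: power2_eq_square)
    then show ?thesis using pos by (simp add: field_simps)
  qed
qed

end

locale rkhs_fun = fun_inner +
  fixes k :: "'a \<Rightarrow> 'a \<Rightarrow> real"
  assumes complete: "ip_complete H ip"
    and kernel_mem: "k x \<in> H"
    and reproducing: "g \<in> H \<Longrightarrow> ip g (k x) = g x"
begin

text \<open>The squared distance of \<open>s i\<close> and \<open>s j\<close> is a combination of
  Gram entries that tends to L - 2 L + L = 0, so the sequence is Cauchy without any candidate for
  its limit. Pointwise convergence follows because evaluation is the inner product with a kernel
  function; it serves to identify the limit.\<close>

lemma ip_limit:
  fixes s :: "nat \<Rightarrow> 'a \<Rightarrow> real"
  assumes s: "\<And>i. s i \<in> H"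
    and gram: "((\<lambda>(i, j). ip (s i) (s j)) \<longlongrightarrow> L) (sequentially \<times>\<^sub>F sequentially)"
  obtains h where "h \<in> H" "\<And>g. g \<in> H \<Longrightarrow> (\<lambda>i. ip g (s i)) \<longlonglongrightarrow> ip g h"
    "\<And>x. (\<lambda>i. s i x) \<longlonglongrightarrow> h x"
proof -
  have "\<exists>N. \<forall>i\<ge>N. \<forall>j\<ge>N. ip_dist ip (s i) (s j) < e" if "e > 0" for e
  proof -
    have "e\<^sup>2 / 4 > 0" using that by simp
    then have "\<forall>\<^sub>F p in sequentially \<times>\<^sub>F sequentially. \<bar>(case p of (i, j) \<Rightarrow> ip (s i) (s j)) - L\<bar> < e\<^sup>2 / 4"
      using tendstoD[OF gram, of "e\<^sup>2 / 4"] by (simp only: dist_real_def)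
    then obtain P Q where P: "eventually P sequentially" and Q: "eventually Q sequentially"
      and PQ: "\<And>i j. P i \<Longrightarrow> Q j \<Longrightarrow> \<bar>ip (s i) (s j) - L\<bar> < e\<^sup>2 / 4"
      unfolding eventually_prod_filter by auto
    have "eventually (\<lambda>i. P i \<and> Q i) sequentially" using P Q by (rule eventually_conj)
    then obtain N where N: "\<And>i. i \<ge> N \<Longrightarrow> P i \<and> Q i"
      unfolding eventually_sequentially by blast
    \<comment> \<open>The absolute values of the coefficients 1, -2, 1 of the Gram entries add up to
      4, hence the quarter.\<close>
    have "ip_dist ip (s i) (s j) < e" if ij: "i \<ge> N" "j \<ge> N" for i j
    proof -
      have "\<bar>ip (s i) (s i) - L\<bar> < e\<^sup>2 / 4" "\<bar>ip (s i) (s j) - L\<bar> < e\<^sup>2 / 4" "\<bar>ip (s j) (s j) - L\<bar> < e\<^sup>2 / 4"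
        using PQ N ij by blast+
      then have "ip (\<lambda>x. s i x - s j x) (\<lambda>x. s i x - s j x) < e\<^sup>2"
        using ip_diff_diff[OF s s, of i j] by linarith
      then show ?thesis unfolding ip_dist_def using \<open>e > 0\<close>
        by (metis real_sqrt_less_iff real_sqrt_unique less_eq_real_def)
    qed
    then show ?thesis by blast
  qed
  then obtain h where h: "h \<in> H" and lim: "(\<lambda>i. ip_dist ip (s i) h) \<longlonglongrightarrow> 0"
    using complete[unfolded ip_complete_def, rule_format, of s] s by blast
  have lim': "(\<lambda>i. ip g (s i)) \<longlonglongrightarrow> ip g h" if g: "g \<in> H" for g
  proof -
    have "\<bar>ip g (s i) - ip g h\<bar> \<le> sqrt (ip g g) * ip_dist ip (s i) h" for i
    proof -
      have d: "(\<lambda>x. s i x - h x) \<in> H" using s h by (rule diff_mem)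
      have "ip g (s i) - ip g h = ip g (\<lambda>x. s i x - h x)"
        using g s h d by (simp add: ip_sym[of g] ip_diff)
      then have "(ip g (s i) - ip g h)\<^sup>2 \<le> ip g g * ip (\<lambda>x. s i x - h x) (\<lambda>x. s i x - h x)"
        using cauchy_schwarz[OF g d] by simp
      then show ?thesis unfolding ip_dist_def
        by (metis real_sqrt_abs real_sqrt_le_mono real_sqrt_mult)
    qed
    moreover have "(\<lambda>i. sqrt (ip g g) * ip_dist ip (s i) h) \<longlonglongrightarrow> 0"
      using tendsto_mult_left[OF lim, of "sqrt (ip g g)"] by simp
    ultimately have "(\<lambda>i. ip g (s i) - ip g h) \<longlonglongrightarrow> 0"
      unfolding real_norm_def[symmetric] by (rule Lim_null_comparison[OF always_eventually[OF allI]])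
    then show ?thesis by (rule LIM_zero_cancel)
  qed
  have "(\<lambda>i. s i x) \<longlonglongrightarrow> h x" for x
  proof -
    have "ip (k x) (s i) = s i x" for i using ip_sym[OF kernel_mem s] reproducing[OF s] by simp
    moreover have "ip (k x) h = h x" using ip_sym[OF kernel_mem h] reproducing[OF h] by simp
    ultimately show ?thesis using lim'[OF kernel_mem[of x]] by simp
  qed
  then show thesis using that h lim' by blast
qed

text \<open>One coordinate is treated at a time: \<xi> is that coordinate, and \<open>B\<close>
  collects the factors of all the others. Up to the factor \<open>r\<close>, the Gram function is
  that of the exponential kernel in one variable.\<close>

context
  fixes B \<xi> :: "'a \<Rightarrow> real" and r :: real
  assumes exp_mem: "\<And>t. (\<lambda>x. B x * exp (t * \<xi> x)) \<in> H"
    and ip_exp: "\<And>s t. ip (\<lambda>x. B x * exp (s * \<xi> x)) (\<lambda>x. B x * exp (t * \<xi> x)) = r * exp (s * t)"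
begin

text \<open>\<open>exp_quotient n t\<close> is the \<open>n\<close>-th divided difference of the family \<open>B exp(t \<xi>)\<close> in \<open>t\<close>
  with nodes \<open>0, \<dots>, 0, t\<close>. Its Gram function is again an explicit power series, so that the
  limit \<open>t \<rightarrow> 0\<close> exists in \<open>H\<close>.\<close>

definition exp_quotient :: "nat \<Rightarrow> real \<Rightarrow> 'a \<Rightarrow> real" where
  "exp_quotient n t = (\<lambda>x. B x * \<xi> x ^ n * shifted_series exp_coeff n (t * \<xi> x))"

lemma exp_quotient_Suc:
  assumes "t \<noteq> 0"
  shows "exp_quotient (Suc n) t = (\<lambda>x. (1 / t) * (exp_quotient n t x - exp_quotient n 0 x))"
proof
  fix x
  show "exp_quotient (Suc n) t x = (1 / t) * (exp_quotient n t x - exp_quotient n 0 x)"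
    unfolding exp_quotient_def mult_zero_left shifted_series_zero
    using assms by (subst shifted_series_Suc[OF exp_coeff_summable, of n]) (simp add: field_simps)
qed

abbreviation "inv_seq \<equiv> (\<lambda>i. 1 / real (Suc i))"

lemma inv_seq: "filterlim inv_seq (nhds 0) sequentially"
  using LIMSEQ_inverse_real_of_nat by (simp add: inverse_eq_divide)

lemma shifted_series_inv_seq:
  assumes "\<And>t. summable (\<lambda>j. a j * t ^ j)"
  shows "(\<lambda>i. shifted_series a n (inv_seq i * u)) \<longlonglongrightarrow> a n"
proof -
  have "(\<lambda>i. inv_seq i * u) \<longlonglongrightarrow> 0" using tendsto_mult_right[OF inv_seq, of u] tendsto_mult_left_zero[OF inv_seq] by blast
  then have "(\<lambda>i. shifted_series a n (inv_seq i * u)) \<longlonglongrightarrow> shifted_series a n 0"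
    by (rule isCont_tendsto_compose[OF shifted_series_isCont[OF assms]])
  then show ?thesis by (simp add: shifted_series_zero)
qed

text \<open>At parameter 0 the recursion would divide by zero, so this value is reached along
  \<open>inv_seq\<close>. The Gram entries depend on the product of the parameters alone and hence
  converge; the pointwise limit shows that the limit in \<open>H\<close> is
  \<open>exp_quotient n 0\<close>.\<close>

lemma exp_quotient_limit:
  assumes mem: "\<And>t. t \<noteq> 0 \<Longrightarrow> exp_quotient n t \<in> H"
    and ip: "\<And>s t. s \<noteq> 0 \<Longrightarrow> t \<noteq> 0 \<Longrightarrow>
      ip (exp_quotient n s) (exp_quotient n t) = r * shifted_series exp_coeff n (s * t)"
  shows "exp_quotient n 0 \<in> H"
    "g \<in> H \<Longrightarrow> (\<lambda>i. ip g (exp_quotient n (inv_seq i))) \<longlonglongrightarrow> ip g (exp_quotient n 0)"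
proof -
  have nz: "inv_seq i \<noteq> 0" for i by simp
  have "((\<lambda>(i, j). inv_seq i * inv_seq j) \<longlongrightarrow> 0 * 0) (sequentially \<times>\<^sub>F sequentially)"
    unfolding case_prod_unfold
    by (intro tendsto_mult filterlim_compose[OF inv_seq] filterlim_fst filterlim_snd)
  then have "((\<lambda>p. shifted_series exp_coeff n (case p of (i, j) \<Rightarrow> inv_seq i * inv_seq j)) \<longlongrightarrow>
      shifted_series exp_coeff n 0) (sequentially \<times>\<^sub>F sequentially)"
    by (intro isCont_tendsto_compose[OF shifted_series_isCont[OF exp_coeff_summable]]) simp
  then have "((\<lambda>(i, j). ip (exp_quotient n (inv_seq i)) (exp_quotient n (inv_seq j))) \<longlongrightarrow>
      r * shifted_series exp_coeff n 0) (sequentially \<times>\<^sub>F sequentially)"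
    unfolding case_prod_unfold ip[OF nz nz] by (rule tendsto_mult_left)
  then obtain h where h: "h \<in> H"
    "\<And>g. g \<in> H \<Longrightarrow> (\<lambda>i. ip g (exp_quotient n (inv_seq i))) \<longlonglongrightarrow> ip g h"
    "\<And>x. (\<lambda>i. exp_quotient n (inv_seq i) x) \<longlonglongrightarrow> h x"
    using ip_limit[of "\<lambda>i. exp_quotient n (inv_seq i)"] mem[OF nz] by blast
  have "(\<lambda>i. exp_quotient n (inv_seq i) x) \<longlonglongrightarrow> exp_quotient n 0 x" for x
    unfolding exp_quotient_def mult_zero_left shifted_series_zero
    by (intro tendsto_mult_left shifted_series_inv_seq exp_coeff_summable)
  then have "h = exp_quotient n 0" using h(3) LIMSEQ_unique by blast
  then show "exp_quotient n 0 \<in> H"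
    "g \<in> H \<Longrightarrow> (\<lambda>i. ip g (exp_quotient n (inv_seq i))) \<longlonglongrightarrow> ip g (exp_quotient n 0)"
    using h by blast+
qed

text \<open>For nonzero parameters, expanding both difference quotients leaves the value of the
  previous series at \<open>s * t\<close> minus its value at 0, divided by \<open>s * t\<close>: the
  next shifted series. Zero parameters are then reached by limits, one argument at a time.\<close>

lemma exp_quotient_mem_ip:
  "exp_quotient n s \<in> H \<and> exp_quotient n t \<in> H \<and>
   ip (exp_quotient n s) (exp_quotient n t) = r * shifted_series exp_coeff n (s * t)"
proof (induction n arbitrary: s t)
  case 0
  then show ?case using exp_mem ip_exp by (simp add: exp_quotient_def shifted_series_exp)
next
  case (Suc n)
  have mem: "exp_quotient n t \<in> H" for t using Suc by blast
  have ip: "ip (exp_quotient n s) (exp_quotient n t) = r * shifted_series exp_coeff n (s * t)" for s t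
    using Suc by blast
  have mem': "exp_quotient (Suc n) t \<in> H" if "t \<noteq> 0" for t
    unfolding exp_quotient_Suc[OF that] by (intro scale_mem diff_mem mem)
  have ip': "ip (exp_quotient (Suc n) s) (exp_quotient (Suc n) t) =
      r * shifted_series exp_coeff (Suc n) (s * t)" if "s \<noteq> 0" "t \<noteq> 0" for s t
  proof -
    have *: "ip (exp_quotient (Suc n) s) g = (1 / s) * (ip (exp_quotient n s) g - ip (exp_quotient n 0) g)"
      if "g \<in> H" "s \<noteq> 0" for g s
      using that mem by (simp only: exp_quotient_Suc[OF that(2)] ip_scale diff_mem ip_diff)
    have **: "ip g (exp_quotient (Suc n) t) = (1 / t) * (ip (exp_quotient n t) g - ip (exp_quotient n 0) g)"
      if "g \<in> H" "t \<noteq> 0" for g t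
      using *[OF that] ip_sym[OF that(1) mem'[OF that(2)]] by simp
    have "ip (exp_quotient (Suc n) s) (exp_quotient (Suc n) t) =
        (1 / s) * (1 / t) * (ip (exp_quotient n t) (exp_quotient n s) - ip (exp_quotient n 0) (exp_quotient n s)
          - (ip (exp_quotient n t) (exp_quotient n 0) - ip (exp_quotient n 0) (exp_quotient n 0)))"
      unfolding *[OF mem'[OF that(2)] that(1)] **[OF mem that(2)] by (simp add: right_diff_distrib)
    also have "\<dots> = (1 / s) * (1 / t) * r * (shifted_series exp_coeff n (s * t) - exp_coeff n)"
      unfolding ip by (simp add: shifted_series_zero algebra_simps)
    also have "\<dots> = r * shifted_series exp_coeff (Suc n) (s * t)"
      using that by (subst shifted_series_Suc[OF exp_coeff_summable]) simp
    finally show ?thesis .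
  qed
  have lim: "exp_quotient (Suc n) 0 \<in> H"
    "(\<lambda>i. ip g (exp_quotient (Suc n) (inv_seq i))) \<longlonglongrightarrow> ip g (exp_quotient (Suc n) 0)"
    if "g \<in> H" for g
    using exp_quotient_limit[of "Suc n"] mem' ip' that by blast+
  have mem'': "exp_quotient (Suc n) t \<in> H" for t using mem' lim(1)[OF zero_mem] by (cases "t = 0") auto
  have ip0: "ip (exp_quotient (Suc n) s) (exp_quotient (Suc n) 0) =
      r * shifted_series exp_coeff (Suc n) 0" if "s \<noteq> 0" for s
  proof (rule LIMSEQ_unique[OF lim(2)])
    have "(\<lambda>i. r * shifted_series exp_coeff (Suc n) (inv_seq i * s)) \<longlonglongrightarrow> r * exp_coeff (Suc n)"
      by (intro tendsto_mult_left shifted_series_inv_seq exp_coeff_summable)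
    then show "(\<lambda>i. ip (exp_quotient (Suc n) s) (exp_quotient (Suc n) (inv_seq i))) \<longlonglongrightarrow>
        r * shifted_series exp_coeff (Suc n) 0"
      using that by (simp add: ip' shifted_series_zero mult.commute[of s] del: of_nat_Suc)
  qed (use mem' that in auto)
  have ip00: "ip (exp_quotient (Suc n) 0) (exp_quotient (Suc n) 0) = r * shifted_series exp_coeff (Suc n) 0"
  proof (rule LIMSEQ_unique[OF lim(2)])
    show "(\<lambda>i. ip (exp_quotient (Suc n) 0) (exp_quotient (Suc n) (inv_seq i))) \<longlonglongrightarrow>
        r * shifted_series exp_coeff (Suc n) 0"
      unfolding ip_sym[OF mem'' mem'', of 0] by (simp add: ip0 del: of_nat_Suc)
  qed (rule mem'')
  have "ip (exp_quotient (Suc n) s) (exp_quotient (Suc n) t) = r * shifted_series exp_coeff (Suc n) (s * t)"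
    using ip' ip0 ip00 ip_sym[OF mem''[of s] mem''[of t]] by (cases "s = 0"; cases "t = 0") auto
  then show ?case using mem'' by blast
qed

text \<open>Pairing with \<open>h\<close> is linear and continuous, so the divided differences of
  the family pass to those of the scalar function with coefficients \<open>a\<close>.\<close>

lemma ip_exp_quotient:
  assumes h: "h \<in> H"
    and a: "\<And>t. summable (\<lambda>j. a j * t ^ j)"
    and ip_h: "\<And>t. ip h (\<lambda>x. B x * exp (t * \<xi> x)) = shifted_series a 0 t"
  shows "ip h (exp_quotient n t) = shifted_series a n t"
proof (induction n arbitrary: t)
  case 0
  then show ?case using ip_h by (simp add: exp_quotient_def shifted_series_exp)
next
  case (Suc n)
  have mem: "exp_quotient n t \<in> H" for n t using exp_quotient_mem_ip by blast
  have *: "ip h (exp_quotient (Suc n) t) = shifted_series a (Suc n) t" if "t \<noteq> 0" for t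
  proof -
    have "ip h (exp_quotient (Suc n) t) = (1 / t) * (ip h (exp_quotient n t) - ip h (exp_quotient n 0))"
      unfolding exp_quotient_Suc[OF that] using h mem
      by (simp add: ip_sym[of h] scale_mem diff_mem ip_scale ip_diff del: mult_eq_0_iff times_divide_eq_left)
    also have "\<dots> = (1 / t) * (shifted_series a n t - a n)" by (simp add: Suc shifted_series_zero)
    also have "\<dots> = shifted_series a (Suc n) t"
      using that by (subst shifted_series_Suc[OF a]) simp
    finally show ?thesis .
  qed
  show ?case
  proof (cases "t = 0")
    case True
    have "(\<lambda>i. ip h (exp_quotient (Suc n) (inv_seq i))) \<longlonglongrightarrow> ip h (exp_quotient (Suc n) 0)"
      by (rule exp_quotient_limit(2)) (use exp_quotient_mem_ip h in auto)
    moreover have "(\<lambda>i. ip h (exp_quotient (Suc n) (inv_seq i))) \<longlonglongrightarrow> a (Suc n)"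
      using shifted_series_inv_seq[OF a, of "Suc n" 1] by (simp add: * del: of_nat_Suc)
    ultimately show ?thesis using LIMSEQ_unique True by (auto simp: shifted_series_zero)
  qed (use * in simp)
qed

text \<open>\<open>B\<close> times the \<open>n\<close>-th power of \<xi> is the \<open>n\<close>-th
  derivative of the exponential family at parameter 0; pairing with \<open>h\<close> gives the
  \<open>n\<close>-th derivative of a power series, whence the factorial.\<close>

lemma monomial_factor_mem: "(\<lambda>x. B x * \<xi> x ^ n) \<in> H"
  and ip_monomial_factor:
    "h \<in> H \<Longrightarrow> (\<And>t. summable (\<lambda>j. a j * t ^ j)) \<Longrightarrow>
     (\<And>t. ip h (\<lambda>x. B x * exp (t * \<xi> x)) = shifted_series a 0 t) \<Longrightarrow>
     ip h (\<lambda>x. B x * \<xi> x ^ n) = fact n * a n"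
proof -
  have eq: "(\<lambda>x. B x * \<xi> x ^ n) = (\<lambda>x. fact n * exp_quotient n 0 x)"
    by (simp add: exp_quotient_def shifted_series_zero)
  have mem: "exp_quotient n 0 \<in> H" using exp_quotient_mem_ip by blast
  then show *: "(\<lambda>x. B x * \<xi> x ^ n) \<in> H" unfolding eq by (rule scale_mem)
  assume a: "h \<in> H" "\<And>t. summable (\<lambda>j. a j * t ^ j)"
    "\<And>t. ip h (\<lambda>x. B x * exp (t * \<xi> x)) = shifted_series a 0 t"
  have "ip h (\<lambda>x. B x * \<xi> x ^ n) = fact n * ip h (exp_quotient n 0)"
    using a(1) mem scale_mem[OF mem, of "fact n"] unfolding eq by (metis ip_scale ip_sym)
  then show "ip h (\<lambda>x. B x * \<xi> x ^ n) = fact n * a n"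
    by (simp add: ip_exp_quotient[OF a] shifted_series_zero)
qed

end

end

section \<open>Taylor expansion in the space of the exponential kernel\<close>

definition scaled_mono :: "real \<Rightarrow> real ^ 'd \<Rightarrow> nat ^ 'd::finite \<Rightarrow> real ^ 'd \<Rightarrow> real" where
  "scaled_mono \<sigma> x0 \<beta> x = mpow (x - x0) \<beta> / \<sigma> ^ mdeg \<beta>"

definition mfact :: "nat ^ 'd::finite \<Rightarrow> real" where
  "mfact \<beta> = (\<Prod>j\<in>UNIV. fact (\<beta> $ j))"

lemma mfact_pos: "mfact \<beta> > 0"
  by (simp add: mfact_def prod_pos)

lemma scaled_mono_eq_prod:
  "scaled_mono \<sigma> x0 \<beta> x = (\<Prod>j\<in>UNIV. ((x $ j - x0 $ j) / \<sigma>) ^ (\<beta> $ j))"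
  by (simp add: scaled_mono_def mpow_def mdeg_def power_divide prod_dividef power_sum)

lemma rkhs_funI:
  assumes "is_rkhs k H ip"
  shows "rkhs_fun H ip k"
  using assms unfolding is_rkhs_def by unfold_locales auto

text \<open>The kernel functions are generating functions of the monomials. Their Gram function, the
  exponential of the sum of the \<open>y j * z j\<close>, contains only products of equal powers of
  \<open>y j\<close> and \<open>z j\<close>; this is the orthogonality, and the coefficients give
  the squared norms.\<close>

lemma exp_kernel_monomials:
  fixes H :: "(real ^ 'd::finite \<Rightarrow> real) set"
  assumes rkhs: "is_rkhs (exp_kernel \<sigma> x0) H ip" and \<sigma>: "\<sigma> > 0"
  shows "scaled_mono \<sigma> x0 \<beta> \<in> H"
    and "ip (scaled_mono \<sigma> x0 \<beta>) (scaled_mono \<sigma> x0 \<gamma>) = (if \<beta> = \<gamma> then mfact \<beta> else 0)"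
proof -
  interpret rkhs_fun H ip "exp_kernel \<sigma> x0" using rkhs by (rule rkhs_funI)
  define \<xi> where "\<xi> = (\<lambda>j (x :: real ^ 'd). (x $ j - x0 $ j) / \<sigma>)"
  text \<open>Starting from the kernel functions, the exponential factors are replaced by powers one
    coordinate at a time.\<close>
  define F where "F = (\<lambda>S (\<beta> :: nat ^ 'd) (y :: 'd \<Rightarrow> real) x.
    (\<Prod>j\<in>S. \<xi> j x ^ (\<beta> $ j)) * exp (\<Sum>j\<in>-S. y j * \<xi> j x))"
  define C where "C = (\<lambda>S (\<beta> :: nat ^ 'd) (\<gamma> :: nat ^ 'd).
    \<Prod>j\<in>S. if \<beta> $ j = \<gamma> $ j then fact (\<beta> $ j) else 0 :: real)"
  have main: "(\<forall>\<beta> y. F S \<beta> y \<in> H) \<and>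
    (\<forall>\<beta> \<gamma> y z. ip (F S \<beta> y) (F S \<gamma> z) = C S \<beta> \<gamma> * exp (\<Sum>j\<in>-S. y j * z j))" for S
  proof (induction S rule: infinite_finite_induct)
    case (infinite A)
    then show ?case by simp
  next
    case empty
    \<comment> \<open>The point with scaled coordinates \<open>y\<close>; its kernel function is the
      pure exponential with frequencies \<open>y\<close>.\<close>
    define p where "p = (\<lambda>y :: 'd \<Rightarrow> real. \<chi> j. x0 $ j + \<sigma> * y j)"
    have inner: "inner (p y - x0) (x - x0) / \<sigma>\<^sup>2 = (\<Sum>j\<in>UNIV. y j * \<xi> j x)" for y x
      using \<sigma> by (simp add: p_def inner_vec_def \<xi>_def sum_divide_distrib power2_eq_square)
    have F: "F {} \<beta> y = exp_kernel \<sigma> x0 (p y)" for \<beta> y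
      unfolding F_def exp_kernel_def inner by simp
    have mem: "F {} \<beta> y \<in> H" for \<beta> y unfolding F by (rule kernel_mem)
    have \<xi>p: "\<xi> j (p z) = z j" for j z using \<sigma> by (simp add: \<xi>_def p_def)
    have "ip (F {} \<beta> y) (F {} \<gamma> z) = C {} \<beta> \<gamma> * exp (\<Sum>j\<in>-{}. y j * z j)" for \<beta> \<gamma> y z
    proof -
      have "ip (F {} \<beta> y) (F {} \<gamma> z) = F {} \<beta> y (p z)"
        unfolding F[of \<gamma>] by (rule reproducing[OF mem])
      then show ?thesis by (simp add: F_def C_def \<xi>p)
    qed
    then show ?case using mem by blast
  next
    case (insert i S)
    have mem: "F S \<beta> y \<in> H" for \<beta> y using insert by blast
    have ip: "ip (F S \<beta> y) (F S \<gamma> z) = C S \<beta> \<gamma> * exp (\<Sum>j\<in>-S. y j * z j)" for \<beta> \<gamma> y z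
      using insert by blast
    define B where "B = (\<lambda>(\<beta> :: nat ^ 'd) y x.
      (\<Prod>j\<in>S. \<xi> j x ^ (\<beta> $ j)) * exp (\<Sum>j\<in>-(insert i S). y j * \<xi> j x))"
    have S: "-S = insert i (-(insert i S))" using insert by auto
    have upd: "(\<Sum>j\<in>-(insert i S). (y(i := t)) j * g j) = (\<Sum>j\<in>-(insert i S). y j * g j)"
      for y :: "'d \<Rightarrow> real" and t g by (rule sum.cong) auto
    have split: "(\<Sum>j\<in>-S. (y(i := t)) j * g j) = t * g i + (\<Sum>j\<in>-(insert i S). y j * g j)"
      for y :: "'d \<Rightarrow> real" and t g
      unfolding S by (subst sum.insert) (use upd[of y t g] in auto)
    have FS: "F S \<beta> (y(i := t)) = (\<lambda>x. B \<beta> y x * exp (t * \<xi> i x))" for \<beta> y t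
      unfolding F_def B_def split by (simp add: exp_add mult_ac)
    have FiS: "F (insert i S) \<beta> y = (\<lambda>x. B \<beta> y x * \<xi> i x ^ (\<beta> $ i))" for \<beta> y
      using insert.hyps by (simp add: F_def B_def mult_ac)
    define D where "D = (\<lambda>\<beta> \<gamma> y z. C S \<beta> \<gamma> * exp (\<Sum>j\<in>-(insert i S). y j * z j))"
    have D_sym: "D \<beta> \<gamma> y z = D \<gamma> \<beta> z y" for \<beta> \<gamma> y z
    proof -
      have "C S \<beta> \<gamma> = C S \<gamma> \<beta>" unfolding C_def by (rule prod.cong) auto
      then show ?thesis by (simp add: D_def mult.commute)
    qed
    have ip': "ip (\<lambda>x. B \<beta> y x * exp (s * \<xi> i x)) (\<lambda>x. B \<gamma> z x * exp (t * \<xi> i x)) =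
        D \<beta> \<gamma> y z * exp (s * t)" for \<beta> \<gamma> y z s t
    proof -
      have "(\<Sum>j\<in>-S. (y(i := s)) j * (z(i := t)) j) = s * t + (\<Sum>j\<in>-(insert i S). y j * z j)"
        unfolding split using upd[of z t y] by (simp add: mult.commute)
      then show ?thesis unfolding FS[symmetric] ip D_def by (simp add: exp_add)
    qed
    have mem': "(\<lambda>x. B \<beta> y x * exp (t * \<xi> i x)) \<in> H" for \<beta> y t
      unfolding FS[symmetric] by (rule mem)
    have memI: "F (insert i S) \<beta> y \<in> H" for \<beta> y
      unfolding FiS by (rule monomial_factor_mem[OF mem' ip'])
    have ser: "summable (\<lambda>j. d * s ^ j * t ^ j / fact j)" for d s t :: real
      using summable_mult[OF exp_coeff_summable[of "s * t"], of d] by (simp add: power_mult_distrib field_simps)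
    have ser0: "shifted_series (\<lambda>j. d * s ^ j / fact j) 0 t = d * exp (s * t)" for d s t :: real
      unfolding shifted_series_exp[symmetric] shifted_series_def
      by (subst suminf_mult[symmetric]) (use exp_coeff_summable[of "s * t"] in \<open>simp_all add: power_mult_distrib field_simps\<close>)
    \<comment> \<open>Only one argument is converted to a power here. The result is a single
      monomial in \<open>s\<close>; converting the other argument then extracts one coefficient of
      it, which vanishes unless the exponents agree.\<close>
    have ip1: "ip (\<lambda>x. B \<gamma> z x * exp (s * \<xi> i x)) (F (insert i S) \<beta> y) = D \<gamma> \<beta> z y * s ^ (\<beta> $ i)"
      for \<beta> \<gamma> y z s
      unfolding FiS
      by (subst ip_monomial_factor[OF mem' ip' mem', where a = "\<lambda>j. D \<gamma> \<beta> z y * s ^ j / fact j"])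
         (simp_all add: ser ser0 ip')
    have "ip (F (insert i S) \<beta> y) (F (insert i S) \<gamma> z) =
        fact (\<gamma> $ i) * (if \<gamma> $ i = \<beta> $ i then D \<beta> \<gamma> y z else 0)" for \<beta> \<gamma> y z
      unfolding FiS[of \<gamma>]
    proof (rule ip_monomial_factor[OF mem' ip' memI])
      show "summable (\<lambda>j. (if j = \<beta> $ i then D \<beta> \<gamma> y z else 0) * t ^ j)" for t :: real
        by (rule summable_finite[of "{\<beta> $ i}"]) auto
      show "ip (F (insert i S) \<beta> y) (\<lambda>x. B \<gamma> z x * exp (t * \<xi> i x)) =
          shifted_series (\<lambda>j. if j = \<beta> $ i then D \<beta> \<gamma> y z else 0) 0 t" for t
      proof -
        have "shifted_series (\<lambda>j. if j = \<beta> $ i then D \<beta> \<gamma> y z else 0) 0 t = D \<beta> \<gamma> y z * t ^ (\<beta> $ i)"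
          unfolding shifted_series_def by (subst suminf_finite[of "{\<beta> $ i}"]) auto
        then show ?thesis
          unfolding ip_sym[OF memI mem'] ip1 by (simp add: D_sym)
      qed
    qed
    moreover have "C (insert i S) \<beta> \<gamma> = fact (\<gamma> $ i) * (if \<gamma> $ i = \<beta> $ i then C S \<beta> \<gamma> else 0)" for \<beta> \<gamma>
      using insert by (auto simp: C_def)
    ultimately show ?case using memI by (simp add: D_def)
  qed
  have F: "F UNIV \<beta> (\<lambda>_. 0) = scaled_mono \<sigma> x0 \<beta>" for \<beta>
    by (simp add: F_def scaled_mono_eq_prod \<xi>_def fun_eq_iff)
  show "scaled_mono \<sigma> x0 \<beta> \<in> H" using conjunct1[OF main[of UNIV], rule_format, of \<beta> "\<lambda>_. 0"] by (simp add: F)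
  have "C UNIV \<beta> \<gamma> = (if \<beta> = \<gamma> then mfact \<beta> else 0)"
    by (auto simp: C_def mfact_def vec_eq_iff)
  then show "ip (scaled_mono \<sigma> x0 \<beta>) (scaled_mono \<sigma> x0 \<gamma>) = (if \<beta> = \<gamma> then mfact \<beta> else 0)"
    using conjunct2[OF main[of UNIV], rule_format, of \<beta> "\<lambda>_. 0" \<gamma> "\<lambda>_. 0"] by (simp add: F)
qed

text \<open>The Fourier coefficient of \<open>h\<close> in the orthogonal system of scaled
  monomials. No derivative of \<open>h\<close> is formed; that these are the coefficients of a power
  series for \<open>h\<close> is the content of \<open>taylor_error_bound\<close>.\<close>

definition taylor_coeff ::
  "real \<Rightarrow> real ^ 'd::finite \<Rightarrow> ((real ^ 'd \<Rightarrow> real) \<Rightarrow> (real ^ 'd \<Rightarrow> real) \<Rightarrow> real) \<Rightarrow>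
   (real ^ 'd \<Rightarrow> real) \<Rightarrow> nat ^ 'd \<Rightarrow> real" where
  "taylor_coeff \<sigma> x0 ip h \<beta> = ip h (scaled_mono \<sigma> x0 \<beta>) / mfact \<beta>"

text \<open>The sum \<open>s\<close> is the orthogonal projection of the kernel function at
  \<open>x\<close> onto the span of the monomials in \<open>A\<close>. The error is the inner
  product of \<open>h\<close> with the kernel function minus \<open>s\<close>, and the squared norm
  of this difference is given by Pythagoras.\<close>

lemma taylor_error:
  fixes H :: "(real ^ 'd::finite \<Rightarrow> real) set"
  assumes rkhs: "is_rkhs (exp_kernel \<sigma> x0) H ip" and \<sigma>: "\<sigma> > 0" and h: "h \<in> H" and A: "finite A"
  shows "(h x - (\<Sum>\<beta>\<in>A. taylor_coeff \<sigma> x0 ip h \<beta> * scaled_mono \<sigma> x0 \<beta> x))\<^sup>2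
    \<le> ip h h * (exp (\<Sum>j\<in>UNIV. ((x $ j - x0 $ j) / \<sigma>)\<^sup>2) - (\<Sum>\<beta>\<in>A. (scaled_mono \<sigma> x0 \<beta> x)\<^sup>2 / mfact \<beta>))"
proof -
  interpret rkhs_fun H ip "exp_kernel \<sigma> x0" using rkhs by (rule rkhs_funI)
  let ?v = "scaled_mono \<sigma> x0" and ?k = "exp_kernel \<sigma> x0 x"
  define s where "s = (\<lambda>y. \<Sum>\<beta>\<in>A. (?v \<beta> x / mfact \<beta>) * ?v \<beta> y)"
  note v = exp_kernel_monomials[OF rkhs \<sigma>]
  have s: "s \<in> H" unfolding s_def by (intro sum_mem A v)
  have ip_s: "ip s u = (\<Sum>\<beta>\<in>A. (?v \<beta> x / mfact \<beta>) * ip (?v \<beta>) u)" if "u \<in> H" for u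
    unfolding s_def by (intro ip_sum A v that)
  have "ip s (?v \<beta>) = ?v \<beta> x" if "\<beta> \<in> A" for \<beta>
    using that A mfact_pos[of \<beta>] by (simp add: ip_s v sum.If_cases if_distrib cong: if_cong)
  then have ip_v_s: "ip (?v \<beta>) s = ?v \<beta> x" if "\<beta> \<in> A" for \<beta>
    using that ip_sym[OF v(1) s] by simp
  have s_s: "ip s s = (\<Sum>\<beta>\<in>A. (?v \<beta> x)\<^sup>2 / mfact \<beta>)"
    unfolding ip_s[OF s] by (rule sum.cong) (auto simp: ip_v_s power2_eq_square)
  have k_s: "ip ?k s = ip s s"
    unfolding s_s using ip_sym[OF kernel_mem s] reproducing[OF s]
    by (simp add: s_def power2_eq_square)
  have k_k: "ip ?k ?k = exp (\<Sum>j\<in>UNIV. ((x $ j - x0 $ j) / \<sigma>)\<^sup>2)"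
    unfolding reproducing[OF kernel_mem]
    by (simp add: exp_kernel_def inner_vec_def power2_eq_square sum_divide_distrib)
  have "ip s h = (\<Sum>\<beta>\<in>A. taylor_coeff \<sigma> x0 ip h \<beta> * ?v \<beta> x)"
    unfolding ip_s[OF h] taylor_coeff_def by (rule sum.cong) (auto simp: ip_sym[OF h v(1)])
  then have "h x - (\<Sum>\<beta>\<in>A. taylor_coeff \<sigma> x0 ip h \<beta> * ?v \<beta> x) = ip h (\<lambda>y. ?k y - s y)"
    using ip_sym[OF h diff_mem[OF kernel_mem s]] ip_diff[OF kernel_mem s h] ip_sym[OF h kernel_mem]
      reproducing[OF h] by simp
  moreover have "ip (\<lambda>y. ?k y - s y) (\<lambda>y. ?k y - s y) = ip ?k ?k - ip s s"
    using ip_diff_diff[OF kernel_mem s] k_s by simp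
  ultimately show ?thesis
    using cauchy_schwarz[OF h diff_mem[OF kernel_mem s, of x]] by (simp add: k_k s_s)
qed

section \<open>Sums over multi-indices and tails of the exponential series\<close>

lemma sum_vec_prod:
  fixes f :: "'d::finite \<Rightarrow> 'b \<Rightarrow> 'c::comm_semiring_1"
  assumes "\<And>j. finite (B j)"
  shows "(\<Sum>\<beta> | \<forall>j. \<beta> $ j \<in> B j. \<Prod>j\<in>UNIV. f j (\<beta> $ j)) = (\<Prod>j\<in>UNIV. \<Sum>k\<in>B j. f j k)"
proof -
  have "(\<Prod>j\<in>UNIV. \<Sum>k\<in>B j. f j k) = (\<Sum>g\<in>PiE UNIV B. \<Prod>j\<in>UNIV. f j (g j))"
    using assms by (intro prod_sum_PiE) auto
  also have "\<dots> = (\<Sum>\<beta> | \<forall>j. \<beta> $ j \<in> B j. \<Prod>j\<in>UNIV. f j (\<beta> $ j))"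
    by (rule sum.reindex_bij_witness[of _ "\<lambda>\<beta>. ($) \<beta>" vec_lambda]) (auto simp: PiE_def)
  finally show ?thesis ..
qed

lemma finite_vec_box:
  assumes "\<And>j. finite (B j)"
  shows "finite {\<beta> :: 'b ^ 'd::finite. \<forall>j. \<beta> $ j \<in> B j}"
proof -
  have "{\<beta> :: 'b ^ 'd. \<forall>j. \<beta> $ j \<in> B j} \<subseteq> vec_lambda ` PiE UNIV B"
    by (auto simp: image_iff PiE_def intro!: bexI[of _ "($) _"])
  then show ?thesis using assms finite_PiE[of UNIV B] by (meson finite finite_imageI finite_subset)
qed

lemma component_le_mdeg: "\<beta> $ j \<le> mdeg \<beta>"
  unfolding mdeg_def by (rule member_le_sum) auto

lemma finite_mdeg_le: "finite {\<beta> :: nat ^ 'd::finite. mdeg \<beta> \<le> n}"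
  by (rule finite_subset[OF _ finite_vec_box[of "\<lambda>_. {..n}"]]) (auto intro: order_trans[OF component_le_mdeg])

text \<open>Terms of degree above \<open>n\<close> gain at least a factor \<open>r ^ n\<close> when \<open>w\<close> is scaled by \<open>r\<close>.\<close>

lemma exp_tail_bound:
  fixes w :: "'d::finite \<Rightarrow> real"
  assumes w: "\<And>j. 0 \<le> w j" and r: "1 \<le> r"
  shows "r ^ n * (exp (\<Sum>j\<in>UNIV. w j) - (\<Sum>\<beta> | mdeg \<beta> \<le> n. (\<Prod>j\<in>UNIV. w j ^ (\<beta> $ j)) / mfact \<beta>))
    \<le> exp (r * (\<Sum>j\<in>UNIV. w j))"
proof -
  let ?A = "{\<beta> :: nat ^ 'd. mdeg \<beta> \<le> n}"
  \<comment> \<open>Sums over boxes factor into one-variable sums, which sums over degree ranges do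
    not; the exponential is therefore approached through growing boxes.\<close>
  let ?Box = "\<lambda>N. {\<beta> :: nat ^ 'd. \<forall>j. \<beta> $ j \<in> {..<N}}"
  define t where "t = (\<lambda>r (\<beta> :: nat ^ 'd). \<Prod>j\<in>UNIV. (r * w j) ^ (\<beta> $ j) / fact (\<beta> $ j))"
  have t_eq: "(\<Prod>j\<in>UNIV. w j ^ (\<beta> $ j)) / mfact \<beta> = t 1 \<beta>" for \<beta>
    by (simp add: t_def mfact_def prod_dividef)
  have t_nonneg: "0 \<le> t r \<beta>" if "r \<ge> 0" for r \<beta> unfolding t_def using that w by (intro prod_nonneg) auto
  have t_scale: "t r \<beta> = r ^ mdeg \<beta> * t 1 \<beta>" for r \<beta>
    by (simp add: t_def mdeg_def power_mult_distrib prod_dividef prod.distrib power_sum)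
  have sum_t: "(\<Sum>\<beta>\<in>?Box N. t r \<beta>) = (\<Prod>j\<in>UNIV. \<Sum>k<N. (r * w j) ^ k / fact k)" for r N
    unfolding t_def by (rule sum_vec_prod) simp
  have exp_sums: "(\<lambda>N. \<Sum>k<N. x ^ k / fact k) \<longlonglongrightarrow> exp x" for x :: real
    using exp_converges[of x] by (simp add: sums_def field_simps)
  have le_exp: "(\<Sum>k<N. x ^ k / fact k) \<le> exp x" if "x \<ge> 0" for N and x :: real
    using exp_converges[of x] that
    by (intro order_trans[OF sum_le_suminf[of "\<lambda>k. x ^ k / fact k" "{..<N}"]])
       (auto simp: sums_iff field_simps)
  have bound: "r ^ n * ((\<Sum>\<beta>\<in>?Box N. t 1 \<beta>) - (\<Sum>\<beta>\<in>?A. t 1 \<beta>)) \<le> exp (r * (\<Sum>j\<in>UNIV. w j))" for N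
  proof -
    have fin: "finite (?Box N)" by (rule finite_vec_box) simp
    have "(\<Sum>\<beta>\<in>?Box N. t 1 \<beta>) = (\<Sum>\<beta>\<in>?Box N \<inter> ?A. t 1 \<beta>) + (\<Sum>\<beta>\<in>?Box N - ?A. t 1 \<beta>)"
      by (rule sum.Int_Diff[OF fin])
    moreover have "(\<Sum>\<beta>\<in>?Box N \<inter> ?A. t 1 \<beta>) \<le> (\<Sum>\<beta>\<in>?A. t 1 \<beta>)"
      by (rule sum_mono2) (auto intro: finite_mdeg_le t_nonneg)
    ultimately have "r ^ n * ((\<Sum>\<beta>\<in>?Box N. t 1 \<beta>) - (\<Sum>\<beta>\<in>?A. t 1 \<beta>)) \<le> r ^ n * (\<Sum>\<beta>\<in>?Box N - ?A. t 1 \<beta>)"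
      using r by (intro mult_left_mono) auto
    also have "\<dots> \<le> (\<Sum>\<beta>\<in>?Box N - ?A. t r \<beta>)"
      unfolding sum_distrib_left t_scale[of r]
      using r by (intro sum_mono mult_right_mono power_increasing t_nonneg) auto
    also have "\<dots> \<le> (\<Sum>\<beta>\<in>?Box N. t r \<beta>)"
      using r by (intro sum_mono2 fin t_nonneg) auto
    also have "\<dots> \<le> (\<Prod>j\<in>UNIV. exp (r * w j))"
      unfolding sum_t using r w by (intro prod_mono conjI sum_nonneg le_exp) auto
    also have "\<dots> = exp (r * (\<Sum>j\<in>UNIV. w j))"
      by (simp add: exp_sum sum_distrib_left)
    finally show ?thesis .
  qed
  have "(\<lambda>N. \<Sum>\<beta>\<in>?Box N. t 1 \<beta>) \<longlonglongrightarrow> (\<Prod>j\<in>UNIV. exp (w j))"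
    unfolding sum_t by (intro tendsto_prod) (use exp_sums in simp)
  then have "(\<lambda>N. r ^ n * ((\<Sum>\<beta>\<in>?Box N. t 1 \<beta>) - (\<Sum>\<beta>\<in>?A. t 1 \<beta>))) \<longlonglongrightarrow>
      r ^ n * (exp (\<Sum>j\<in>UNIV. w j) - (\<Sum>\<beta>\<in>?A. t 1 \<beta>))"
    by (intro tendsto_intros) (simp add: exp_sum)
  then show ?thesis unfolding t_eq using bound by (intro LIMSEQ_le_const2) auto
qed

text \<open>The squared scaled monomials divided by \<open>mfact\<close> are the terms of the
  exponential of the sum of the squared scaled coordinates, so \<open>exp_tail_bound\<close>
  controls the remainder. As \<open>r\<close> is free, the decay is faster than any geometric rate,
  uniformly for bounded \<open>x\<close>.\<close>

lemma taylor_error_bound: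
  fixes H :: "(real ^ 'd::finite \<Rightarrow> real) set"
  assumes rkhs: "is_rkhs (exp_kernel \<sigma> x0) H ip" and \<sigma>: "\<sigma> > 0" and h: "h \<in> H" and r: "1 \<le> r"
  shows "r ^ n * (h x - (\<Sum>\<beta> | mdeg \<beta> \<le> n. taylor_coeff \<sigma> x0 ip h \<beta> * scaled_mono \<sigma> x0 \<beta> x))\<^sup>2
    \<le> ip h h * exp (r * (norm (x - x0) / \<sigma>)\<^sup>2)"
proof -
  interpret rkhs_fun H ip "exp_kernel \<sigma> x0" using rkhs by (rule rkhs_funI)
  let ?w = "\<lambda>j. ((x $ j - x0 $ j) / \<sigma>)\<^sup>2"
  have norm: "(norm (x - x0) / \<sigma>)\<^sup>2 = (\<Sum>j\<in>UNIV. ?w j)"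
    by (simp add: power_divide norm_vec_def L2_set_def sum_nonneg sum_divide_distrib)
  have sq: "(scaled_mono \<sigma> x0 \<beta> x)\<^sup>2 = (\<Prod>j\<in>UNIV. ?w j ^ (\<beta> $ j))" for \<beta>
    by (auto simp: scaled_mono_eq_prod prod_power_distrib power_mult[symmetric] mult.commute intro!: prod.cong)
  have "r ^ n * (h x - (\<Sum>\<beta> | mdeg \<beta> \<le> n. taylor_coeff \<sigma> x0 ip h \<beta> * scaled_mono \<sigma> x0 \<beta> x))\<^sup>2
      \<le> r ^ n * (ip h h * (exp (\<Sum>j\<in>UNIV. ?w j) - (\<Sum>\<beta> | mdeg \<beta> \<le> n. (scaled_mono \<sigma> x0 \<beta> x)\<^sup>2 / mfact \<beta>)))"
    using r by (intro mult_left_mono taylor_error[OF rkhs \<sigma> h finite_mdeg_le]) auto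
  also have "\<dots> = ip h h * (r ^ n * (exp (\<Sum>j\<in>UNIV. ?w j) - (\<Sum>\<beta> | mdeg \<beta> \<le> n. (\<Prod>j\<in>UNIV. ?w j ^ (\<beta> $ j)) / mfact \<beta>)))"
    unfolding sq by (rule mult.left_commute)
  also have "\<dots> \<le> ip h h * exp (r * (\<Sum>j\<in>UNIV. ?w j))"
    using r by (intro mult_left_mono ip_nonneg h exp_tail_bound[of ?w]) auto
  finally show ?thesis unfolding norm .
qed

section \<open>Coefficients of polynomials\<close>

definition lagrange_poly :: "(nat \<Rightarrow> real) \<Rightarrow> nat \<Rightarrow> nat \<Rightarrow> real poly" where
  "lagrange_poly x n i = (\<Prod>j\<in>{..n} - {i}. smult (1 / (x i - x j)) [:- x j, 1:])"

text \<open>Multiplication by a linear factor combines two neighbouring coefficients with weights 1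
  and \<open>x j\<close>, so a common bound for all coefficients grows at most by the factor 1 + |x
  j|.\<close>

lemma coeff_prod_linear_bound:
  fixes x b :: "'i \<Rightarrow> real"
  assumes "finite J"
  shows "\<bar>coeff (\<Prod>j\<in>J. smult (b j) [:- x j, 1:]) k\<bar> \<le> (\<Prod>j\<in>J. \<bar>b j\<bar> * (1 + \<bar>x j\<bar>))"
  using assms
proof (induction J arbitrary: k rule: finite_induct)
  case (insert i J)
  let ?p = "\<Prod>j\<in>J. smult (b j) [:- x j, 1:]" and ?M = "\<Prod>j\<in>J. \<bar>b j\<bar> * (1 + \<bar>x j\<bar>)"
  have "(\<Prod>j\<in>insert i J. smult (b j) [:- x j, 1:]) = smult (b i) ([:- x i, 1:] * ?p)"
    using insert by (simp only: prod.insert mult_smult_left not_False_eq_True)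
  then have "coeff (\<Prod>j\<in>insert i J. smult (b j) [:- x j, 1:]) k =
      b i * (- x i * coeff ?p k + (if k = 0 then 0 else coeff ?p (k - 1)))"
    by (simp add: coeff_pCons split: nat.split)
  moreover have "\<bar>- x i * coeff ?p k + (if k = 0 then 0 else coeff ?p (k - 1))\<bar> \<le> \<bar>x i\<bar> * ?M + ?M"
  proof -
    have M: "0 \<le> ?M" by (intro prod_nonneg) auto
    have "\<bar>- x i * coeff ?p k + (if k = 0 then 0 else coeff ?p (k - 1))\<bar>
        \<le> \<bar>- x i * coeff ?p k\<bar> + \<bar>if k = 0 then 0 else coeff ?p (k - 1)\<bar>" by (rule abs_triangle_ineq)
    also have "\<dots> \<le> \<bar>x i\<bar> * ?M + ?M"
      using insert.IH M by (intro add_mono) (auto simp: abs_mult intro!: mult_left_mono)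
    finally show ?thesis .
  qed
  ultimately show ?case
    using insert by (simp add: abs_mult mult.assoc mult_left_mono distrib_right add.commute)
qed (simp add: coeff_1)

text \<open>Interpolation at \<open>n + 1\<close> nodes reproduces the \<open>m\<close>-th power
  exactly; the claim compares the \<open>k\<close>-th coefficients. It makes the extraction of a
  coefficient a linear functional of point values.\<close>

lemma sum_lagrange_coeff:
  assumes x: "inj_on x {..n}" and m: "m \<le> n"
  shows "(\<Sum>i\<le>n. coeff (lagrange_poly x n i) k * x i ^ m) = (if k = m then 1 else 0)"
proof -
  let ?p = "\<Sum>i\<le>n. smult (x i ^ m) (lagrange_poly x n i)"
  have deg: "degree (lagrange_poly x n i) \<le> n" if "i \<le> n" for i
  proof -
    have "degree (lagrange_poly x n i) \<le> (\<Sum>j\<in>{..n} - {i}. 1)"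
      unfolding lagrange_poly_def
      by (rule order_trans[OF degree_prod_sum_le sum_mono])
        (auto intro: order_trans[OF degree_smult_le] simp del: smult_pCons)
    then show ?thesis using that by simp
  qed
  have poly_l: "poly (lagrange_poly x n i) (x l) = (if i = l then 1 else 0)" if "i \<le> n" "l \<le> n" for i l
  proof (cases "i = l")
    case True
    have "poly (lagrange_poly x n i) (x i) = (\<Prod>j\<in>{..n} - {i}. 1)"
      unfolding lagrange_poly_def poly_prod
    proof (rule prod.cong)
      fix j assume "j \<in> {..n} - {i}"
      then have "x i - x j \<noteq> 0" using inj_onD[OF x, of i j] that by auto
      then show "poly (smult (1 / (x i - x j)) [:- x j, 1:]) (x i) = 1" by (simp add: diff_divide_distrib[symmetric])
    qed simp
    then show ?thesis using True by simp
  next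
    case False
    then have "poly (lagrange_poly x n i) (x l) = 0"
      unfolding lagrange_poly_def poly_prod using that by (intro prod_zero) auto
    then show ?thesis using False by simp
  qed
  have "?p = monom 1 m"
  proof (rule poly_eqI_degree)
    show "poly ?p t = poly (monom 1 m) t" if "t \<in> x ` {..n}" for t
      using that by (auto simp: poly_sum poly_l poly_monom sum.If_cases if_distrib cong: if_cong)
    have card: "card (x ` {..n}) = Suc n" using x by (simp add: card_image)
    show "degree (monom (1::real) m) < card (x ` {..n})"
      unfolding card using m by (simp add: degree_monom_eq)
    have "degree ?p \<le> n"
      by (intro degree_sum_le order_trans[OF degree_smult_le] deg) auto
    then show "degree ?p < card (x ` {..n})" unfolding card by simp
  qed
  then have "coeff ?p k = coeff (monom 1 m) k" by simp
  then show ?thesis by (simp add: coeff_sum mult.commute eq_commute)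
qed

lemma prod_abs_diff_nat:
  assumes "i \<le> n"
  shows "(\<Prod>j\<in>{..n} - {i}. \<bar>real i - real j\<bar>) = fact i * fact (n - i)"
proof -
  have split: "{..n} - {i} = {..<i} \<union> {Suc i..n}" using assms by auto
  have "(\<Prod>j\<in>{..<i}. \<bar>real i - real j\<bar>) = (\<Prod>j\<in>{1..i}. real j)"
    by (rule prod.reindex_bij_witness[of _ "\<lambda>j. i - j" "\<lambda>j. i - j"]) auto
  moreover have "(\<Prod>j\<in>{Suc i..n}. \<bar>real i - real j\<bar>) = (\<Prod>j\<in>{1..n - i}. real j)"
    by (rule prod.reindex_bij_witness[of _ "\<lambda>j. i + j" "\<lambda>j. j - i"]) auto
  ultimately show ?thesis
    unfolding split by (subst prod.union_disjoint) (auto simp: fact_prod)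
qed

text \<open>For equidistant nodes the denominators multiply to \<open>fact i * fact (n - i)\<close>
  times a power of the spacing, and the factorials are at least \<open>fact n / 2 ^ n\<close>. The
  small spacing contributes \<open>real (Suc n) ^ n\<close>, which \<open>fact n\<close> reduces to
  geometric growth.\<close>

lemma lagrange_coeff_bound:
  assumes i: "i \<le> n" and l: "l > 0" and x: "\<And>j. x j = u + l / Suc n * j"
    and R: "\<And>j. j \<le> n \<Longrightarrow> \<bar>x j\<bar> \<le> R"
  shows "\<bar>coeff (lagrange_poly x n i) k\<bar> \<le> (exp 1 * (1 + 2 * (1 + R) / l)) ^ Suc n"
proof -
  have R0: "R \<ge> 0" using R[of 0] by linarith
  define h where "h = l / Suc n"
  have h: "h > 0" using l by (simp add: h_def)
  have "\<bar>coeff (lagrange_poly x n i) k\<bar> \<le> (\<Prod>j\<in>{..n} - {i}. \<bar>1 / (x i - x j)\<bar> * (1 + \<bar>x j\<bar>))"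
    unfolding lagrange_poly_def by (rule coeff_prod_linear_bound) simp
  also have "\<dots> \<le> (\<Prod>j\<in>{..n} - {i}. ((1 + R) / h) / \<bar>real i - real j\<bar>)"
  proof (intro prod_mono conjI)
    fix j assume j: "j \<in> {..n} - {i}"
    have "x i - x j = h * (real i - real j)" unfolding x h_def by (simp add: right_diff_distrib)
    then have "\<bar>1 / (x i - x j)\<bar> * (1 + \<bar>x j\<bar>) = ((1 + \<bar>x j\<bar>) / h) / \<bar>real i - real j\<bar>"
      using h by (simp add: abs_mult)
    also have "\<dots> \<le> ((1 + R) / h) / \<bar>real i - real j\<bar>"
      using R[of j] j h by (intro divide_right_mono) auto
    finally show "\<bar>1 / (x i - x j)\<bar> * (1 + \<bar>x j\<bar>) \<le> ((1 + R) / h) / \<bar>real i - real j\<bar>" .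
  qed auto
  also have "\<dots> = ((1 + R) / h) ^ n / (fact i * fact (n - i))"
    unfolding prod_dividef prod_abs_diff_nat[OF i] using i by (simp add: power_divide)
  also have "\<dots> \<le> ((1 + R) / h) ^ n * (2 ^ n / fact n)"
  proof -
    have "(fact i * fact (n - i)) * real (n choose i) = fact n"
      using binomial_fact_lemma[OF i] by (metis of_nat_fact of_nat_mult)
    moreover have "real (n choose i) \<le> 2 ^ n"
      using binomial_le_pow2[of n i] by (metis of_nat_le_iff of_nat_numeral of_nat_power)
    ultimately have "fact n \<le> (fact i * fact (n - i)) * (2 ^ n :: real)"
      by (metis mult_left_mono fact_ge_zero mult_nonneg_nonneg)
    then have "1 / (fact i * fact (n - i)) \<le> (2 ^ n / fact n :: real)"
      by (simp add: divide_simps mult.commute)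
    then show ?thesis
      using R0 h mult_left_mono[of "1 / (fact i * fact (n - i))" "2 ^ n / fact n" "((1 + R) / h) ^ n"]
      by (simp only: times_divide_eq_right mult_1_right) simp
  qed
  also have "\<dots> = (2 * (1 + R) / l) ^ n * (real (Suc n) ^ n / fact n)"
    by (simp add: h_def power_mult_distrib[symmetric] algebra_simps del: of_nat_Suc)
  also have "\<dots> \<le> (1 + 2 * (1 + R) / l) ^ Suc n * exp 1 ^ Suc n"
  proof (rule mult_mono)
    have "(2 * (1 + R) / l) ^ n \<le> (1 + 2 * (1 + R) / l) ^ n" using R0 l by (intro power_mono) auto
    also have "\<dots> \<le> (1 + 2 * (1 + R) / l) ^ Suc n" using R0 l by (intro power_increasing) auto
    finally show "(2 * (1 + R) / l) ^ n \<le> (1 + 2 * (1 + R) / l) ^ Suc n" .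
    \<comment> \<open>A single term of the exponential series at \<open>n + 1\<close> is bounded by
      the whole series.\<close>
    have "real (Suc n) ^ n / fact n = (\<Sum>k\<in>{n}. real (Suc n) ^ k / fact k)" by simp
    also have "\<dots> \<le> (\<Sum>k. real (Suc n) ^ k / fact k)"
      using exp_converges[of "real (Suc n)"]
      by (intro sum_le_suminf) (auto simp: sums_iff field_simps simp del: of_nat_Suc)
    also have "\<dots> = exp (real (Suc n))" by (simp add: exp_def field_simps)
    also have "\<dots> = exp 1 ^ Suc n" by (simp only: exp_of_nat_mult[symmetric] mult_1_right)
    finally show "real (Suc n) ^ n / fact n \<le> exp 1 ^ Suc n" .
  qed (use R0 l in auto)
  also have "\<dots> = (exp 1 * (1 + 2 * (1 + R) / l)) ^ Suc n"
    by (simp only: power_mult_distrib mult.commute)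
  finally show ?thesis .
qed

section \<open>Polynomials in several variables: from values to coefficients\<close>

definition mpoly_eval :: "real \<Rightarrow> real ^ 'd \<Rightarrow> nat \<Rightarrow> (nat ^ 'd::finite \<Rightarrow> real) \<Rightarrow> real ^ 'd \<Rightarrow> real" where
  "mpoly_eval \<sigma> x0 n a x = (\<Sum>\<beta> | mdeg \<beta> \<le> n. a \<beta> * scaled_mono \<sigma> x0 \<beta> x)"

text \<open>The tensor product of the one-variable coefficient functionals. A total degree of at
  most \<open>n\<close> bounds each exponent by \<open>n\<close>, so \<open>n + 1\<close> nodes per
  coordinate suffice.\<close>

lemma mpoly_coeff_eq_grid_sum:
  fixes a :: "nat ^ 'd::finite \<Rightarrow> real"
  assumes h: "h > 0" and \<sigma>: "\<sigma> > 0" and \<gamma>: "mdeg \<gamma> \<le> n"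
  shows "a \<gamma> = (\<Sum>i | \<forall>j. i $ j \<in> {..n}.
    (\<Prod>j\<in>UNIV. coeff (lagrange_poly (\<lambda>l. (s $ j - x0 $ j) / \<sigma> + h / \<sigma> * real l) n (i $ j)) (\<gamma> $ j)) *
    mpoly_eval \<sigma> x0 n a (s + h *\<^sub>R (\<chi> j. real (i $ j))))"
proof -
  define x where "x = (\<lambda>j (l :: nat). (s $ j - x0 $ j) / \<sigma> + h / \<sigma> * real l)"
  let ?c = "\<lambda>j i. coeff (lagrange_poly (x j) n i) (\<gamma> $ j)"
  have inj: "inj_on (x j) {..n}" for j using h \<sigma> by (auto simp: x_def inj_on_def)
  have mono: "scaled_mono \<sigma> x0 \<beta> (s + h *\<^sub>R (\<chi> j. real (i $ j))) = (\<Prod>j\<in>UNIV. x j (i $ j) ^ (\<beta> $ j))"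
    for \<beta> and i :: "nat ^ 'd"
    unfolding scaled_mono_eq_prod by (rule prod.cong) (auto simp: x_def add_divide_distrib diff_divide_distrib algebra_simps)
  have delta: "(\<Sum>i | \<forall>j. i $ j \<in> {..n}. \<Prod>j\<in>UNIV. ?c j (i $ j) * x j (i $ j) ^ (\<beta> $ j)) =
      (if \<beta> = \<gamma> then 1 else 0)" if "mdeg \<beta> \<le> n" for \<beta>
  proof -
    have "(\<Sum>i | \<forall>j. i $ j \<in> {..n}. \<Prod>j\<in>UNIV. ?c j (i $ j) * x j (i $ j) ^ (\<beta> $ j)) =
        (\<Prod>j\<in>UNIV. \<Sum>i\<le>n. ?c j i * x j i ^ (\<beta> $ j))"
      by (rule sum_vec_prod) simp
    also have "\<dots> = (\<Prod>j\<in>UNIV. if \<gamma> $ j = \<beta> $ j then 1 else 0)"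
      using that component_le_mdeg[of \<beta>] order_trans
      by (intro prod.cong refl sum_lagrange_coeff inj) blast
    also have "\<dots> = (if \<beta> = \<gamma> then 1 else 0)" by (auto simp: vec_eq_iff) metis
    finally show ?thesis .
  qed
  have "(\<Sum>i | \<forall>j. i $ j \<in> {..n}. (\<Prod>j\<in>UNIV. ?c j (i $ j)) * mpoly_eval \<sigma> x0 n a (s + h *\<^sub>R (\<chi> j. real (i $ j)))) =
      (\<Sum>\<beta> | mdeg \<beta> \<le> n. a \<beta> * (\<Sum>i | \<forall>j. i $ j \<in> {..n}. \<Prod>j\<in>UNIV. ?c j (i $ j) * x j (i $ j) ^ (\<beta> $ j)))"
    unfolding mpoly_eval_def mono sum_distrib_left prod.distrib
    by (subst sum.swap) (simp add: mult_ac)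
  also have "\<dots> = (\<Sum>\<beta> | mdeg \<beta> \<le> n. a \<beta> * (if \<beta> = \<gamma> then 1 else 0))"
    by (intro sum.cong refl arg_cong2[of _ _ _ _ "(*)"] delta) simp
  also have "\<dots> = a \<gamma>"
    using \<gamma> by (simp add: if_distrib finite_mdeg_le cong: if_cong)
  finally show ?thesis unfolding x_def ..
qed

lemma scaled_mono_continuous: "continuous_on A (scaled_mono \<sigma> x0 \<beta>)"
  unfolding scaled_mono_def mpow_def divide_inverse by (intro continuous_intros)

lemma mpoly_eval_continuous: "continuous_on A (mpoly_eval \<sigma> x0 n a)"
  unfolding mpoly_eval_def[abs_def] by (intro continuous_intros scaled_mono_continuous)

lemma mpoly_eval_measurable [measurable]: "mpoly_eval \<sigma> x0 n a \<in> borel_measurable borel"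
  by (rule borel_measurable_continuous_onI) (rule mpoly_eval_continuous)

text \<open>A coefficient of a polynomial of degree \<open>n\<close> is recovered from the values on a grid of
  \<open>(n + 1) ^ d\<close> points in a cube contained in \<open>U\<close>; averaging over translations of the grid
  turns the point values into an integral.\<close>

lemma mpoly_coeff_bound_lborel:
  fixes U :: "(real ^ 'd::finite) set"
  assumes \<sigma>: "\<sigma> > 0" and U: "open U" "U \<noteq> {}"
  obtains E where "E \<ge> 1"
    "\<And>n a \<gamma>. mdeg \<gamma> \<le> n \<Longrightarrow> ennreal ((a \<gamma>)\<^sup>2) \<le>
      ennreal (E ^ Suc n) * (\<integral>\<^sup>+x. ennreal ((mpoly_eval \<sigma> x0 n a x)\<^sup>2) * indicator U x \<partial>lborel)"
proof -
  let ?d = "CARD('d)"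
  obtain p where p: "p \<in> U" using U by blast
  then obtain e where e: "e > 0" "ball p e \<subseteq> U" using U open_contains_ball by blast
  \<comment> \<open>With this side length the sum of the coordinate distances in the cube is at most
    e / 2, so the cube lies in the ball.\<close>
  define \<eta> where "\<eta> = e / (2 * real ?d)"
  have \<eta>: "\<eta> > 0" using e by (simp add: \<eta>_def)
  have cube: "x \<in> U" if "\<And>j. p $ j \<le> x $ j \<and> x $ j \<le> p $ j + \<eta>" for x
  proof -
    have "norm (x - p) \<le> (\<Sum>j\<in>UNIV. \<bar>(x - p) $ j\<bar>)" by (rule norm_le_l1_cart)
    also have "\<dots> \<le> (\<Sum>j\<in>(UNIV :: 'd set). \<eta>)"
      using that by (intro sum_mono) (auto simp: abs_le_iff algebra_simps intro: order_trans)
    also have "\<dots> < e" using e by (simp add: \<eta>_def)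
    finally show ?thesis using e by (auto simp: dist_norm norm_minus_commute subset_iff)
  qed
  define R where "R = (\<Sum>j\<in>UNIV. \<bar>p $ j\<bar> + \<eta> + \<bar>x0 $ j\<bar>) / \<sigma>"
  have R: "\<bar>(x $ j - x0 $ j) / \<sigma>\<bar> \<le> R" if "\<And>j. p $ j \<le> x $ j \<and> x $ j \<le> p $ j + \<eta>" for x j
  proof -
    have "\<bar>x $ j - x0 $ j\<bar> \<le> \<bar>p $ j\<bar> + \<eta> + \<bar>x0 $ j\<bar>" using that[of j] \<eta> by linarith
    also have "\<dots> \<le> (\<Sum>j\<in>UNIV. \<bar>p $ j\<bar> + \<eta> + \<bar>x0 $ j\<bar>)"
      using \<eta> by (intro member_le_sum) auto
    finally show ?thesis using \<sigma> by (simp add: R_def divide_right_mono)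
  qed
  have R0: "R \<ge> 0" using \<sigma> \<eta> unfolding R_def by (intro divide_nonneg_pos sum_nonneg) auto
  define L where "L = exp 1 * (1 + 2 * (1 + R) / (\<eta> / \<sigma>))"
  have L1: "L \<ge> 1" unfolding L_def
  proof (rule mult_ge1_I)
    show "1 \<le> 1 + 2 * (1 + R) / (\<eta> / \<sigma>)" using R0 \<eta> \<sigma> by simp
  qed simp
  \<comment> \<open>The factors bound, in this order: the squared Lagrange coefficients (two), the
    number of grid points from squaring a sum, the number of grid integrals, and the inverse volume
    of the cube of translations. Each (n + 1)^d is estimated by (2^d)^(n + 1).\<close>
  define E where "E = L ^ ?d * L ^ ?d * 2 ^ ?d * 2 ^ ?d * (2 ^ ?d * (1 + 1 / \<eta>) ^ ?d)"
  have E1: "E \<ge> 1"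
    unfolding E_def using L1 \<eta> by (intro mult_ge1_I one_le_power) auto
  have bound: "ennreal ((a \<gamma>)\<^sup>2) \<le>
      ennreal (E ^ Suc n) * (\<integral>\<^sup>+x. ennreal ((mpoly_eval \<sigma> x0 n a x)\<^sup>2) * indicator U x \<partial>lborel)"
    if \<gamma>: "mdeg \<gamma> \<le> n" for n a \<gamma>
  proof -
    let ?q = "mpoly_eval \<sigma> x0 n a"
    \<comment> \<open>The grid uses \<open>n\<close> steps of this length and one more step is left
      for translations, so that every translated grid stays in the cube of side \<eta>.\<close>
    define h where "h = \<eta> / Suc n"
    have h: "h > 0" using \<eta> by (simp add: h_def)
    define G where "G = {i :: nat ^ 'd. \<forall>j. i $ j \<in> {..n}}"
    have finG: "finite G" unfolding G_def by (rule finite_vec_box) simp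
    have cardG: "real (card G) = real (Suc n) ^ ?d"
    proof -
      have "(\<Sum>i\<in>G. \<Prod>j\<in>(UNIV :: 'd set). 1) = (\<Prod>j\<in>(UNIV :: 'd set). \<Sum>k\<in>{..n}. 1 :: real)"
        unfolding G_def by (rule sum_vec_prod) simp
      then show ?thesis by simp
    qed
    define g where "g = (\<lambda>i :: nat ^ 'd. h *\<^sub>R (\<chi> j. real (i $ j)))"
    define S where "S = cbox p (p + (\<chi> j. h))"
    have S: "s \<in> S \<longleftrightarrow> (\<forall>j. p $ j \<le> s $ j \<and> s $ j \<le> p $ j + h)" for s
      by (simp add: S_def mem_box_cart)
    have grid: "p $ j \<le> (s + g i) $ j \<and> (s + g i) $ j \<le> p $ j + \<eta>" if "s \<in> S" "i \<in> G" for s i j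
    proof -
      have "h * real (i $ j) \<le> h * real n" using that h by (simp add: G_def mult_left_mono)
      moreover have "h + h * real n = \<eta>"
      proof -
        have "h + h * real n = h * real (Suc n)" by (simp add: algebra_simps)
        then show ?thesis by (simp add: h_def del: of_nat_Suc)
      qed
      moreover have "0 \<le> h * real (i $ j)" using h by simp
      ultimately show ?thesis using that(1)[unfolded S, rule_format, of j] by (simp add: g_def add_increasing2)
    qed
    have pw: "(a \<gamma>)\<^sup>2 \<le> (L ^ ?d * L ^ ?d * 2 ^ ?d) ^ Suc n * (\<Sum>i\<in>G. (?q (s + g i))\<^sup>2)" if s: "s \<in> S" for s
    proof -
      define c where "c = (\<lambda>i. \<Prod>j\<in>UNIV. coeff (lagrange_poly
        (\<lambda>l. (s $ j - x0 $ j) / \<sigma> + h / \<sigma> * real l) n (i $ j)) (\<gamma> $ j))"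
      have a: "a \<gamma> = (\<Sum>i\<in>G. c i * ?q (s + g i))"
        unfolding G_def c_def g_def by (rule mpoly_coeff_eq_grid_sum[OF h \<sigma> \<gamma>])
      have c: "(c i)\<^sup>2 \<le> (L ^ ?d * L ^ ?d) ^ Suc n" if i: "i \<in> G" for i
      proof -
        have "\<bar>c i\<bar> \<le> (\<Prod>j\<in>(UNIV :: 'd set). L ^ Suc n)"
          unfolding c_def abs_prod
        proof (intro prod_mono conjI)
          fix j
          show "\<bar>coeff (lagrange_poly (\<lambda>l. (s $ j - x0 $ j) / \<sigma> + h / \<sigma> * real l) n (i $ j)) (\<gamma> $ j)\<bar> \<le> L ^ Suc n"
            unfolding L_def
          proof (rule lagrange_coeff_bound)
            show "i $ j \<le> n" using i by (simp add: G_def)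
            show "0 < \<eta> / \<sigma>" using \<eta> \<sigma> by simp
            show "(s $ j - x0 $ j) / \<sigma> + h / \<sigma> * real l = (s $ j - x0 $ j) / \<sigma> + \<eta> / \<sigma> / Suc n * real l" for l
              by (simp add: h_def)
            show "\<bar>(s $ j - x0 $ j) / \<sigma> + h / \<sigma> * real l\<bar> \<le> R" if "l \<le> n" for l
            proof -
              have "(\<chi> j. l) \<in> G" using that by (simp add: G_def)
              from R[OF grid[OF s this], of j] show ?thesis
                by (simp add: g_def add_divide_distrib diff_divide_distrib algebra_simps)
            qed
          qed
        qed simp
        then have "\<bar>c i\<bar> \<le> (L ^ ?d) ^ Suc n" by (simp add: power_mult[symmetric] mult.commute del: power_Suc)
        then have "\<bar>c i\<bar> ^ 2 \<le> ((L ^ ?d) ^ Suc n) ^ 2" by (rule power_mono) simp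
        then show ?thesis by (simp only: power2_abs power2_eq_square power_mult_distrib)
      qed
      have "(a \<gamma>)\<^sup>2 \<le> (\<Sum>i\<in>G. (c i * ?q (s + g i))\<^sup>2) * card G"
        unfolding a by (rule sum_squared_le_sum_of_squares)
      also have "\<dots> \<le> (\<Sum>i\<in>G. (L ^ ?d * L ^ ?d) ^ Suc n * (?q (s + g i))\<^sup>2) * (2 ^ ?d) ^ Suc n"
      proof (rule mult_mono)
        show "(\<Sum>i\<in>G. (c i * ?q (s + g i))\<^sup>2) \<le> (\<Sum>i\<in>G. (L ^ ?d * L ^ ?d) ^ Suc n * (?q (s + g i))\<^sup>2)"
          unfolding power_mult_distrib[of "c _"] by (intro sum_mono mult_right_mono c) auto
        have "real (card G) \<le> (2 ^ Suc n) ^ ?d" unfolding cardG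
          using of_nat_mono[OF less_imp_le[OF less_exp[of "Suc n"]], where 'a = real]
          by (intro power_mono) simp_all
        then show "real (card G) \<le> (2 ^ ?d) ^ Suc n" by (simp only: power_mult[symmetric] mult.commute)
      qed (use L1 in \<open>auto intro!: sum_nonneg\<close>)
      also have "\<dots> = (L ^ ?d * L ^ ?d * 2 ^ ?d) ^ Suc n * (\<Sum>i\<in>G. (?q (s + g i))\<^sup>2)"
        by (simp only: sum_distrib_left[symmetric] power_mult_distrib mult_ac)
      finally show ?thesis .
    qed
    let ?I = "\<integral>\<^sup>+x. ennreal ((?q x)\<^sup>2) * indicator U x \<partial>lborel"
    let ?D = "(L ^ ?d * L ^ ?d * 2 ^ ?d) ^ Suc n"
    \<comment> \<open>By translation invariance, the integral over each translate of
      \<open>S\<close> is dominated by the same integral over \<open>U\<close>.\<close>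
    have shift: "(\<integral>\<^sup>+s. ennreal ((?q (s + g i))\<^sup>2) * indicator S s \<partial>lborel) \<le> ?I" if "i \<in> G" for i
    proof -
      have "(\<integral>\<^sup>+s. ennreal ((?q (s + g i))\<^sup>2) * indicator S s \<partial>lborel) \<le>
          (\<integral>\<^sup>+s. ennreal ((?q (g i + s))\<^sup>2) * indicator U (g i + s) \<partial>lborel)"
        using cube[OF grid[OF _ that]]
        by (intro nn_integral_mono) (auto simp: add.commute split: split_indicator)
      also have "\<dots> = (\<integral>\<^sup>+x. ennreal ((?q x)\<^sup>2) * indicator U x \<partial>distr lborel borel ((+) (g i)))"
        using U by (subst nn_integral_distr) auto
      finally show ?thesis unfolding lborel_distr_plus .
    qed
    have volS: "emeasure lborel S = ennreal (h ^ ?d)"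
    proof -
      have "S \<noteq> {}" using S[of p] h by auto
      then have "measure lborel S = (\<Prod>j\<in>(UNIV :: 'd set). h)"
        unfolding S_def by (subst content_cbox_cart) auto
      then show ?thesis
        using emeasure_eq_ennreal_measure[of lborel S] emeasure_lborel_cbox_finite[of p "p + (\<chi> j. h)"]
        by (simp add: S_def less_top)
    qed
    have "ennreal ((a \<gamma>)\<^sup>2) * ennreal (h ^ ?d) = (\<integral>\<^sup>+s. ennreal ((a \<gamma>)\<^sup>2) * indicator S s \<partial>lborel)"
      by (subst nn_integral_cmult_indicator) (simp_all add: volS, simp add: S_def)
    also have "\<dots> \<le> (\<integral>\<^sup>+s. ennreal ?D * (\<Sum>i\<in>G. ennreal ((?q (s + g i))\<^sup>2) * indicator S s) \<partial>lborel)"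
    proof (intro nn_integral_mono)
      fix s
      have "ennreal ((a \<gamma>)\<^sup>2) \<le> ennreal ?D * (\<Sum>i\<in>G. ennreal ((?q (s + g i))\<^sup>2))" if "s \<in> S"
        using pw[OF that] L1 by (simp add: sum_ennreal sum_nonneg ennreal_mult[symmetric] del: power_Suc)
      then show "ennreal ((a \<gamma>)\<^sup>2) * indicator S s \<le> ennreal ?D * (\<Sum>i\<in>G. ennreal ((?q (s + g i))\<^sup>2) * indicator S s)"
        by (auto split: split_indicator)
    qed
    also have "\<dots> = ennreal ?D * (\<Sum>i\<in>G. \<integral>\<^sup>+s. ennreal ((?q (s + g i))\<^sup>2) * indicator S s \<partial>lborel)"
      by (subst nn_integral_cmult, (simp add: S_def)) (subst nn_integral_sum, simp_all add: S_def)
    also have "\<dots> \<le> ennreal ?D * (\<Sum>i\<in>G. ?I)"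
      by (intro mult_left_mono sum_mono shift) auto
    also have "\<dots> = ennreal (?D * real (Suc n) ^ ?d) * ?I"
    proof -
      have "ennreal (?D * real (Suc n) ^ ?d) = ennreal ?D * ennreal (real (Suc n) ^ ?d)"
        using L1 by (intro ennreal_mult) simp_all
      then show ?thesis
        by (simp only: sum_constant ennreal_of_nat_eq_real_of_nat cardG mult.assoc)
    qed
    finally have main: "ennreal ((a \<gamma>)\<^sup>2) * ennreal (h ^ ?d) \<le> ennreal (?D * real (Suc n) ^ ?d) * ?I" .
    have "ennreal ((a \<gamma>)\<^sup>2) = ennreal ((a \<gamma>)\<^sup>2) * ennreal (h ^ ?d) * ennreal (1 / h ^ ?d)"
      using h by (simp add: mult.assoc ennreal_mult[symmetric])
    also have "\<dots> \<le> ennreal (?D * real (Suc n) ^ ?d) * ?I * ennreal (1 / h ^ ?d)"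
      by (intro mult_right_mono main) simp
    also have "\<dots> = ennreal (?D * real (Suc n) ^ ?d * (1 / h ^ ?d)) * ?I"
    proof -
      have "ennreal (?D * real (Suc n) ^ ?d * (1 / h ^ ?d)) =
          ennreal (?D * real (Suc n) ^ ?d) * ennreal (1 / h ^ ?d)"
        using L1 h by (intro ennreal_mult) simp_all
      then show ?thesis by (simp only: mult.assoc mult.commute[of ?I])
    qed
    also have "\<dots> \<le> ennreal (E ^ Suc n) * ?I"
    proof (intro mult_right_mono ennreal_leI)
      have n2: "real (Suc n) ^ ?d \<le> (2 ^ ?d) ^ Suc n"
      proof -
        have "real (Suc n) ^ ?d \<le> (2 ^ Suc n) ^ ?d"
          using of_nat_mono[OF less_imp_le[OF less_exp[of "Suc n"]], where 'a = real]
          by (intro power_mono) simp_all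
        then show ?thesis by (simp only: power_mult[symmetric] mult.commute)
      qed
      have "1 / h ^ ?d = (1 / \<eta>) ^ ?d * real (Suc n) ^ ?d"
        by (simp add: h_def power_divide)
      also have "\<dots> \<le> ((1 + 1 / \<eta>) ^ ?d) ^ Suc n * (2 ^ ?d) ^ Suc n"
      proof (intro mult_mono n2)
        have "(1 / \<eta>) ^ ?d \<le> ((1 + 1 / \<eta>) ^ ?d) ^ 1" using \<eta> by (simp add: power_mono)
        also have "\<dots> \<le> ((1 + 1 / \<eta>) ^ ?d) ^ Suc n" using \<eta> by (intro power_increasing one_le_power) auto
        finally show "(1 / \<eta>) ^ ?d \<le> ((1 + 1 / \<eta>) ^ ?d) ^ Suc n" .
      qed (use \<eta> in auto)
      finally have "?D * real (Suc n) ^ ?d * (1 / h ^ ?d) \<le>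
          ?D * (2 ^ ?d) ^ Suc n * (((1 + 1 / \<eta>) ^ ?d) ^ Suc n * (2 ^ ?d) ^ Suc n)"
        using L1 h n2 by (intro mult_mono) auto
      also have "\<dots> = E ^ Suc n"
        unfolding E_def by (simp only: power_mult_distrib mult_ac)
      finally show "?D * real (Suc n) ^ ?d * (1 / h ^ ?d) \<le> E ^ Suc n" .
    qed simp
    finally show ?thesis .
  qed
  show thesis by (rule that[OF E1 bound])
qed

section \<open>Projections onto polynomials\<close>

lemma essinf_pos_imp_AE:
  fixes \<rho> :: "'a::euclidean_space \<Rightarrow> real"
  assumes U: "open U" and pos: "essinf (restrict_space lborel U) \<rho> > 0"
  obtains \<delta> where "\<delta> > 0" "AE x in lborel. x \<in> U \<longrightarrow> \<delta> \<le> \<rho> x"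
proof -
  let ?M = "restrict_space lborel U"
  have "0 < - esssup ?M (\<lambda>x. - ereal (\<rho> x))" using pos by (simp add: essinf_def)
  then obtain \<delta> :: real where \<delta>: "0 < ereal \<delta>" "ereal \<delta> < - esssup ?M (\<lambda>x. - ereal (\<rho> x))"
    using ereal_dense2 by blast
  have "AE x in ?M. - ereal (\<rho> x) \<le> esssup ?M (\<lambda>x. - ereal (\<rho> x))" by (rule esssup_AE)
  then have "AE x in ?M. \<delta> \<le> \<rho> x"
  proof eventually_elim
    case (elim x)
    have "esssup ?M (\<lambda>x. - ereal (\<rho> x)) < - ereal \<delta>"
      using \<delta>(2) by (subst ereal_less_uminus_reorder) 
    with elim have "- ereal (\<rho> x) < - ereal \<delta>" by (rule le_less_trans)
    then show ?case by simp
  qed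
  then have "AE x in lborel. x \<in> U \<longrightarrow> \<delta> \<le> \<rho> x"
    using U by (subst (asm) AE_restrict_space_iff) auto
  then show thesis using that \<delta> by simp
qed

text \<open>What the convergence proof uses of the law of the samples. The positive lower bound on
  the density enters only through \<open>coeff_bound\<close>, whose base \<open>E\<close> does not
  depend on the degree.\<close>

locale sampling_measure = prob_space \<mu> for \<mu> :: "(real ^ 'd::finite) measure" +
  fixes S :: "(real ^ 'd) set" and \<sigma> :: real and x0 :: "real ^ 'd" and E :: real
  assumes sets_eq [measurable_cong]: "sets \<mu> = sets borel"
    and compact_S: "compact S" and AE_S: "AE x in \<mu>. x \<in> S"
    and \<sigma>_pos: "\<sigma> > 0" and E_ge_1: "E \<ge> 1"
    and coeff_bound: "\<And>n a \<gamma>. mdeg \<gamma> \<le> n \<Longrightarrow>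
      ennreal ((a \<gamma>)\<^sup>2) \<le> ennreal (E ^ Suc n) * (\<integral>\<^sup>+x. ennreal ((mpoly_eval \<sigma> x0 n a x)\<^sup>2) \<partial>\<mu>)"

lemma sampling_measure_density:
  fixes \<rho> :: "real ^ 'd::finite \<Rightarrow> real"
  assumes prob: "prob_space (density lborel (\<lambda>x. ennreal (\<rho> x)))"
    and \<rho> [measurable]: "\<rho> \<in> borel_measurable borel" and \<rho>0: "\<And>x. \<rho> x \<ge> 0" and S: "compact (closure {x. \<rho> x \<noteq> 0})"
    and \<sigma>: "\<sigma> > 0" and U: "open U" "U \<noteq> {}" and pos: "essinf (restrict_space lborel U) \<rho> > 0"
  obtains E where "sampling_measure (density lborel (\<lambda>x. ennreal (\<rho> x))) (closure {x. \<rho> x \<noteq> 0}) \<sigma> x0 E"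
proof -
  let ?\<mu> = "density lborel (\<lambda>x. ennreal (\<rho> x))"
  obtain \<delta> where \<delta>: "\<delta> > 0" "AE x in lborel. x \<in> U \<longrightarrow> \<delta> \<le> \<rho> x"
    using essinf_pos_imp_AE[OF U(1) pos] .
  obtain E where E: "E \<ge> 1"
    "\<And>n a \<gamma>. mdeg \<gamma> \<le> n \<Longrightarrow> ennreal ((a \<gamma>)\<^sup>2) \<le>
      ennreal (E ^ Suc n) * (\<integral>\<^sup>+x. ennreal ((mpoly_eval \<sigma> x0 n a x)\<^sup>2) * indicator U x \<partial>lborel)"
    using mpoly_coeff_bound_lborel[OF \<sigma> U, where ?x0.0 = x0] by blast
  \<comment> \<open>The exponent \<open>Suc n\<close> is at least 1, so enlarging the base absorbs
    the factor 1 / \<delta> from comparing Lebesgue measure on \<open>U\<close> with the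
    density.\<close>
  define E' where "E' = E * (1 + 1 / \<delta>)"
  have "sampling_measure ?\<mu> (closure {x. \<rho> x \<noteq> 0}) \<sigma> x0 E'"
  proof (intro sampling_measure.intro prob sampling_measure_axioms.intro S \<sigma>)
    show "sets ?\<mu> = sets borel" by simp
    show "AE x in ?\<mu>. x \<in> closure {x. \<rho> x \<noteq> 0}"
      using closure_subset[of "{x. \<rho> x \<noteq> 0}"] by (subst AE_density) (auto intro!: AE_I2)
    show "E' \<ge> 1" unfolding E'_def using E(1) \<delta>(1) by (intro mult_ge1_I) auto
    fix n a and \<gamma> :: "nat ^ 'd" assume \<gamma>: "mdeg \<gamma> \<le> n"
    let ?q = "\<lambda>x. ennreal ((mpoly_eval \<sigma> x0 n a x)\<^sup>2)"
    have "ennreal ((a \<gamma>)\<^sup>2) \<le> ennreal (E ^ Suc n) * (\<integral>\<^sup>+x. ?q x * indicator U x \<partial>lborel)"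
      by (rule E(2)[OF \<gamma>])
    also have "(\<integral>\<^sup>+x. ?q x * indicator U x \<partial>lborel) \<le> (\<integral>\<^sup>+x. ennreal (1 / \<delta>) * (ennreal (\<rho> x) * ?q x) \<partial>lborel)"
    proof (rule nn_integral_mono_AE)
      show "AE x in lborel. ?q x * indicator U x \<le> ennreal (1 / \<delta>) * (ennreal (\<rho> x) * ?q x)"
        using \<delta>(2)
      proof eventually_elim
        case (elim x)
        have "1 * ?q x \<le> (ennreal (1 / \<delta>) * ennreal (\<rho> x)) * ?q x" if "x \<in> U"
        proof (rule mult_right_mono)
          have "1 \<le> 1 / \<delta> * \<rho> x" using elim that \<delta>(1) by (simp add: field_simps)
          then show "1 \<le> ennreal (1 / \<delta>) * ennreal (\<rho> x)"
            using \<delta>(1) \<rho>0[of x] by (simp add: ennreal_mult[symmetric])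
        qed simp
        then show ?case by (auto simp: mult.assoc split: split_indicator)
      qed
    qed
    also have "\<dots> = ennreal (1 / \<delta>) * (\<integral>\<^sup>+x. ?q x \<partial>?\<mu>)"
      by (simp add: nn_integral_cmult nn_integral_density)
    also have "ennreal (E ^ Suc n) * (ennreal (1 / \<delta>) * (\<integral>\<^sup>+x. ?q x \<partial>?\<mu>)) =
        ennreal (E ^ Suc n * (1 / \<delta>)) * (\<integral>\<^sup>+x. ?q x \<partial>?\<mu>)"
    proof -
      have "ennreal (E ^ Suc n * (1 / \<delta>)) = ennreal (E ^ Suc n) * ennreal (1 / \<delta>)"
        using E(1) \<delta>(1) by (intro ennreal_mult) auto
      then show ?thesis by (simp only: mult.assoc)
    qed
    also have "\<dots> \<le> ennreal (E' ^ Suc n) * (\<integral>\<^sup>+x. ?q x \<partial>?\<mu>)"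
    proof (intro mult_right_mono ennreal_leI)
      have "(1 / \<delta>) \<le> (1 + 1 / \<delta>) ^ Suc n"
        using \<delta>(1) self_le_power[of "1 + 1 / \<delta>" "Suc n"] by simp
      then show "E ^ Suc n * (1 / \<delta>) \<le> E' ^ Suc n"
        unfolding E'_def power_mult_distrib using E(1) by (intro mult_left_mono) auto
    qed simp
    finally show "ennreal ((a \<gamma>)\<^sup>2) \<le> ennreal (E' ^ Suc n) * (\<integral>\<^sup>+x. ?q x \<partial>?\<mu>)"
      by (simp add: mult_left_mono)
  qed
  then show thesis by (rule that)
qed

context sampling_measure
begin

lemma integrable_continuous:
  fixes g :: "real ^ 'd \<Rightarrow> real"
  assumes "continuous_on UNIV g"
  shows "integrable \<mu> g"
proof -
  have [measurable]: "g \<in> borel_measurable borel" using assms by (rule borel_measurable_continuous_onI)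
  have "bounded (g ` S)"
    using compact_S assms by (intro compact_imp_bounded compact_continuous_image) (auto intro: continuous_on_subset)
  then obtain B where B: "\<And>x. x \<in> S \<Longrightarrow> norm (g x) \<le> B" by (auto simp: bounded_iff)
  have "AE x in \<mu>. norm (g x) \<le> B" using AE_S by eventually_elim (rule B)
  then show ?thesis by (rule integrable_const_bound) measurable
qed

lemma coeff_bound_integral:
  assumes "mdeg \<gamma> \<le> n"
  shows "(a \<gamma>)\<^sup>2 \<le> E ^ Suc n * (\<integral>x. (mpoly_eval \<sigma> x0 n a x)\<^sup>2 \<partial>\<mu>)"
proof -
  have "integrable \<mu> (\<lambda>x. (mpoly_eval \<sigma> x0 n a x)\<^sup>2)"
    by (intro integrable_continuous continuous_intros mpoly_eval_continuous)
  then have "(\<integral>\<^sup>+x. ennreal ((mpoly_eval \<sigma> x0 n a x)\<^sup>2) \<partial>\<mu>) = ennreal (\<integral>x. (mpoly_eval \<sigma> x0 n a x)\<^sup>2 \<partial>\<mu>)"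
    by (rule nn_integral_eq_integral) simp
  moreover have "0 \<le> (\<integral>x. (mpoly_eval \<sigma> x0 n a x)\<^sup>2 \<partial>\<mu>)" by simp
  ultimately show ?thesis
    using coeff_bound[OF assms, of a] E_ge_1 by (simp add: ennreal_mult[symmetric] ennreal_le_iff del: power_Suc)
qed

lemma integral_mpoly_orthogonal:
  assumes u: "continuous_on UNIV u"
    and orth: "\<And>\<gamma>. mdeg \<gamma> \<le> n \<Longrightarrow> (\<integral>x. u x * scaled_mono \<sigma> x0 \<gamma> x \<partial>\<mu>) = 0"
  shows "(\<integral>x. u x * mpoly_eval \<sigma> x0 n a x \<partial>\<mu>) = 0"
proof -
  have int: "integrable \<mu> (\<lambda>x. u x * scaled_mono \<sigma> x0 \<gamma> x)" for \<gamma>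
    by (intro integrable_continuous continuous_intros u scaled_mono_continuous)
  have "(\<integral>x. u x * mpoly_eval \<sigma> x0 n a x \<partial>\<mu>) =
      (\<integral>x. (\<Sum>\<gamma> | mdeg \<gamma> \<le> n. a \<gamma> * (u x * scaled_mono \<sigma> x0 \<gamma> x)) \<partial>\<mu>)"
    by (simp add: mpoly_eval_def sum_distrib_left mult_ac)
  also have "\<dots> = (\<Sum>\<gamma> | mdeg \<gamma> \<le> n. a \<gamma> * (\<integral>x. u x * scaled_mono \<sigma> x0 \<gamma> x \<partial>\<mu>))"
    using int by (subst Bochner_Integration.integral_sum) auto
  also have "\<dots> = 0" using orth by simp
  finally show ?thesis .
qed

text \<open>Such a polynomial is orthogonal to itself, and the coefficient bound turns its zero norm
  into zero coefficients. This makes the limiting Gram matrix nonsingular.\<close>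

lemma mpoly_orthogonal_imp_zero:
  assumes "\<And>\<gamma>. mdeg \<gamma> \<le> n \<Longrightarrow> (\<integral>x. mpoly_eval \<sigma> x0 n a x * scaled_mono \<sigma> x0 \<gamma> x \<partial>\<mu>) = 0"
    and "mdeg \<beta> \<le> n"
  shows "a \<beta> = 0"
proof -
  have "(\<integral>x. (mpoly_eval \<sigma> x0 n a x)\<^sup>2 \<partial>\<mu>) = 0"
    unfolding power2_eq_square by (rule integral_mpoly_orthogonal[OF mpoly_eval_continuous assms(1)])
  then show ?thesis using coeff_bound_integral[OF assms(2), of a] by simp
qed

text \<open>The Taylor polynomial of degree \<open>n\<close> is so close to \<open>h\<close> on the support that the exponential
  loss \<open>E ^ n\<close> in passing from the \<open>L\<^sup>2\<close> norm to coefficients does no harm.\<close>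

lemma projection_coeff_tendsto:
  fixes H :: "(real ^ 'd \<Rightarrow> real) set"
  assumes rkhs: "is_rkhs (exp_kernel \<sigma> x0) H ip" and h: "h \<in> H" and cont: "continuous_on UNIV h"
    and orth: "\<And>n \<gamma>. n \<ge> n0 \<Longrightarrow> mdeg \<gamma> \<le> n \<Longrightarrow>
      (\<integral>x. (h x - mpoly_eval \<sigma> x0 n (p n) x) * scaled_mono \<sigma> x0 \<gamma> x \<partial>\<mu>) = 0"
  shows "(\<lambda>n. p n \<beta>) \<longlonglongrightarrow> taylor_coeff \<sigma> x0 ip h \<beta>"
proof -
  \<comment> \<open>Twice the base of the coefficient bound: after the loss of
    \<open>E ^ Suc n\<close>, a factor \<open>(1 / 2) ^ n\<close> remains.\<close>
  let ?a = "taylor_coeff \<sigma> x0 ip h" and ?r = "2 * E"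
  have "bounded ((\<lambda>x. norm (x - x0)) ` S)"
    using compact_S by (intro compact_imp_bounded compact_continuous_image continuous_intros) auto
  then obtain R where R: "\<And>x. x \<in> S \<Longrightarrow> norm (x - x0) \<le> R" by (auto simp: bounded_iff)
  define Q where "Q = ip h h * exp (?r * (R / \<sigma>)\<^sup>2)"
  interpret rkhs_fun H ip "exp_kernel \<sigma> x0" using rkhs by (rule rkhs_funI)
  have bound: "(p n \<beta> - ?a \<beta>)\<^sup>2 \<le> E * Q * (1 / 2) ^ n" if n: "n \<ge> n0" "mdeg \<beta> \<le> n" for n
  proof -
    \<comment> \<open>Here \<open>u\<close> is the Taylor error and \<open>u - q\<close> the
      projection error, which is orthogonal to polynomials of degree at most \<open>n\<close>. So
      \<open>q\<close> is the projection of \<open>u\<close>, and its norm is at most that of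
      \<open>u\<close>.\<close>
    define q where "q = mpoly_eval \<sigma> x0 n (\<lambda>\<beta>. p n \<beta> - ?a \<beta>)"
    define u where "u = (\<lambda>x. h x - mpoly_eval \<sigma> x0 n ?a x)"
    have q_eq: "q x = mpoly_eval \<sigma> x0 n (p n) x - mpoly_eval \<sigma> x0 n ?a x" for x
      by (simp add: q_def mpoly_eval_def sum_subtractf left_diff_distrib)
    have cq: "continuous_on UNIV q" unfolding q_def by (rule mpoly_eval_continuous)
    have cu: "continuous_on UNIV u" unfolding u_def by (intro continuous_intros cont mpoly_eval_continuous)
    have int: "integrable \<mu> (\<lambda>x. (q x)\<^sup>2)" "integrable \<mu> (\<lambda>x. (u x)\<^sup>2)"
      by (intro integrable_continuous continuous_intros cq cu)+
    have int': "integrable \<mu> (\<lambda>x. u x * q x)" "integrable \<mu> (\<lambda>x. (u x - q x) * q x)"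
      by (intro integrable_continuous continuous_intros cq cu)+
    have "(\<integral>x. (u x - q x) * q x \<partial>\<mu>) = 0"
      unfolding q_def
    proof (rule integral_mpoly_orthogonal)
      show "continuous_on UNIV (\<lambda>x. u x - mpoly_eval \<sigma> x0 n (\<lambda>\<beta>. p n \<beta> - ?a \<beta>) x)"
        by (intro continuous_intros cu mpoly_eval_continuous)
      show "(\<integral>x. (u x - mpoly_eval \<sigma> x0 n (\<lambda>\<beta>. p n \<beta> - ?a \<beta>) x) * scaled_mono \<sigma> x0 \<gamma> x \<partial>\<mu>) = 0"
        if "mdeg \<gamma> \<le> n" for \<gamma>
        using orth[OF n(1) that] q_eq unfolding q_def by (simp add: u_def)
    qed
    moreover have "(\<integral>x. (u x - q x) * q x \<partial>\<mu>) = (\<integral>x. u x * q x \<partial>\<mu>) - (\<integral>x. (q x)\<^sup>2 \<partial>\<mu>)"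
      using int int' by (subst Bochner_Integration.integral_diff[symmetric])
        (auto simp: left_diff_distrib power2_eq_square)
    moreover have "(\<integral>x. u x * q x \<partial>\<mu>) \<le> (\<integral>x. ((u x)\<^sup>2 + (q x)\<^sup>2) / 2 \<partial>\<mu>)"
    proof (rule integral_mono)
      show "u x * q x \<le> ((u x)\<^sup>2 + (q x)\<^sup>2) / 2" for x
        using sum_squares_bound[of "u x" "q x"] by simp
    qed (use int int' in auto)
    moreover have "(\<integral>x. ((u x)\<^sup>2 + (q x)\<^sup>2) / 2 \<partial>\<mu>) = ((\<integral>x. (u x)\<^sup>2 \<partial>\<mu>) + (\<integral>x. (q x)\<^sup>2 \<partial>\<mu>)) / 2"
      using int by simp
    ultimately have le: "(\<integral>x. (q x)\<^sup>2 \<partial>\<mu>) \<le> (\<integral>x. (u x)\<^sup>2 \<partial>\<mu>)" by simp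
    have "AE x in \<mu>. ?r ^ n * (u x)\<^sup>2 \<le> Q"
      using AE_S
    proof eventually_elim
      case (elim x)
      have "?r ^ n * (u x)\<^sup>2 \<le> ip h h * exp (?r * (norm (x - x0) / \<sigma>)\<^sup>2)"
        unfolding u_def mpoly_eval_def using E_ge_1
        by (intro taylor_error_bound[OF rkhs \<sigma>_pos h]) simp
      also have "\<dots> \<le> Q"
        unfolding Q_def using R[OF elim] \<sigma>_pos E_ge_1 ip_nonneg[OF h]
        by (intro mult_left_mono) (auto intro!: mult_left_mono power_mono divide_right_mono)
      finally show ?case .
    qed
    then have "(\<integral>x. ?r ^ n * (u x)\<^sup>2 \<partial>\<mu>) \<le> (\<integral>x. Q \<partial>\<mu>)"
      using int by (intro integral_mono_AE) auto
    then have u: "?r ^ n * (\<integral>x. (u x)\<^sup>2 \<partial>\<mu>) \<le> Q" by (simp add: prob_space)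
    have "(p n \<beta> - ?a \<beta>)\<^sup>2 \<le> E ^ Suc n * (\<integral>x. (q x)\<^sup>2 \<partial>\<mu>)"
      using coeff_bound_integral[OF n(2), of "\<lambda>\<beta>. p n \<beta> - ?a \<beta>"] by (simp add: q_def)
    also have "\<dots> \<le> E ^ Suc n * (\<integral>x. (u x)\<^sup>2 \<partial>\<mu>)"
      using le E_ge_1 by (intro mult_left_mono) auto
    also have "\<dots> = E * (1 / 2) ^ n * (?r ^ n * (\<integral>x. (u x)\<^sup>2 \<partial>\<mu>))"
      by (simp add: power_mult_distrib power_divide)
    also have "\<dots> \<le> E * (1 / 2) ^ n * Q"
      using E_ge_1 u by (intro mult_left_mono) auto
    finally show ?thesis by (simp add: mult_ac)
  qed
  have "(\<lambda>n. E * Q * (1 / 2) ^ n) \<longlonglongrightarrow> 0"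
    by (intro tendsto_mult_right_zero LIMSEQ_realpow_zero) auto
  then have "(\<lambda>n. (p n \<beta> - ?a \<beta>)\<^sup>2) \<longlonglongrightarrow> 0"
  proof (rule Lim_null_comparison[rotated])
    show "\<forall>\<^sub>F n in sequentially. norm ((p n \<beta> - ?a \<beta>)\<^sup>2) \<le> E * Q * (1 / 2) ^ n"
      using eventually_ge_at_top[of "max n0 (mdeg \<beta>)"] by eventually_elim (use bound in auto)
  qed
  then have "(\<lambda>n. sqrt ((p n \<beta> - ?a \<beta>)\<^sup>2)) \<longlonglongrightarrow> sqrt 0" by (rule tendsto_real_sqrt)
  then have "(\<lambda>n. p n \<beta> - ?a \<beta>) \<longlonglongrightarrow> 0" by (simp add: tendsto_rabs_zero_iff)
  then show ?thesis by (rule LIM_zero_cancel)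
qed

end

section \<open>Law of large numbers and multi-index counting\<close>

text \<open>By Hoeffding's inequality the deviation probabilities decay geometrically, so they are
  summable and Borel-Cantelli applies; countably many tolerances 1 / (k + 1) give
  convergence.\<close>

lemma (in prob_space) slln_bounded:
  fixes Y :: "nat \<Rightarrow> 'a \<Rightarrow> real"
  assumes indep: "indep_vars (\<lambda>_. borel) Y UNIV"
    and distr: "\<And>i. distr M borel (Y i) = distr M borel (Y 0)"
    and bounded: "AE \<omega> in M. \<bar>Y 0 \<omega>\<bar> \<le> B"
  shows "AE \<omega> in M. (\<lambda>N. (\<Sum>l<N. Y l \<omega>) / real N) \<longlonglongrightarrow> expectation (Y 0)"
proof -
  \<comment> \<open>Adding 1 keeps the interval from -b to b nondegenerate, as the Hoeffding bound
    requires.\<close>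
  define b where "b = \<bar>B\<bar> + 1"
  have b: "b > 0" by (simp add: b_def)
  have rv [measurable]: "random_variable borel (Y i)" for i
    using indep by (simp add: indep_vars_def)
  have ae: "AE \<omega> in M. Y 0 \<omega> \<in> {-b..b}"
    using bounded by eventually_elim (auto simp: b_def)
  have iid: "Hoeffding_ineq_iid M {..<N} Y (Y 0) (-b) b" for N
    by unfold_locales (use indep_vars_subset[OF indep] distr ae in auto)
  let ?\<mu> = "expectation (Y 0)"
  have dev: "AE \<omega> in M. \<forall>\<^sub>F N in sequentially. \<bar>(\<Sum>l<N. Y l \<omega>) / real N - ?\<mu>\<bar> < \<epsilon>" if \<epsilon>: "\<epsilon> > 0" for \<epsilon>
  proof -
    define A where "A = (\<lambda>N. {\<omega> \<in> space M. \<bar>(\<Sum>l<N. Y l \<omega>) / real N - ?\<mu>\<bar> \<ge> \<epsilon>})"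
    define q where "q = exp (- 2 * \<epsilon>\<^sup>2 / (2 * b)\<^sup>2)"
    have q: "0 \<le> q" "q < 1" using \<epsilon> b by (auto simp: q_def divide_less_0_iff)
    have bound: "prob (A N) \<le> 2 * q ^ N" for N
    proof (cases "N = 0")
      case False
      interpret H: Hoeffding_ineq_iid M "{..<N}" Y "Y 0" "-b" b ?\<mu> by (rule iid)
      have "prob (A N) \<le> 2 * exp (- 2 * real N * \<epsilon>\<^sup>2 / (2 * b)\<^sup>2)"
      proof -
        have "-b < b" "{..<N} \<noteq> {}" using b False by auto
        from H.Hoeffding_ineq_abs_ge'[OF less_imp_le[OF \<epsilon>] this]
        show ?thesis unfolding A_def card_lessThan minus_minus diff_minus_eq_add mult_2 .
      qed
      also have "exp (- 2 * real N * \<epsilon>\<^sup>2 / (2 * b)\<^sup>2) = q ^ N"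
        unfolding q_def exp_of_nat_mult[symmetric] by (simp add: field_simps)
      finally show ?thesis .
    qed (simp add: order_trans[OF prob_le_1])
    have "AE \<omega> in M. \<forall>\<^sub>F N in sequentially. \<omega> \<in> space M - A N"
    proof (rule borel_cantelli_AE1)
      show "A N \<in> sets M" for N unfolding A_def by measurable
      show "emeasure M (A N) < \<infinity>" for N by (simp add: emeasure_eq_measure)
      have "summable (\<lambda>N. 2 * q ^ N)" using q by (intro summable_mult summable_geometric) simp
      then show "summable (\<lambda>N. prob (A N))"
        by (rule summable_comparison_test'[where N = 0]) (use bound in simp)
    qed
    then show ?thesis
    proof eventually_elim
      case (elim \<omega>)
      then show ?case by (rule eventually_mono) (auto simp: A_def not_le)
    qed
  qed
  have "AE \<omega> in M. \<forall>k. \<forall>\<^sub>F N in sequentially. \<bar>(\<Sum>l<N. Y l \<omega>) / real N - ?\<mu>\<bar> < 1 / real (Suc k)"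
    unfolding AE_all_countable by (intro allI dev) simp
  then show ?thesis
  proof eventually_elim
    case (elim \<omega>)
    show ?case
    proof (rule tendstoI)
      fix e :: real assume "e > 0"
      then obtain k where "1 / real (Suc k) < e"
        using reals_Archimedean[of e] by (auto simp: inverse_eq_divide)
      with elim[rule_format, of k] show "\<forall>\<^sub>F N in sequentially. dist ((\<Sum>l<N. Y l \<omega>) / real N) ?\<mu> < e"
        by (auto simp: dist_real_def elim: eventually_mono)
    qed
  qed
qed

lemma (in prob_space) slln_bounded_function:
  fixes X :: "nat \<Rightarrow> 'a \<Rightarrow> 'b::topological_space" and \<phi> :: "'b \<Rightarrow> real"
  assumes indep: "indep_vars (\<lambda>_. borel) X UNIV"
    and distr: "\<And>i. distr M borel (X i) = \<mu>"
    and \<phi> [measurable]: "\<phi> \<in> borel_measurable borel"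
    and bounded: "AE x in \<mu>. \<bar>\<phi> x\<bar> \<le> B"
  shows "AE \<omega> in M. (\<lambda>N. (\<Sum>l<N. \<phi> (X l \<omega>)) / real N) \<longlonglongrightarrow> (\<integral>x. \<phi> x \<partial>\<mu>)"
proof -
  have rv [measurable]: "random_variable borel (X i)" for i
    using indep by (simp add: indep_vars_def)
  have "AE \<omega> in M. (\<lambda>N. (\<Sum>l<N. \<phi> (X l \<omega>)) / real N) \<longlonglongrightarrow> expectation (\<lambda>\<omega>. \<phi> (X 0 \<omega>))"
  proof (rule slln_bounded)
    show "indep_vars (\<lambda>_. borel) (\<lambda>i \<omega>. \<phi> (X i \<omega>)) UNIV"
      by (rule indep_vars_compose2[OF indep]) simp
    have "distr M borel (\<lambda>\<omega>. \<phi> (X i \<omega>)) = distr \<mu> borel \<phi>" for i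
      using distr_distr[of \<phi> borel borel "X i" M] by (simp add: o_def distr)
    then show "distr M borel (\<lambda>\<omega>. \<phi> (X i \<omega>)) = distr M borel (\<lambda>\<omega>. \<phi> (X 0 \<omega>))" for i by simp
    have "AE x in distr M borel (X 0). \<bar>\<phi> x\<bar> \<le> B" unfolding distr by (rule bounded)
    then show "AE \<omega> in M. \<bar>\<phi> (X 0 \<omega>)\<bar> \<le> B" by (subst (asm) AE_distr_iff) auto
  qed
  also have "expectation (\<lambda>\<omega>. \<phi> (X 0 \<omega>)) = (\<integral>x. \<phi> x \<partial>\<mu>)"
    unfolding distr[of 0, symmetric] by (rule integral_distr[symmetric]) auto
  finally show ?thesis .
qed

text \<open>Stars and bars: a slack entry \<open>n - mdeg \<beta>\<close> at the head of the list of
  components turns degree at most \<open>n\<close> into sum exactly \<open>n\<close>.\<close>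

lemma card_mdeg_le: "card {\<beta> :: nat ^ 'd::finite. mdeg \<beta> \<le> n} = rdim TYPE('d) n"
proof -
  let ?d = "CARD('d)"
  obtain c :: "nat \<Rightarrow> 'd" where c: "bij_betw c {..<?d} UNIV"
    using ex_bij_betw_nat_finite[of "UNIV :: 'd set"] by (auto simp: atLeast0LessThan)
  define c' where "c' = inv_into {..<?d} c"
  have c': "c' j < ?d" "c (c' j) = j" for j
    using bij_betw_inv_into_right[OF c] bij_betw_apply[OF bij_betw_inv_into[OF c]] by (auto simp: c'_def)
  have c'c: "c' (c i) = i" if "i < ?d" for i
    using bij_betw_inv_into_left[OF c] that by (simp add: c'_def)
  have mdeg: "mdeg \<beta> = sum_list (map (\<lambda>i. \<beta> $ c i) [0..<?d])" for \<beta> :: "nat ^ 'd"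
    unfolding mdeg_def sum.reindex_bij_betw[OF c, symmetric]
    by (simp add: interv_sum_list_conv_sum_set_nat atLeast0LessThan)
  let ?L = "{l :: nat list. length l = Suc ?d \<and> sum_list l = n}"
  define F where "F = (\<lambda>\<beta> :: nat ^ 'd. (n - mdeg \<beta>) # map (\<lambda>i. \<beta> $ c i) [0..<?d])"
  define F' where "F' = (\<lambda>l :: nat list. \<chi> j. tl l ! c' j)"
  have F'F: "F' (F \<beta>) = \<beta>" for \<beta> by (simp add: F_def F'_def vec_eq_iff c')
  have mdegF': "map (\<lambda>i. F' l $ c i) [0..<?d] = tl l" if "length l = Suc ?d" for l
    using that by (intro nth_equalityI) (auto simp: F'_def c'c)
  have "bij_betw F {\<beta>. mdeg \<beta> \<le> n} ?L"
  proof (rule bij_betw_byWitness[where f' = F'])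
    show "\<forall>\<beta>\<in>{\<beta>. mdeg \<beta> \<le> n}. F' (F \<beta>) = \<beta>" using F'F by blast
    have sum_tl: "mdeg (F' l) = sum_list (tl l)" if "length l = Suc ?d" for l
      unfolding mdeg mdegF'[OF that] ..
    have split: "sum_list l = hd l + sum_list (tl l)" "l = hd l # tl l" if "length l = Suc ?d" for l :: "nat list"
      using that by (cases l; simp)+
    show "\<forall>l\<in>?L. F (F' l) = l"
    proof
      fix l assume l: "l \<in> ?L"
      then have len: "length l = Suc ?d" and "sum_list l = n" by auto
      then have "n - mdeg (F' l) = hd l" unfolding sum_tl[OF len] using split(1)[OF len] by simp
      then show "F (F' l) = l" unfolding F_def mdegF'[OF len] using split(2)[OF len] by simp
    qed
    show "F ` {\<beta>. mdeg \<beta> \<le> n} \<subseteq> ?L" by (auto simp: F_def mdeg[symmetric])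
    show "F' ` ?L \<subseteq> {\<beta>. mdeg \<beta> \<le> n}" using sum_tl split(1) by fastforce
  qed
  then have "card {\<beta> :: nat ^ 'd. mdeg \<beta> \<le> n} = card ?L" by (rule bij_betw_same_card)
  also have "\<dots> = (n + ?d) choose n" using card_length_sum_list[of "Suc ?d" n] by simp
  also have "\<dots> = rdim TYPE('d) n" unfolding rdim_def using binomial_symmetric[of n "n + ?d"] by simp
  finally show ?thesis .
qed

text \<open>By monotonicity the indices of degree at most \<open>n\<close> form an initial segment,
  and their number determines it. This translates matrix dimensions into degrees.\<close>

lemma graded_enum_less_rdim:
  fixes \<alpha> :: "nat \<Rightarrow> nat ^ 'd::finite"
  assumes \<alpha>: "graded_enum c \<alpha>"
  shows "i < rdim TYPE('d) n \<longleftrightarrow> mdeg (\<alpha> i) \<le> n"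
proof -
  define A where "A = {i. mdeg (\<alpha> i) \<le> n}"
  have bij: "bij \<alpha>" and mono: "\<And>i j. i \<le> j \<Longrightarrow> mdeg (\<alpha> i) \<le> mdeg (\<alpha> j)"
    using \<alpha> by (auto simp: graded_enum_def)
  have "bij_betw \<alpha> A {\<beta>. mdeg \<beta> \<le> n}"
    unfolding A_def using bij_betw_subset[OF bij subset_UNIV, of "{i. mdeg (\<alpha> i) \<le> n}"] bij_is_surj[OF bij]
    by (auto simp: bij_betw_def surj_def image_iff)
  then have card: "card A = rdim TYPE('d) n" by (simp add: bij_betw_same_card card_mdeg_le)
  moreover have "rdim TYPE('d) n > 0" by (simp add: rdim_def)
  ultimately have fin: "finite A" by (intro card_ge_0_finite) simp
  have "A \<subseteq> {..<rdim TYPE('d) n}"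
  proof
    fix i assume "i \<in> A"
    then have "{..i} \<subseteq> A" using mono by (auto simp: A_def intro: order_trans)
    from card_mono[OF fin this] show "i \<in> {..<rdim TYPE('d) n}" by (simp add: card)
  qed
  then have "A = {..<rdim TYPE('d) n}" by (intro card_subset_eq) (simp_all add: card)
  then show ?thesis unfolding A_def by blast
qed

lemma bij_betw_graded_enum:
  fixes \<alpha> :: "nat \<Rightarrow> nat ^ 'd::finite"
  assumes \<alpha>: "graded_enum c \<alpha>"
  shows "bij_betw \<alpha> {..<rdim TYPE('d) n} {\<beta>. mdeg \<beta> \<le> n}"
proof -
  have "bij \<alpha>" using \<alpha> by (simp add: graded_enum_def)
  moreover have "\<alpha> ` {..<rdim TYPE('d) n} = {\<beta>. mdeg \<beta> \<le> n}"
  proof (intro equalityI subsetI)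
    fix \<beta> :: "nat ^ 'd" assume "\<beta> \<in> {\<beta>. mdeg \<beta> \<le> n}"
    moreover obtain i where "\<beta> = \<alpha> i" using surjD[OF bij_is_surj[OF \<open>bij \<alpha>\<close>]] by blast
    ultimately show "\<beta> \<in> \<alpha> ` {..<rdim TYPE('d) n}" using graded_enum_less_rdim[OF \<alpha>] by auto
  qed (use graded_enum_less_rdim[OF \<alpha>] in auto)
  ultimately show ?thesis by (auto simp: bij_betw_def bij_def intro: inj_on_subset)
qed

section \<open>Pseudo-inverses and least squares\<close>

text \<open>For both candidates, the product with \<open>A\<close> on the left is the orthogonal
  projection onto the column space of \<open>A\<close>, and on the right that onto the row space; so
  the products agree. Since \<open>pinv\<close> is a definite description, this allows an explicit
  candidate to be identified with it.\<close>

lemma is_pinv_unique: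
  assumes B: "is_pinv A B" and C: "is_pinv A C"
  shows "B = C"
proof -
  obtain n m where A: "A \<in> carrier_mat n m" by blast
  have Bc: "B \<in> carrier_mat m n" and Cc: "C \<in> carrier_mat m n"
    using A B C by (auto simp: is_pinv_def)
  note car = A Bc Cc
  have AB: "A * B = A * C"
  proof -
    have "A * B = (A * C * A) * B" using C by (simp add: is_pinv_def)
    also have "\<dots> = (A * C) * (A * B)"
      using car by (intro assoc_mult_mat[of _ n n _ m _ n]) auto
    also have "\<dots> = transpose_mat (A * C) * transpose_mat (A * B)" using B C by (simp add: is_pinv_def)
    also have "\<dots> = transpose_mat ((A * B) * (A * C))"
      using car by (subst transpose_mult[of _ n n _ n]) auto
    also have "(A * B) * (A * C) = (A * B * A) * C"
      using car by (intro assoc_mult_mat[of _ n n _ m _ n, symmetric]) auto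
    also have "\<dots> = A * C" using B by (simp add: is_pinv_def)
    also have "transpose_mat (A * C) = A * C" using C by (simp add: is_pinv_def)
    finally show ?thesis .
  qed
  have BA: "B * A = C * A"
  proof -
    have "B * A = B * (A * C * A)" using C by (simp add: is_pinv_def)
    also have "\<dots> = B * (A * (C * A))"
      using assoc_mult_mat[OF A Cc A] by simp
    also have "\<dots> = (B * A) * (C * A)"
      using car by (intro assoc_mult_mat[of _ m n _ m _ m, symmetric]) auto
    also have "\<dots> = transpose_mat (B * A) * transpose_mat (C * A)" using B C by (simp add: is_pinv_def)
    also have "\<dots> = transpose_mat ((C * A) * (B * A))"
      using car by (subst transpose_mult[of _ m m _ m]) auto
    also have "(C * A) * (B * A) = C * (A * (B * A))"
      using car by (intro assoc_mult_mat[of _ m n _ m _ m]) auto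
    also have "\<dots> = C * (A * B * A)"
      using assoc_mult_mat[OF A Bc A] by simp
    also have "\<dots> = C * A" using B by (simp add: is_pinv_def)
    also have "transpose_mat (C * A) = C * A" using C by (simp add: is_pinv_def)
    finally show ?thesis .
  qed
  have "B = B * A * B" using B by (simp add: is_pinv_def)
  also have "\<dots> = B * (A * C)" using assoc_mult_mat[OF Bc A Bc] AB by simp
  also have "\<dots> = C * A * C" using assoc_mult_mat[OF Bc A Cc] BA by simp
  also have "\<dots> = C" using C by (simp add: is_pinv_def)
  finally show ?thesis .
qed

text \<open>The candidate is a right inverse of \<open>A\<close>, which settles three Penrose
  conditions. The symmetry of its product with \<open>A\<close> in the other order needs
  \<open>T\<close> symmetric: the transpose of \<open>T\<close> is a left inverse of the symmetric
  Gram matrix and thus equals the right inverse \<open>T\<close>.\<close>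

lemma pinv_full_row_rank:
  assumes A: "A \<in> carrier_mat r N" and T: "T \<in> carrier_mat r r"
    and ST: "A * transpose_mat A * T = 1\<^sub>m r"
  shows "pinv A = transpose_mat A * T"
proof -
  let ?S = "A * transpose_mat A"
  have At: "transpose_mat A \<in> carrier_mat N r" and S: "?S \<in> carrier_mat r r" using A by auto
  have Tt: "transpose_mat T \<in> carrier_mat r r" using T by simp
  have S_sym: "transpose_mat ?S = ?S" using A At by (subst transpose_mult[of _ r N _ r]) auto
  have "transpose_mat T * ?S = transpose_mat (?S * T)"
    using S T by (simp add: transpose_mult[of _ r r _ r] S_sym)
  then have TS: "transpose_mat T * ?S = 1\<^sub>m r" unfolding ST by simp
  have "transpose_mat T = transpose_mat T * (?S * T)" unfolding ST using Tt by simp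
  also have "\<dots> = (transpose_mat T * ?S) * T" using assoc_mult_mat[OF Tt S T] by simp
  finally have T_sym: "transpose_mat T = T" unfolding TS using T by simp
  have AB: "A * (transpose_mat A * T) = 1\<^sub>m r" using assoc_mult_mat[OF A At T] ST by simp
  have AtT: "transpose_mat A * T \<in> carrier_mat N r" using At T by auto
  have "is_pinv A (transpose_mat A * T)"
    unfolding is_pinv_def
  proof (intro conjI)
    show "transpose_mat A * T \<in> carrier_mat (dim_col A) (dim_row A)" using A T by auto
    show "A * (transpose_mat A * T) * A = A" unfolding AB using A by simp
    show "transpose_mat A * T * A * (transpose_mat A * T) = transpose_mat A * T"
      unfolding assoc_mult_mat[OF AtT A AtT] AB using AtT by (rule right_mult_one_mat)
    show "transpose_mat (A * (transpose_mat A * T)) = A * (transpose_mat A * T)" unfolding AB by simp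
    have "transpose_mat (transpose_mat A * T * A) = transpose_mat A * (transpose_mat T * A)"
      using assoc_mult_mat[OF At T A] transpose_mult[OF At mult_carrier_mat[OF T A]]
        transpose_mult[OF T A] assoc_mult_mat[OF At Tt A] by simp
    then show "transpose_mat (transpose_mat A * T * A) = transpose_mat A * T * A"
      unfolding T_sym using assoc_mult_mat[OF At T A] by simp
  qed
  then show ?thesis unfolding pinv_def by (intro the_equality is_pinv_unique)
qed

section \<open>Entrywise limits of inverse matrices\<close>

lemma tendsto_det:
  fixes B :: "nat \<Rightarrow> real mat"
  assumes "\<And>N. B N \<in> carrier_mat r r" "A \<in> carrier_mat r r"
    and "\<And>i j. i < r \<Longrightarrow> j < r \<Longrightarrow> (\<lambda>N. B N $$ (i, j)) \<longlonglongrightarrow> A $$ (i, j)"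
  shows "(\<lambda>N. det (B N)) \<longlonglongrightarrow> det A"
  unfolding det_def'[OF assms(1)] det_def'[OF assms(2)]
proof (intro tendsto_sum tendsto_mult tendsto_const tendsto_prod)
  fix p i assume "p \<in> {p. p permutes {0..<r}}" "i \<in> {0..<r}"
  then have "i < r" "p i < r" using permutes_in_image[of p "{0..<r}" i] by simp_all
  then show "(\<lambda>N. B N $$ (i, p i)) \<longlonglongrightarrow> A $$ (i, p i)" by (rule assms(3))
qed

text \<open>Adjugate and determinant are polynomials in the entries, so Cramer's formula carries
  entrywise convergence over to inverses.\<close>

lemma tendsto_adj_mat:
  fixes B :: "nat \<Rightarrow> real mat"
  assumes B: "\<And>N. B N \<in> carrier_mat r r" and A: "A \<in> carrier_mat r r"
    and lim: "\<And>i j. i < r \<Longrightarrow> j < r \<Longrightarrow> (\<lambda>N. B N $$ (i, j)) \<longlonglongrightarrow> A $$ (i, j)"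
    and ij: "i < r" "j < r"
  shows "(\<lambda>N. adj_mat (B N) $$ (i, j)) \<longlonglongrightarrow> adj_mat A $$ (i, j)"
proof -
  have "(\<lambda>N. det (mat_delete (B N) j i)) \<longlonglongrightarrow> det (mat_delete A j i)"
  proof (rule tendsto_det)
    show "mat_delete (B N) j i \<in> carrier_mat (r - 1) (r - 1)" for N using B[of N] by auto
    show "mat_delete A j i \<in> carrier_mat (r - 1) (r - 1)" using A by auto
    fix k l assume "k < r - 1" "l < r - 1"
    then have "(if k < j then k else Suc k) < r" "(if l < i then l else Suc l) < r" by auto
    note lim' = lim[OF this]
    have entry: "mat_delete C j i $$ (k, l) = C $$ (if k < j then k else Suc k, if l < i then l else Suc l)"
      if "C \<in> carrier_mat r r" for C :: "real mat"
      using carrier_matD[OF that] \<open>k < r - 1\<close> \<open>l < r - 1\<close> by (simp add: mat_delete_def)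
    show "(\<lambda>N. mat_delete (B N) j i $$ (k, l)) \<longlonglongrightarrow> mat_delete A j i $$ (k, l)"
      unfolding entry[OF B] entry[OF A] by (rule lim')
  qed
  then have "(\<lambda>N. (-1) ^ (j + i) * det (mat_delete (B N) j i)) \<longlonglongrightarrow> (-1) ^ (j + i) * det (mat_delete A j i)"
    by (rule tendsto_mult_left)
  moreover have "adj_mat C $$ (i, j) = (-1) ^ (j + i) * det (mat_delete C j i)" if "C \<in> carrier_mat r r" for C :: "real mat"
    using carrier_matD[OF that] ij by (simp add: adj_mat_def cofactor_def)
  ultimately show ?thesis by (simp only: A B)
qed

text \<open>Least squares in the limit: for large \<open>N\<close>, row \<open>k\<close> of the
  product is the vector of empirical right-hand sides times the inverse empirical Gram matrix. Both
  converge, so the limit solves the normal equations for \<open>G\<close> and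
  \<open>b\<close>.\<close>

lemma pinv_entry_limit:
  fixes v :: "nat \<Rightarrow> nat \<Rightarrow> real" and w :: "nat \<Rightarrow> real" and G :: "nat \<Rightarrow> nat \<Rightarrow> real"
  assumes A: "\<And>N. A N \<in> carrier_mat r N" "\<And>N i l. i < r \<Longrightarrow> l < N \<Longrightarrow> A N $$ (i, l) = v i l"
    and W: "\<And>N. W N \<in> carrier_mat q N" "\<And>N l. l < N \<Longrightarrow> W N $$ (k, l) = w l" and k: "k < q"
    and G: "\<And>i j. i < r \<Longrightarrow> j < r \<Longrightarrow> (\<lambda>N. (\<Sum>l<N. v i l * v j l) / real N) \<longlonglongrightarrow> G i j"
    and b: "\<And>j. j < r \<Longrightarrow> (\<lambda>N. (\<Sum>l<N. w l * v j l) / real N) \<longlonglongrightarrow> b j"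
    and inj: "\<And>c. (\<And>j. j < r \<Longrightarrow> (\<Sum>i<r. c i * G i j) = 0) \<Longrightarrow> \<forall>i<r. c i = 0"
  obtains p where "\<And>j. j < r \<Longrightarrow> (\<lambda>N. (W N * pinv (A N)) $$ (k, j)) \<longlonglongrightarrow> p j"
    "\<And>j. j < r \<Longrightarrow> (\<Sum>i<r. p i * G i j) = b j"
proof -
  define g where "g = Matrix.mat r r (\<lambda>(i, j). G i j)"
  have g: "g \<in> carrier_mat r r" by (simp add: g_def)
  have dimA: "dim_row (A N) = r" "dim_col (A N) = N" for N using carrier_matD[OF A(1)] by blast+
  have dimW: "dim_row (W N) = q" "dim_col (W N) = N" for N using carrier_matD[OF W(1)] by blast+
  define gN where "gN = (\<lambda>N. (1 / real N) \<cdot>\<^sub>m (A N * transpose_mat (A N)))"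
  have gN: "gN N \<in> carrier_mat r r" for N
    using mult_carrier_mat[OF A(1), of "transpose_mat (A N)" N r] A(1)[of N] by (simp add: gN_def)
  have gN_entry: "gN N $$ (i, j) = (\<Sum>l<N. v i l * v j l) / real N" if "i < r" "j < r" for N i j
    using dimA[of N] that by (simp add: gN_def scalar_prod_def A(2) atLeast0LessThan)
  have lim: "(\<lambda>N. gN N $$ (i, j)) \<longlonglongrightarrow> g $$ (i, j)" if "i < r" "j < r" for i j
    using G[OF that] that by (simp add: gN_entry g_def)
  have det_g: "det g \<noteq> 0"
  proof
    \<comment> \<open>The hypothesis \<open>inj\<close> concerns row vectors, hence the passage to
      the transpose.\<close>
    assume "det g = 0"
    then have "det (transpose_mat g) = 0" using det_transpose[OF g] by simp
    then obtain u where u: "u \<in> carrier_vec r" "u \<noteq> 0\<^sub>v r" "transpose_mat g *\<^sub>v u = 0\<^sub>v r"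
      using det_0_iff_vec_prod_zero_field[of "transpose_mat g" r] g by auto
    have "(\<Sum>i<r. vec_index u i * G i j) = 0" if j: "j < r" for j
    proof -
      have "(\<Sum>i<r. vec_index u i * G i j) = vec_index (transpose_mat g *\<^sub>v u) j"
        using j u(1) by (auto simp: g_def scalar_prod_def atLeast0LessThan mult.commute intro!: sum.cong)
      then show ?thesis using j by (simp add: u(3))
    qed
    then have "\<forall>i<r. vec_index u i = 0" by (rule inj)
    then have "u = 0\<^sub>v r" using u(1) by (intro eq_vecI) auto
    then show False using u(2) by simp
  qed
  have lim_det: "(\<lambda>N. det (gN N)) \<longlonglongrightarrow> det g" by (rule tendsto_det[OF gN g lim])
  \<comment> \<open>Cramer's inverse of the unnormalised Gram matrix, which is \<open>N\<close>
    times \<open>gN N\<close>; this is the source of the extra factor in the denominator.\<close>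
  define T where "T = (\<lambda>N. (1 / (real N * det (gN N))) \<cdot>\<^sub>m adj_mat (gN N))"
  have T: "T N \<in> carrier_mat r r" for N using adj_mat(1)[OF gN[of N]] by (simp add: T_def)
  have entry: "(W N * pinv (A N)) $$ (k, j) =
      (\<Sum>i<r. ((\<Sum>l<N. w l * v i l) / real N) * (adj_mat (gN N) $$ (i, j) / det (gN N)))"
    if N: "N > 0" "det (gN N) \<noteq> 0" and j: "j < r" for N j
  proof -
    have AA: "A N * transpose_mat (A N) \<in> carrier_mat r r" using A(1)[of N] by auto
    have adj: "adj_mat (gN N) \<in> carrier_mat r r" by (rule adj_mat(1)[OF gN])
    have "A N * transpose_mat (A N) = real N \<cdot>\<^sub>m gN N"
      using N(1) AA by (intro eq_matI) (auto simp: gN_def)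
    then have "A N * transpose_mat (A N) * T N = real N \<cdot>\<^sub>m (gN N * T N)"
      using mult_smult_assoc_mat[OF gN[of N] T[of N]] by simp
    also have "gN N * T N = (1 / (real N * det (gN N))) \<cdot>\<^sub>m (gN N * adj_mat (gN N))"
      using mult_smult_distrib[OF gN[of N] adj] unfolding T_def by blast
    also have "gN N * adj_mat (gN N) = det (gN N) \<cdot>\<^sub>m 1\<^sub>m r"
      by (rule adj_mat(2)[OF gN])
    also have "real N \<cdot>\<^sub>m ((1 / (real N * det (gN N))) \<cdot>\<^sub>m (det (gN N) \<cdot>\<^sub>m 1\<^sub>m r)) = 1\<^sub>m r"
      using N by (intro eq_matI) auto
    finally have "pinv (A N) = transpose_mat (A N) * T N"
      by (rule pinv_full_row_rank[OF A(1) T])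
    then have "W N * pinv (A N) = (W N * transpose_mat (A N)) * T N"
      using assoc_mult_mat[OF W(1) _ T, of "transpose_mat (A N)"] A(1)[of N] by simp
    also have "\<dots> $$ (k, j) = (\<Sum>i<r. (W N * transpose_mat (A N)) $$ (k, i) * T N $$ (i, j))"
      using k j carrier_matD[OF T[of N]] by (simp add: scalar_prod_def atLeast0LessThan dimA dimW)
    also have "\<dots> = (\<Sum>i<r. ((\<Sum>l<N. w l * v i l) / real N) * (adj_mat (gN N) $$ (i, j) / det (gN N)))"
    proof (rule sum.cong)
      fix i assume i: "i \<in> {..<r}"
      have "(W N * transpose_mat (A N)) $$ (k, i) = (\<Sum>l<N. w l * v i l)"
        using i k by (simp add: scalar_prod_def atLeast0LessThan dimA dimW A(2) W(2))
      moreover have "T N $$ (i, j) = adj_mat (gN N) $$ (i, j) / (real N * det (gN N))"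
        using i j carrier_matD[OF adj] by (simp add: T_def)
      ultimately show "(W N * transpose_mat (A N)) $$ (k, i) * T N $$ (i, j) =
        ((\<Sum>l<N. w l * v i l) / real N) * (adj_mat (gN N) $$ (i, j) / det (gN N))"
        by simp
    qed simp
    finally show ?thesis .
  qed
  define p where "p = (\<lambda>j. \<Sum>i<r. b i * (adj_mat g $$ (i, j) / det g))"
  \<comment> \<open>The explicit formula is available only where the empirical Gram matrix is
    invertible; a nonzero limit of the determinants makes this hold for all large
    \<open>N\<close>.\<close>
  have ev: "\<forall>\<^sub>F N in sequentially. N > 0 \<and> det (gN N) \<noteq> 0"
    using eventually_conj[OF eventually_gt_at_top[of 0] tendsto_imp_eventually_ne[OF lim_det det_g]] .
  show thesis
  proof (rule that)
    fix j assume j: "j < r"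
    have "(\<lambda>N. \<Sum>i<r. ((\<Sum>l<N. w l * v i l) / real N) * (adj_mat (gN N) $$ (i, j) / det (gN N))) \<longlonglongrightarrow> p j"
      unfolding p_def
      by (intro tendsto_sum tendsto_mult[OF b tendsto_divide[OF tendsto_adj_mat[OF gN g lim] lim_det det_g]])
        (use j in auto)
    then show "(\<lambda>N. (W N * pinv (A N)) $$ (k, j)) \<longlonglongrightarrow> p j"
      by (rule Lim_transform_eventually) (rule eventually_mono[OF ev], simp add: entry[OF _ _ j])
    have "(\<Sum>i<r. p i * G i j) = (\<Sum>l<r. b l / det g * (\<Sum>i<r. adj_mat g $$ (l, i) * G i j))"
      unfolding p_def sum_distrib_right sum_distrib_left
      by (subst sum.swap) (simp add: mult_ac)
    also have "\<dots> = (\<Sum>l<r. b l / det g * (if l = j then det g else 0))"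
    proof (rule sum.cong)
      fix l assume l: "l \<in> {..<r}"
      have "(\<Sum>i<r. adj_mat g $$ (l, i) * G i j) = (adj_mat g * g) $$ (l, j)"
        using l j carrier_matD[OF adj_mat(1)[OF g]] carrier_matD[OF g]
        by (simp add: g_def scalar_prod_def atLeast0LessThan)
      also have "\<dots> = (if l = j then det g else 0)"
        unfolding adj_mat(3)[OF g] using l j by simp
      finally show "b l / det g * (\<Sum>i<r. adj_mat g $$ (l, i) * G i j) = b l / det g * (if l = j then det g else 0)"
        by simp
    qed simp
    also have "\<dots> = b j" using j det_g by (simp add: if_distrib cong: if_cong)
    finally show "(\<Sum>i<r. p i * G i j) = b j" .
  qed
qed

section \<open>Convergence of the reconstruction\<close>

lemma sup_norm_on_diff_le:
  fixes A B :: "'a \<Rightarrow> 'b::real_normed_vector"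
  assumes B: "bounded (B ` K)" and AB: "\<And>y. y \<in> K \<Longrightarrow> norm (A y - B y) \<le> e" and e: "0 \<le> e"
  shows "\<bar>sup_norm_on K A - sup_norm_on K B\<bar> \<le> e"
proof (cases "K = {}")
  case False
  obtain b where b: "\<And>y. y \<in> K \<Longrightarrow> norm (B y) \<le> b" using B by (auto simp: bounded_iff)
  have AB': "norm (A y) \<le> norm (B y) + e" "norm (B y) \<le> norm (A y) + e" if "y \<in> K" for y
    using AB[OF that] norm_triangle_ineq2[of "A y" "B y"] norm_triangle_ineq2[of "B y" "A y"]
      norm_minus_commute[of "A y" "B y"] by linarith+
  have bdd: "bdd_above ((\<lambda>y. norm (B y)) ` K)" "bdd_above ((\<lambda>y. norm (A y)) ` K)"
    using b order_trans[OF AB'(1) add_right_mono[OF b]]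
    by (auto intro: bdd_aboveI[of _ b] bdd_aboveI[of _ "b + e"])
  have "(SUP y\<in>K. norm (A y)) \<le> (SUP y\<in>K. norm (B y)) + e"
    using False by (intro cSUP_least order_trans[OF AB'(1)] add_right_mono cSUP_upper bdd) auto
  moreover have "(SUP y\<in>K. norm (B y)) \<le> (SUP y\<in>K. norm (A y)) + e"
    using False by (intro cSUP_least order_trans[OF AB'(2)] add_right_mono cSUP_upper bdd) auto
  ultimately show ?thesis using False by (simp add: sup_norm_on_def abs_le_iff)
qed (use e in \<open>simp add: sup_norm_on_def\<close>)

lemma sup_norm_on_tendsto:
  fixes A :: "nat \<Rightarrow> 'a \<Rightarrow> 'b::real_normed_vector"
  assumes B: "bounded (B ` K)" and AB: "\<And>N y. y \<in> K \<Longrightarrow> norm (A N y - B y) \<le> e N" and lim: "e \<longlonglongrightarrow> 0"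
  shows "(\<lambda>N. sup_norm_on K (A N)) \<longlonglongrightarrow> sup_norm_on K B"
proof (cases "K = {}")
  case False
  then have "0 \<le> e N" for N using AB order_trans[OF norm_ge_zero] by blast
  then have "norm (sup_norm_on K (A N) - sup_norm_on K B) \<le> e N" for N
    using sup_norm_on_diff_le[OF B AB] by simp
  then have "(\<lambda>N. sup_norm_on K (A N) - sup_norm_on K B) \<longlonglongrightarrow> 0"
    using lim by (intro Lim_null_comparison[OF always_eventually[OF allI] lim]) auto
  then show ?thesis by (rule LIM_zero_cancel)
qed (simp add: sup_norm_on_def)

text \<open>The output of the algorithm and the Taylor approximation both have this shape, so for
  fixed \<open>m\<close> the limits in \<open>N\<close> and \<open>n\<close> concern finitely many
  coefficients. The affine part undoes the normalisation (f_j - y0_j) / \<sigma>.\<close>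

definition poly_map ::
  "real \<Rightarrow> real ^ 'd \<Rightarrow> real ^ 'd \<Rightarrow> nat \<Rightarrow> ('d::finite \<Rightarrow> nat ^ 'd \<Rightarrow> real) \<Rightarrow> real ^ 'd \<Rightarrow> real ^ 'd" where
  "poly_map \<sigma> x0 y0 m C y = (\<chi> j. \<sigma> * mpoly_eval \<sigma> x0 m (C j) y + y0 $ j)"

lemma poly_map_continuous: "continuous_on A (poly_map \<sigma> x0 y0 m C)"
  unfolding poly_map_def[abs_def]
  by (intro continuous_on_vec_lambda continuous_intros mpoly_eval_continuous)

text \<open>Finitely many monomials occur, each bounded on \<open>K\<close>, so coefficientwise
  convergence is uniform there. The sequence variable stands for \<open>N\<close> in one use and for
  \<open>n\<close> in the other.\<close>

lemma sup_norm_poly_map_tendsto: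
  fixes f :: "real ^ 'd::finite \<Rightarrow> real ^ 'd"
  assumes K: "compact K" and f: "continuous_on K f"
    and C: "\<And>j \<beta>. mdeg \<beta> \<le> m \<Longrightarrow> (\<lambda>N. C N j \<beta>) \<longlonglongrightarrow> C' j \<beta>"
  shows "(\<lambda>N. sup_norm_on K (\<lambda>y. f y - poly_map \<sigma> x0 y0 m (C N) y)) \<longlonglongrightarrow>
    sup_norm_on K (\<lambda>y. f y - poly_map \<sigma> x0 y0 m C' y)"
proof -
  have "\<forall>\<beta>. \<exists>B. \<forall>y\<in>K. \<bar>scaled_mono \<sigma> x0 \<beta> y\<bar> \<le> B"
  proof
    fix \<beta>
    show "\<exists>B. \<forall>y\<in>K. \<bar>scaled_mono \<sigma> x0 \<beta> y\<bar> \<le> B"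
    using compact_imp_bounded[OF compact_continuous_image[OF scaled_mono_continuous K, of \<sigma> x0 \<beta>]]
      by (auto simp: bounded_iff)
  qed
  from choice[OF this] obtain B where B: "\<And>\<beta> y. y \<in> K \<Longrightarrow> \<bar>scaled_mono \<sigma> x0 \<beta> y\<bar> \<le> B \<beta>" by blast
  define e where "e = (\<lambda>N. \<Sum>j\<in>UNIV. \<bar>\<sigma>\<bar> * (\<Sum>\<beta> | mdeg \<beta> \<le> m. \<bar>C N j \<beta> - C' j \<beta>\<bar> * B \<beta>))"
  show ?thesis
  proof (rule sup_norm_on_tendsto[where e = e])
    show "bounded ((\<lambda>y. f y - poly_map \<sigma> x0 y0 m C' y) ` K)"
      by (intro compact_imp_bounded compact_continuous_image continuous_intros f K poly_map_continuous)
    show "e \<longlonglongrightarrow> 0"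
      unfolding e_def
      by (intro tendsto_null_sum tendsto_mult_right_zero tendsto_mult_left_zero tendsto_rabs_zero LIM_zero C) auto
    fix N y assume y: "y \<in> K"
    have "norm ((f y - poly_map \<sigma> x0 y0 m (C N) y) - (f y - poly_map \<sigma> x0 y0 m C' y)) =
        norm (poly_map \<sigma> x0 y0 m (C N) y - poly_map \<sigma> x0 y0 m C' y)"
      by (simp add: norm_minus_commute)
    also have "\<dots> \<le> (\<Sum>j\<in>UNIV. \<bar>(poly_map \<sigma> x0 y0 m (C N) y - poly_map \<sigma> x0 y0 m C' y) $ j\<bar>)"
      by (rule norm_le_l1_cart)
    also have "\<dots> = (\<Sum>j\<in>UNIV. \<bar>\<sigma>\<bar> * \<bar>mpoly_eval \<sigma> x0 m (C N j) y - mpoly_eval \<sigma> x0 m (C' j) y\<bar>)"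
      by (simp add: poly_map_def abs_mult[symmetric] right_diff_distrib)
    also have "\<dots> \<le> e N"
      unfolding e_def
    proof (intro sum_mono mult_left_mono)
      fix j
      have "mpoly_eval \<sigma> x0 m (C N j) y - mpoly_eval \<sigma> x0 m (C' j) y =
          (\<Sum>\<beta> | mdeg \<beta> \<le> m. (C N j \<beta> - C' j \<beta>) * scaled_mono \<sigma> x0 \<beta> y)"
        by (simp add: mpoly_eval_def sum_subtractf left_diff_distrib)
      also have "\<bar>\<dots>\<bar> \<le> (\<Sum>\<beta> | mdeg \<beta> \<le> m. \<bar>(C N j \<beta> - C' j \<beta>) * scaled_mono \<sigma> x0 \<beta> y\<bar>)"
        by (rule sum_abs)
      also have "\<dots> \<le> (\<Sum>\<beta> | mdeg \<beta> \<le> m. \<bar>C N j \<beta> - C' j \<beta>\<bar> * B \<beta>)"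
        unfolding abs_mult by (intro sum_mono mult_left_mono B y) simp
      finally show "\<bar>mpoly_eval \<sigma> x0 m (C N j) y - mpoly_eval \<sigma> x0 m (C' j) y\<bar> \<le>
        (\<Sum>\<beta> | mdeg \<beta> \<le> m. \<bar>C N j \<beta> - C' j \<beta>\<bar> * B \<beta>)" .
    qed simp
    finally show "norm ((f y - poly_map \<sigma> x0 y0 m (C N) y) - (f y - poly_map \<sigma> x0 y0 m C' y)) \<le> e N" .
  qed
qed

text \<open>No exponential loss has to be beaten here, so \<open>taylor_error_bound\<close> with
  \<open>r = 2\<close> already yields a geometric rate.\<close>

lemma sup_norm_taylor_tendsto:
  fixes f :: "real ^ 'd::finite \<Rightarrow> real ^ 'd"
  assumes K: "compact K" and rkhs: "is_rkhs (exp_kernel \<sigma> x0) H ip" and \<sigma>: "\<sigma> > 0"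
    and g: "\<And>j. g j \<in> H" and f: "\<And>y j. f y $ j = \<sigma> * g j y + y0 $ j"
  shows "(\<lambda>m. sup_norm_on K (\<lambda>y. f y - poly_map \<sigma> x0 y0 m (\<lambda>j. taylor_coeff \<sigma> x0 ip (g j)) y)) \<longlonglongrightarrow> 0"
proof -
  interpret rkhs_fun H ip "exp_kernel \<sigma> x0" using rkhs by (rule rkhs_funI)
  have "bounded ((\<lambda>x. norm (x - x0)) ` K)"
    using K by (intro compact_imp_bounded compact_continuous_image continuous_intros) auto
  then obtain R where R: "\<And>x. x \<in> K \<Longrightarrow> norm (x - x0) \<le> R" by (auto simp: bounded_iff)
  define Q where "Q = (\<lambda>j. ip (g j) (g j) * exp (2 * (R / \<sigma>)\<^sup>2))"
  define e where "e = (\<lambda>m :: nat. \<Sum>j\<in>UNIV. \<sigma> * sqrt (Q j * (1 / 2) ^ m))"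
  have "(\<lambda>m. sup_norm_on K (\<lambda>y. f y - poly_map \<sigma> x0 y0 m (\<lambda>j. taylor_coeff \<sigma> x0 ip (g j)) y)) \<longlonglongrightarrow>
      sup_norm_on K (\<lambda>y. 0 :: real ^ 'd)"
  proof (rule sup_norm_on_tendsto[where e = e])
    show "bounded ((\<lambda>y. 0 :: real ^ 'd) ` K)" by (rule finite_imp_bounded) (rule finite_subset[of _ "{0}"], auto)
    have "(\<lambda>m. sqrt (Q j * (1 / 2) ^ m)) \<longlonglongrightarrow> sqrt 0" for j
      by (intro tendsto_real_sqrt tendsto_mult_right_zero LIMSEQ_realpow_zero) auto
    then show "e \<longlonglongrightarrow> 0" unfolding e_def
      by (intro tendsto_null_sum tendsto_mult_right_zero) simp
    fix m y assume y: "y \<in> K"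
    let ?P = "poly_map \<sigma> x0 y0 m (\<lambda>j. taylor_coeff \<sigma> x0 ip (g j)) y"
    have "norm (f y - ?P - 0) \<le> (\<Sum>j\<in>UNIV. \<bar>(f y - ?P) $ j\<bar>)"
      using norm_le_l1_cart[of "f y - ?P"] by simp
    also have "\<dots> \<le> e m"
      unfolding e_def
    proof (rule sum_mono)
      fix j
      let ?d = "g j y - (\<Sum>\<beta> | mdeg \<beta> \<le> m. taylor_coeff \<sigma> x0 ip (g j) \<beta> * scaled_mono \<sigma> x0 \<beta> y)"
      have "2 ^ m * ?d\<^sup>2 \<le> ip (g j) (g j) * exp (2 * (norm (y - x0) / \<sigma>)\<^sup>2)"
        by (rule taylor_error_bound[OF rkhs \<sigma> g]) simp
      also have "\<dots> \<le> Q j"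
        unfolding Q_def using R[OF y] \<sigma> ip_nonneg[OF g]
        by (intro mult_left_mono) (auto intro!: mult_left_mono power_mono divide_right_mono)
      finally have "?d\<^sup>2 \<le> Q j * (1 / 2) ^ m" by (simp add: field_simps)
      then have "\<bar>?d\<bar> \<le> sqrt (Q j * (1 / 2) ^ m)" using real_sqrt_le_mono by fastforce
      moreover have "(f y - ?P) $ j = \<sigma> * ?d"
        by (simp add: f poly_map_def mpoly_eval_def right_diff_distrib)
      ultimately show "\<bar>(f y - ?P) $ j\<bar> \<le> \<sigma> * sqrt (Q j * (1 / 2) ^ m)"
        using \<sigma> by (simp add: abs_mult)
    qed
    finally show "norm (f y - ?P - 0) \<le> e m" .
  qed
  moreover have "sup_norm_on K (\<lambda>y. 0 :: real ^ 'd) = 0" by (simp add: sup_norm_on_def)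
  ultimately show ?thesis by simp
qed

section \<open>From the matrices of the algorithm to coefficient limits\<close>

lemma Vmat_carrier: "Vmat \<alpha> \<sigma> x0 n N (z :: nat \<Rightarrow> real ^ 'd::finite) \<in> carrier_mat (rdim TYPE('d) n) N"
  unfolding Vmat_def by (rule mat_of_cols_carrier(1)[of _ "map _ [0..<N]", simplified])

lemma Vmat_entry:
  fixes z :: "nat \<Rightarrow> real ^ 'd::finite"
  assumes "i < rdim TYPE('d) n" "l < N"
  shows "Vmat \<alpha> \<sigma> x0 n N z $$ (i, l) = scaled_mono \<sigma> x0 (\<alpha> i) (z l)"
  using assms by (simp add: Vmat_def mat_of_cols_index vbasis_def scaled_mono_def)

text \<open>Row \<open>Suc (inv_into {..<CARD('d)} c j)\<close> belongs to the multi-index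
  \<open>axis j 1\<close> of degree 1; \<open>1 \<le> m\<close> ensures that this row
  exists.\<close>

lemma fhat_eq_poly_map:
  fixes z :: "nat \<Rightarrow> real ^ 'd::finite"
  assumes \<alpha>: "graded_enum c \<alpha>" and m: "1 \<le> m"
  shows "fhat c \<alpha> \<sigma> x0 y0 z w m n N y = poly_map \<sigma> x0 y0 m
    (\<lambda>j \<beta>. Chat \<alpha> \<sigma> x0 y0 z w m n N $$ (Suc (inv_into {..<CARD('d)} c j), inv_into UNIV \<alpha> \<beta>)) y"
proof -
  let ?C = "Chat \<alpha> \<sigma> x0 y0 z w m n N" and ?r = "rdim TYPE('d) m"
  have inv: "inv_into UNIV \<alpha> (\<alpha> i) = i" for i using \<alpha> by (simp add: graded_enum_def bij_is_inj)
  have dim: "dim_row ?C = ?r" "dim_col ?C = ?r"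
    using carrier_matD[OF Vmat_carrier] by (simp_all add: Chat_def first_cols_def)
  have row: "Suc (inv_into {..<CARD('d)} c j) < ?r" for j
  proof -
    have c: "bij_betw c {..<CARD('d)} UNIV" using \<alpha> by (simp add: graded_enum_def)
    have "inv_into {..<CARD('d)} c j < CARD('d)"
      using bij_betw_apply[OF bij_betw_inv_into[OF c], of j] by simp
    then have "\<alpha> (Suc (inv_into {..<CARD('d)} c j)) = axis (c (inv_into {..<CARD('d)} c j)) 1"
      using \<alpha> by (simp add: graded_enum_def)
    then have "mdeg (\<alpha> (Suc (inv_into {..<CARD('d)} c j))) = 1"
      by (simp add: mdeg_def axis_def)
    then show ?thesis using graded_enum_less_rdim[OF \<alpha>] m by simp
  qed
  have "vec_index (\<sigma> \<cdot>\<^sub>m ?C *\<^sub>v vbasis \<alpha> \<sigma> x0 m y) (Suc (inv_into {..<CARD('d)} c j)) =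
      \<sigma> * mpoly_eval \<sigma> x0 m (\<lambda>\<beta>. ?C $$ (Suc (inv_into {..<CARD('d)} c j), inv_into UNIV \<alpha> \<beta>)) y" for j
  proof -
    let ?k = "Suc (inv_into {..<CARD('d)} c j)"
    have "mpoly_eval \<sigma> x0 m (\<lambda>\<beta>. ?C $$ (?k, inv_into UNIV \<alpha> \<beta>)) y =
        (\<Sum>i<?r. ?C $$ (?k, i) * scaled_mono \<sigma> x0 (\<alpha> i) y)"
      unfolding mpoly_eval_def sum.reindex_bij_betw[OF bij_betw_graded_enum[OF \<alpha>, of m], symmetric]
      by (simp add: inv)
    moreover have "vec_index (\<sigma> \<cdot>\<^sub>m ?C *\<^sub>v vbasis \<alpha> \<sigma> x0 m y) ?k =
        (\<Sum>i<?r. \<sigma> * ?C $$ (?k, i) * scaled_mono \<sigma> x0 (\<alpha> i) y)"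
      using row[of j] dim
      by (simp add: scalar_prod_def atLeast0LessThan vbasis_def scaled_mono_def)
    ultimately show ?thesis by (simp add: sum_distrib_left mult.assoc)
  qed
  then show ?thesis by (simp add: fhat_def poly_map_def vec_eq_iff)
qed

text \<open>Row \<open>?k\<close> fits \<open>g j\<close> by polynomials of degree at most
  \<open>n\<close> in the least-squares sense. The assumed moment limits turn its normal equations
  into those of the projection with respect to \<mu>; the first columns keep the coefficients of
  degree at most \<open>m\<close>.\<close>

lemma (in sampling_measure) Chat_tendsto:
  fixes f :: "real ^ 'd \<Rightarrow> real ^ 'd"
  assumes \<alpha>: "graded_enum c \<alpha>" and mn: "1 \<le> m" "m \<le> n"
    and f: "continuous_on UNIV f" and g: "\<And>y j. g j y = (f y $ j - y0 $ j) / \<sigma>"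
    and gram: "\<And>\<beta> \<gamma>. (\<lambda>N. (\<Sum>l<N. scaled_mono \<sigma> x0 \<beta> (z l) * scaled_mono \<sigma> x0 \<gamma> (z l)) / real N)
      \<longlonglongrightarrow> (\<integral>x. scaled_mono \<sigma> x0 \<beta> x * scaled_mono \<sigma> x0 \<gamma> x \<partial>\<mu>)"
    and rhs: "\<And>j \<gamma>. (\<lambda>N. (\<Sum>l<N. g j (z l) * scaled_mono \<sigma> x0 \<gamma> (z l)) / real N)
      \<longlonglongrightarrow> (\<integral>x. g j x * scaled_mono \<sigma> x0 \<gamma> x \<partial>\<mu>)"
  obtains p where
    "\<And>\<beta>. mdeg \<beta> \<le> m \<Longrightarrow> (\<lambda>N. Chat \<alpha> \<sigma> x0 y0 z (\<lambda>i. f (z i)) m n N $$ (Suc (inv_into {..<CARD('d)} c j), inv_into UNIV \<alpha> \<beta>)) \<longlonglongrightarrow> p \<beta>"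
    "\<And>\<gamma>. mdeg \<gamma> \<le> n \<Longrightarrow> (\<integral>x. (g j x - mpoly_eval \<sigma> x0 n p x) * scaled_mono \<sigma> x0 \<gamma> x \<partial>\<mu>) = 0"
proof -
  let ?v = "scaled_mono \<sigma> x0"
  let ?r = "rdim TYPE('d) n" and ?q = "rdim TYPE('d) m" and ?k = "Suc (inv_into {..<CARD('d)} c j)"
  have inv: "inv_into UNIV \<alpha> (\<alpha> i) = i" "\<alpha> (inv_into UNIV \<alpha> \<beta>) = \<beta>" for i \<beta>
    using \<alpha> by (simp_all add: graded_enum_def bij_is_inj bij_is_surj surj_f_inv_f)
  have c: "bij_betw c {..<CARD('d)} UNIV" using \<alpha> by (simp add: graded_enum_def)
  have k_less: "inv_into {..<CARD('d)} c j < CARD('d)"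
    using bij_betw_apply[OF bij_betw_inv_into[OF c], of j] by simp
  have \<alpha>k: "\<alpha> ?k = axis j 1"
    using \<alpha> k_less bij_betw_inv_into_right[OF c, of j] by (simp add: graded_enum_def)
  have mdegk: "mdeg (\<alpha> ?k) = 1" unfolding \<alpha>k by (simp add: mdeg_def axis_def)
  have k: "?k < ?q" using graded_enum_less_rdim[OF \<alpha>, of ?k m] mdegk mn by simp
  have less: "\<alpha> i \<in> {\<beta>. mdeg \<beta> \<le> n} \<longleftrightarrow> i < ?r" for i using graded_enum_less_rdim[OF \<alpha>, of i n] by simp
  \<comment> \<open>The shift in the modified data cancels the centre \<open>x0\<close>, so the
    degree-one monomial returns exactly the normalised component of \<open>f\<close>.\<close>
  have mono_k: "?v (\<alpha> ?k) (f y - y0 + x0) = g j y" for y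
  proof -
    have "mpow (f y - y0 + x0 - x0) (axis j 1) = (\<Prod>i\<in>UNIV. if i = j then f y $ j - y0 $ j else 1)"
      unfolding mpow_def by (rule prod.cong) (auto simp: axis_def)
    then show ?thesis using mdegk unfolding scaled_mono_def \<alpha>k g by simp
  qed
  have int: "integrable \<mu> (\<lambda>x. ?v \<beta> x * ?v \<gamma> x)" for \<beta> \<gamma>
    by (intro integrable_continuous continuous_intros scaled_mono_continuous)
  have g_cont: "continuous_on UNIV (g j)"
    unfolding g[abs_def] using \<sigma>_pos f by (intro continuous_intros) auto
  have reindex: "(\<integral>x. mpoly_eval \<sigma> x0 n a x * ?v \<gamma> x \<partial>\<mu>) =
      (\<Sum>i<?r. a (\<alpha> i) * (\<integral>x. ?v (\<alpha> i) x * ?v \<gamma> x \<partial>\<mu>))" for a \<gamma>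
  proof -
    have "(\<integral>x. mpoly_eval \<sigma> x0 n a x * ?v \<gamma> x \<partial>\<mu>) = (\<integral>x. (\<Sum>i<?r. a (\<alpha> i) * (?v (\<alpha> i) x * ?v \<gamma> x)) \<partial>\<mu>)"
      unfolding mpoly_eval_def sum.reindex_bij_betw[OF bij_betw_graded_enum[OF \<alpha>, of n], symmetric]
      by (simp add: sum_distrib_right mult.assoc)
    also have "\<dots> = (\<Sum>i<?r. a (\<alpha> i) * (\<integral>x. ?v (\<alpha> i) x * ?v \<gamma> x \<partial>\<mu>))"
      using int by (subst Bochner_Integration.integral_sum) auto
    finally show ?thesis .
  qed
  let ?A = "\<lambda>N. Vmat \<alpha> \<sigma> x0 n N z" and ?W = "\<lambda>N. Vmat \<alpha> \<sigma> x0 m N (\<lambda>i. f (z i) - y0 + x0)"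
  obtain p where p: "\<And>i. i < ?r \<Longrightarrow> (\<lambda>N. (?W N * pinv (?A N)) $$ (?k, i)) \<longlonglongrightarrow> p i"
    "\<And>i. i < ?r \<Longrightarrow> (\<Sum>l<?r. p l * (\<integral>x. ?v (\<alpha> l) x * ?v (\<alpha> i) x \<partial>\<mu>)) = (\<integral>x. g j x * ?v (\<alpha> i) x \<partial>\<mu>)"
  proof (rule pinv_entry_limit[of ?A ?r "\<lambda>i l. ?v (\<alpha> i) (z l)" ?W ?q ?k "\<lambda>l. g j (z l)"
      "\<lambda>i l. \<integral>x. ?v (\<alpha> i) x * ?v (\<alpha> l) x \<partial>\<mu>" "\<lambda>i. \<integral>x. g j x * ?v (\<alpha> i) x \<partial>\<mu>"])
    show "?A N \<in> carrier_mat ?r N" "?W N \<in> carrier_mat ?q N" for N by (rule Vmat_carrier)+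
    show "?A N $$ (i, l) = ?v (\<alpha> i) (z l)" if "i < ?r" "l < N" for N i l
      using that by (rule Vmat_entry)
    show "?W N $$ (?k, l) = g j (z l)" if "l < N" for N l
      using k that by (simp only: Vmat_entry mono_k)
    show "?k < ?q" by (rule k)
    show "(\<lambda>N. (\<Sum>l<N. ?v (\<alpha> i) (z l) * ?v (\<alpha> i') (z l)) / real N) \<longlonglongrightarrow> (\<integral>x. ?v (\<alpha> i) x * ?v (\<alpha> i') x \<partial>\<mu>)" for i i'
      by (rule gram)
    show "(\<lambda>N. (\<Sum>l<N. g j (z l) * ?v (\<alpha> i) (z l)) / real N) \<longlonglongrightarrow> (\<integral>x. g j x * ?v (\<alpha> i) x \<partial>\<mu>)" for i
      by (rule rhs)
    fix a assume a: "\<And>i. i < ?r \<Longrightarrow> (\<Sum>l<?r. a l * (\<integral>x. ?v (\<alpha> l) x * ?v (\<alpha> i) x \<partial>\<mu>)) = 0"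
    show "\<forall>i<?r. a i = 0"
    proof (intro allI impI)
      fix i assume i: "i < ?r"
      have "(\<integral>x. mpoly_eval \<sigma> x0 n (\<lambda>\<beta>. a (inv_into UNIV \<alpha> \<beta>)) x * ?v \<gamma> x \<partial>\<mu>) = 0" if "mdeg \<gamma> \<le> n" for \<gamma>
        unfolding reindex using a[of "inv_into UNIV \<alpha> \<gamma>"] that less[of "inv_into UNIV \<alpha> \<gamma>"] by (simp add: inv)
      then have "a (inv_into UNIV \<alpha> (\<alpha> i)) = 0"
        by (rule mpoly_orthogonal_imp_zero[where n = n]) (use i less in auto)
      then show "a i = 0" by (simp add: inv)
    qed
  qed blast
  show thesis
  proof (rule that)
    fix \<beta> :: "nat ^ 'd" assume \<beta>: "mdeg \<beta> \<le> m"
    have i: "inv_into UNIV \<alpha> \<beta> < ?q" "inv_into UNIV \<alpha> \<beta> < ?r"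
      using graded_enum_less_rdim[OF \<alpha>, of "inv_into UNIV \<alpha> \<beta>"] \<beta> mn by (simp_all add: inv)
    have "Chat \<alpha> \<sigma> x0 y0 z (\<lambda>i. f (z i)) m n N $$ (?k, inv_into UNIV \<alpha> \<beta>) = (?W N * pinv (?A N)) $$ (?k, inv_into UNIV \<alpha> \<beta>)" for N
    proof -
      have "dim_row (?W N * pinv (?A N)) = ?q" using carrier_matD(1)[OF Vmat_carrier] by simp
      then show ?thesis unfolding Chat_def first_cols_def using k i by (subst index_mat) simp_all
    qed
    then show "(\<lambda>N. Chat \<alpha> \<sigma> x0 y0 z (\<lambda>i. f (z i)) m n N $$ (?k, inv_into UNIV \<alpha> \<beta>)) \<longlonglongrightarrow> p (inv_into UNIV \<alpha> \<beta>)"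
      using p(1)[OF i(2)] by simp
  next
    fix \<gamma> :: "nat ^ 'd" assume \<gamma>: "mdeg \<gamma> \<le> n"
    have "(\<integral>x. (g j x - mpoly_eval \<sigma> x0 n (\<lambda>\<beta>. p (inv_into UNIV \<alpha> \<beta>)) x) * ?v \<gamma> x \<partial>\<mu>) =
        (\<integral>x. g j x * ?v \<gamma> x \<partial>\<mu>) - (\<integral>x. mpoly_eval \<sigma> x0 n (\<lambda>\<beta>. p (inv_into UNIV \<alpha> \<beta>)) x * ?v \<gamma> x \<partial>\<mu>)"
      unfolding left_diff_distrib
      by (intro Bochner_Integration.integral_diff integrable_continuous continuous_intros
        g_cont scaled_mono_continuous mpoly_eval_continuous)
    also have "\<dots> = 0"
      unfolding reindex using p(2)[of "inv_into UNIV \<alpha> \<gamma>"] \<gamma> less[of "inv_into UNIV \<alpha> \<gamma>"] by (simp add: inv)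
    finally show "(\<integral>x. (g j x - mpoly_eval \<sigma> x0 n (\<lambda>\<beta>. p (inv_into UNIV \<alpha> \<beta>)) x) * ?v \<gamma> x \<partial>\<mu>) = 0" .
  qed
qed

theorem theorem7p5:
  fixes \<sigma> :: real
    and f :: "real ^ 'd::finite \<Rightarrow> real ^ 'd"
    and x0 :: "real ^ 'd"
    and H :: "(real ^ 'd \<Rightarrow> real) set"
    and ip :: "(real ^ 'd \<Rightarrow> real) \<Rightarrow> (real ^ 'd \<Rightarrow> real) \<Rightarrow> real"
    and c :: "nat \<Rightarrow> 'd"
    and \<alpha> :: "nat \<Rightarrow> nat ^ 'd"
    and M :: "'w measure"
    and X :: "nat \<Rightarrow> 'w \<Rightarrow> real ^ 'd"
    and \<rho> :: "real ^ 'd \<Rightarrow> real"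
    and U K :: "(real ^ 'd) set"
  assumes "\<sigma> > 0"
    and "Cinfinity f"
    and "graded_enum c \<alpha>"
    and "is_rkhs (exp_kernel \<sigma> x0) H ip"
    and "\<And>\<beta> :: nat ^ 'd. (\<lambda>x. mpow (f x) \<beta>) \<in> H"
    and "prob_space M"
    and "prob_space.indep_vars M (\<lambda>_. borel) X UNIV"
    and "\<And>x. \<rho> x \<ge> 0"
    and "\<And>i. distributed M lborel (X i) (\<lambda>x. ennreal (\<rho> x))"
    and "compact (closure {x. \<rho> x \<noteq> 0})"
    and "open U" and "U \<noteq> {}"
    and "essinf (restrict_space lborel U) \<rho> > 0"
    and "compact K"
  shows "AE \<omega> in M. \<exists>(L1 :: nat \<Rightarrow> nat \<Rightarrow> real) (L2 :: nat \<Rightarrow> real).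
           (\<forall>m n. 1 \<le> m \<and> m \<le> n \<longrightarrow>
              (\<lambda>N. sup_norm_on K (\<lambda>y. f y -
                 fhat c \<alpha> \<sigma> x0 (f x0) (\<lambda>i. X i \<omega>) (\<lambda>i. f (X i \<omega>)) m n N y)) \<longlonglongrightarrow> L1 m n) \<and>
           (\<forall>m\<ge>1. (\<lambda>n. L1 m n) \<longlonglongrightarrow> L2 m) \<and>
           L2 \<longlonglongrightarrow> 0"
proof -
  interpret M: prob_space M by fact
  note \<sigma> = \<open>\<sigma> > 0\<close> and \<alpha> = \<open>graded_enum c \<alpha>\<close> and rkhs = \<open>is_rkhs (exp_kernel \<sigma> x0) H ip\<close>
  interpret H: rkhs_fun H ip "exp_kernel \<sigma> x0" using rkhs by (rule rkhs_funI)
  define \<mu> where "\<mu> = density lborel (\<lambda>x. ennreal (\<rho> x))"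
  have distr: "distr M borel (X i) = \<mu>" for i
  proof -
    have "distr M borel (X i) = distr M lborel (X i)" by (rule distr_cong) auto
    then show ?thesis using distributed_distr_eq_density[OF assms(9)[of i]] by (simp add: \<mu>_def)
  qed
  have X_meas: "X i \<in> borel_measurable M" for i
    using distributed_measurable[OF assms(9)[of i]] by simp
  have "(\<lambda>x. ennreal (\<rho> x)) \<in> borel_measurable borel"
    using distributed_borel_measurable[OF assms(9)[of 0]] by simp
  \<comment> \<open>The density is given as an \<open>ennreal\<close> function; nonnegativity allows
    the real function \<rho> to be recovered from it.\<close>
  then have "(\<lambda>x. enn2real (ennreal (\<rho> x))) \<in> borel_measurable borel" by measurable
  then have \<rho>: "\<rho> \<in> borel_measurable borel" using assms(8) by simp
  have "prob_space \<mu>" unfolding distr[of 0, symmetric] by (rule M.prob_space_distr[OF X_meas])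
  then obtain E where "sampling_measure \<mu> (closure {x. \<rho> x \<noteq> 0}) \<sigma> x0 E"
    unfolding \<mu>_def using sampling_measure_density[OF _ \<rho> assms(8,10) \<sigma> assms(11,12,13), where ?x0.0 = x0] by blast
  then interpret S: sampling_measure \<mu> "closure {x. \<rho> x \<noteq> 0}" \<sigma> x0 E .
  have "Ck 0 f" using \<open>Cinfinity f\<close> unfolding Cinfinity_def by blast
  then have f: "continuous_on UNIV f" by simp
  \<comment> \<open>The normalised components lie in \<open>H\<close>: the coordinates of
    \<open>f\<close> are its powers with unit multi-indices, and the constants are its zeroth
    power.\<close>
  define g where "g = (\<lambda>j y. (f y $ j - f x0 $ j) / \<sigma>)"
  have g_cont: "continuous_on UNIV (g j)" for j
    unfolding g_def using \<sigma> f by (intro continuous_intros) auto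
  have gH: "g j \<in> H" for j
  proof -
    have "(\<lambda>x. f x $ j) = (\<lambda>x. mpow (f x) (axis j 1))"
    proof
      fix x
      have "mpow (f x) (axis j 1) = (\<Prod>i\<in>UNIV. if i = j then f x $ j else 1)"
        unfolding mpow_def by (rule prod.cong) (auto simp: axis_def)
      then show "f x $ j = mpow (f x) (axis j 1)" by simp
    qed
    then have 1: "(\<lambda>x. f x $ j) \<in> H" using assms(5)[of "axis j 1"] by simp
    have "(\<lambda>x. mpow (f x) 0) = (\<lambda>x. 1)" by (simp add: mpow_def)
    then have 2: "(\<lambda>x. 1) \<in> H" using assms(5)[of 0] by simp
    have "g j = (\<lambda>x. (1 / \<sigma>) * (f x $ j - f x0 $ j * 1))" by (simp add: g_def)
    also have "\<dots> \<in> H" by (intro H.scale_mem H.diff_mem 1 H.scale_mem[OF 2])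
    finally show ?thesis .
  qed
  have slln: "AE \<omega> in M. (\<lambda>N. (\<Sum>l<N. \<phi> (X l \<omega>)) / real N) \<longlonglongrightarrow> (\<integral>x. \<phi> x \<partial>\<mu>)"
    if \<phi>: "continuous_on UNIV \<phi>" for \<phi> :: "real ^ 'd \<Rightarrow> real"
  proof -
    have "bounded (\<phi> ` closure {x. \<rho> x \<noteq> 0})"
      using assms(10) \<phi> by (intro compact_imp_bounded compact_continuous_image) (auto intro: continuous_on_subset)
    then obtain B where B: "\<And>x. x \<in> closure {x. \<rho> x \<noteq> 0} \<Longrightarrow> \<bar>\<phi> x\<bar> \<le> B" by (auto simp: bounded_iff)
    have "AE x in \<mu>. \<bar>\<phi> x\<bar> \<le> B" using S.AE_S by eventually_elim (rule B)
    then show ?thesis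
      by (rule M.slln_bounded_function[OF assms(7) distr borel_measurable_continuous_onI[OF \<phi>]])
  qed
  let ?v = "scaled_mono \<sigma> x0"
  \<comment> \<open>Indexing the monomials by natural numbers makes the quantifiers countable; the
    null set is chosen before \<open>m\<close> and \<open>n\<close>.\<close>
  have "AE \<omega> in M. \<forall>i i'. (\<lambda>N. (\<Sum>l<N. ?v (\<alpha> i) (X l \<omega>) * ?v (\<alpha> i') (X l \<omega>)) / real N)
      \<longlonglongrightarrow> (\<integral>x. ?v (\<alpha> i) x * ?v (\<alpha> i') x \<partial>\<mu>)"
    unfolding AE_all_countable by (intro allI slln continuous_intros scaled_mono_continuous)
  moreover have "AE \<omega> in M. \<forall>i j. (\<lambda>N. (\<Sum>l<N. g j (X l \<omega>) * ?v (\<alpha> i) (X l \<omega>)) / real N)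
      \<longlonglongrightarrow> (\<integral>x. g j x * ?v (\<alpha> i) x \<partial>\<mu>)"
    unfolding AE_all_countable by (intro allI slln continuous_intros scaled_mono_continuous g_cont)
  ultimately show ?thesis
  proof eventually_elim
    case (elim \<omega>)
    let ?z = "\<lambda>i. X i \<omega>" and ?y0 = "f x0"
    have surj: "\<exists>i. \<beta> = \<alpha> i" for \<beta>
      using \<alpha> surjD[of \<alpha> \<beta>] by (auto simp: graded_enum_def bij_is_surj)
    have gram: "(\<lambda>N. (\<Sum>l<N. ?v \<beta> (?z l) * ?v \<gamma> (?z l)) / real N) \<longlonglongrightarrow> (\<integral>x. ?v \<beta> x * ?v \<gamma> x \<partial>\<mu>)" for \<beta> \<gamma>
      using elim(1) surj[of \<beta>] surj[of \<gamma>] by blast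
    have rhs: "(\<lambda>N. (\<Sum>l<N. g j (?z l) * ?v \<gamma> (?z l)) / real N) \<longlonglongrightarrow> (\<integral>x. g j x * ?v \<gamma> x \<partial>\<mu>)" for j \<gamma>
      using elim(2) surj[of \<gamma>] by blast
    let ?C = "\<lambda>m n N j \<beta>. Chat \<alpha> \<sigma> x0 ?y0 ?z (\<lambda>i. f (?z i)) m n N $$ (Suc (inv_into {..<CARD('d)} c j), inv_into UNIV \<alpha> \<beta>)"
    define good where "good = (\<lambda>m n j p. (\<forall>\<beta>. mdeg \<beta> \<le> m \<longrightarrow> (\<lambda>N. ?C m n N j \<beta>) \<longlonglongrightarrow> p \<beta>) \<and>
      (\<forall>\<gamma>. mdeg \<gamma> \<le> n \<longrightarrow> (\<integral>x. (g j x - mpoly_eval \<sigma> x0 n p x) * ?v \<gamma> x \<partial>\<mu>) = 0))"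
    \<comment> \<open>\<open>L1\<close> has to be a function of \<open>m\<close> and
      \<open>n\<close>, so the limit coefficients are selected for every pair; they are meaningful
      only for 1 \<le> m \<le> n.\<close>
    define P where "P = (\<lambda>m n j. SOME p. good m n j p)"
    have good: "good m n j (P m n j)" if "1 \<le> m" "m \<le> n" for m n j
    proof -
      have "g j y = (f y $ j - ?y0 $ j) / \<sigma>" for y j by (simp add: g_def)
      from S.Chat_tendsto[OF \<alpha> that f this gram rhs, of j]
      obtain p where "good m n j p" unfolding good_def by blast
      then show ?thesis unfolding P_def by (rule someI[of "good m n j"])
    qed
    have P: "mdeg \<beta> \<le> m \<Longrightarrow> (\<lambda>N. ?C m n N j \<beta>) \<longlonglongrightarrow> P m n j \<beta>"
      "mdeg \<gamma> \<le> n \<Longrightarrow> (\<integral>x. (g j x - mpoly_eval \<sigma> x0 n (P m n j) x) * ?v \<gamma> x \<partial>\<mu>) = 0"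
      if "1 \<le> m" "m \<le> n" for m n j \<beta> \<gamma>
      using good[OF that, of j] unfolding good_def by blast+
    define L1 where "L1 = (\<lambda>m n. sup_norm_on K (\<lambda>y. f y - poly_map \<sigma> x0 ?y0 m (P m n) y))"
    define L2 where "L2 = (\<lambda>m. sup_norm_on K (\<lambda>y. f y - poly_map \<sigma> x0 ?y0 m (\<lambda>j. taylor_coeff \<sigma> x0 ip (g j)) y))"
    have fK: "continuous_on K f" using f by (rule continuous_on_subset) simp
    have "(\<lambda>N. sup_norm_on K (\<lambda>y. f y - fhat c \<alpha> \<sigma> x0 ?y0 ?z (\<lambda>i. f (?z i)) m n N y)) \<longlonglongrightarrow> L1 m n"
      if "1 \<le> m" "m \<le> n" for m n
      unfolding L1_def fhat_eq_poly_map[OF \<alpha> that(1)]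
      by (rule sup_norm_poly_map_tendsto[OF \<open>compact K\<close> fK]) (rule P(1)[OF that])
    moreover have "(\<lambda>n. L1 m n) \<longlonglongrightarrow> L2 m" if m: "m \<ge> 1" for m
      unfolding L1_def L2_def
    proof (rule sup_norm_poly_map_tendsto[OF \<open>compact K\<close> fK])
      \<comment> \<open>With \<open>m\<close> fixed, the projection property of
        \<open>P m n j\<close> is available from \<open>n = m\<close> on, which is the starting
        index passed on here.\<close>
      show "(\<lambda>n. P m n j \<beta>) \<longlonglongrightarrow> taylor_coeff \<sigma> x0 ip (g j) \<beta>" for j \<beta>
        by (rule S.projection_coeff_tendsto[OF rkhs gH g_cont, where ?n0.0 = m]) (rule P(2)[OF m])
    qed
    moreover have "L2 \<longlonglongrightarrow> 0"
      unfolding L2_def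
      by (rule sup_norm_taylor_tendsto[OF \<open>compact K\<close> rkhs \<sigma> gH]) (use \<sigma> in \<open>simp add: g_def\<close>)
    ultimately show ?case by blast
  qed
qed

end
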